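(* Let $p$ be an odd prime, $\mathbb{F}_p$ the field with $p$ elements, $k\ge 2$ an integer, $d=2k$, and $A\subset \mathbb{F}_p$. Put $\mathcal{E}=A^d\subset\mathbb{F}_p^d$ and $\varepsilon=\frac{d}{2}\cdot \frac{2^{k+1}-5}{5\cdot 2^k-5}$. There are constants $C,c>0$ (independent of $p$ and $A$) such that if $|\mathcal{E}|\ge C\, p^{\frac{d}{2}-\varepsilon}$, then \[\left\vert \Delta(\mathcal{E})\cdot \Delta(\mathcal{E})\right\vert\ge c\,p.\]
   Context: For $\mathbf{x}=(x_1,\dots,x_d),\mathbf{y}=(y_1,\dots,y_d)\in\mathbb{F}_p^d$, the distance is $\|\mathbf{x}-\mathbf{y}\|=(x_1-y_1)^2+\cdots+(x_d-y_d)^2\in\mathbb{F}_p$. For $\mathcal{E}\subset\mathbb{F}_p^d$, the distance set is $\Delta(\mathcal{E})=\{\|\mathbf{x}-\mathbf{y}\|:\mathbf{x},\mathbf{y}\in\mathcal{E}\}$, and its product set is $\Delta(\mathcal{E})\cdot\Delta(\mathcal{E})=\{ab: a,b\in\Delta(\mathcal{E})\}$. *)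

theory Defs
  imports "HOL-Number_Theory.Number_Theory" "HOL-Library.FuncSet"
begin

text \<open>F_p is represented by the residues {0..<p} (as integers), arithmetic taken mod p.
  Points of F_p^d are functions on the index set {..<d} (extensional, via PiE).\<close>

definition ff_dist :: "nat \<Rightarrow> nat \<Rightarrow> (nat \<Rightarrow> int) \<Rightarrow> (nat \<Rightarrow> int) \<Rightarrow> int" where
  "ff_dist p d x y = (\<Sum>i<d. (x i - y i)^2) mod int p"

definition dist_set :: "nat \<Rightarrow> nat \<Rightarrow> (nat \<Rightarrow> int) set \<Rightarrow> int set" where
  "dist_set p d E = {ff_dist p d x y | x y. x \<in> E \<and> y \<in> E}"

definition prod_set :: "nat \<Rightarrow> int set \<Rightarrow> int set" where
  "prod_set p S = {(a * b) mod int p | a b. a \<in> S \<and> b \<in> S}"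

end

theory Submission
  imports Defs "HOL-Analysis.Convex"
    "Berlekamp_Zassenhaus.Finite_Field" "Berlekamp_Zassenhaus.Unique_Factorization_Poly"
begin

text \<open>
  Everything rests on one incidence bound: if \<open>S \<subseteq> F\<^sub>p\<^sup>3\<close> has \<open>n \<le> p\<^sup>2\<close> points, at most \<open>k\<close> on a line,
  then \<open>c - c' = a' b - a b'\<close> has \<open>O(n powr (3/2) + k n)\<close> solutions in \<open>S \<times> S\<close>. A point
  is read as a line in three-space whose direction lies on the conic \<open>(1, t, t\<^sup>2)\<close>; the equation
  then says that two lines meet. If there were too many meetings, an irreducible surface of low degree
  would contain many of the lines, each crossing many others inside it. Two crossing lines force the
  second fundamental form to be proportional to the form of the conic, so the surface is umbilic,
  and on an umbilic surface the lines crossing a fixed line are collinear in parameter space.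

  The incidence bound has two applications. It bounds the energy of \<open>(x - y)\<^sup>2 + z\<close>, so sums of \<open>k\<close>
  squared differences of \<open>A\<close> form a set \<open>X\<close> of size about \<open>|A| powr (2 - 2 powr (1 - k))\<close>, which is
  \<open>p powr (3/5)\<close> at the threshold. It also bounds the number of lines rich in points of \<open>X \<times> X\<close>;
  together with the \<open>L\<^sup>2\<close> identity for the lines of small richness this shows that the products
  \<open>(a + b) (c + d)\<close> with \<open>a, b, c, d \<in> X\<close> fill a positive proportion of \<open>F\<^sub>p\<close>. Finally
  \<open>X + X\<close> consists of distances of \<open>A\<^bsup>2k\<^esup>\<close>.
\<close>

subsection \<open>Derivations\<close>

text \<open>The size \<open>p powr (3/5)\<close> is where the two terms of the energy bound balance:
  for \<open>x = |X|\<close> the generic term \<open>x^8 / p\<close> dominates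
  \<open>x powr (11/2) * p powr (1/2)\<close> once \<open>x^5 \<ge> p^3\<close>. The directions
  \<open>(1, t, t^2)\<close> are isotropic for \<open>dx dz - dy^2\<close>, and two such null lines
  of distinct slopes meet exactly when their parameters are orthogonal for a symplectic form. An
  energy therefore becomes an incidence count as soon as its equation is bilinear, which is achieved
  by exchanging one variable between its two sides. Two obstacles shape the incidence proof. In
  characteristic \<open>p\<close> derivatives can vanish unexpectedly, so all relevant degrees stay
  below \<open>p\<close>; the surfaces have degree about \<open>sqrt n\<close>, whence
  \<open>n \<le> p\<^sup>2\<close>. Moreover, counting zeros on a line requires its crossings to be
  distinct points, which concurrent lines would spoil. Therefore incidences are counted between two
  families, each free of internal meetings, obtained from the same points by perturbation over a
  function field.\<close>

definition derivation :: "('a::comm_ring_1 \<Rightarrow> 'a) \<Rightarrow> bool" where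
  "derivation D \<longleftrightarrow> (\<forall>a b. D (a + b) = D a + D b) \<and> (\<forall>a b. D (a * b) = a * D b + D a * b)"

lemma derivation_add: "derivation D \<Longrightarrow> D (a + b) = D a + D b"
  and derivation_mult: "derivation D \<Longrightarrow> D (a * b) = a * D b + D a * b"
  by (simp_all add: derivation_def)

lemma derivation_0: "derivation D \<Longrightarrow> D 0 = 0"
  using derivation_add[of D 0 0] by simp

lemma derivation_1: "derivation D \<Longrightarrow> D 1 = 0"
  using derivation_mult[of D 1 1] by simp

lemma derivation_minus: "derivation D \<Longrightarrow> D (- a) = - D a"
  using derivation_add[of D a "- a"] derivation_0[of D] by (simp add: eq_neg_iff_add_eq_0 add.commute)

lemma derivation_diff: "derivation D \<Longrightarrow> D (a - b) = D a - D b"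
  using derivation_add[of D a "- b"] derivation_minus[of D b] by simp

lemma derivation_numeral: "derivation D \<Longrightarrow> D (numeral n) = 0"
proof -
  assume D: "derivation D"
  have "D (of_nat m) = 0" for m
    by (induction m) (simp_all add: derivation_0[OF D] derivation_1[OF D] derivation_add[OF D])
  from this[of "numeral n"] show ?thesis by simp
qed

lemma derivation_sum: "derivation D \<Longrightarrow> D (sum f A) = (\<Sum>i\<in>A. D (f i))"
  by (induction A rule: infinite_finite_induct) (simp_all add: derivation_0 derivation_add)

lemmas derivation_simps = derivation_0 derivation_1 derivation_add derivation_mult
  derivation_minus derivation_diff derivation_numeral

lemma derivation_pderiv: "derivation (pderiv :: 'a::idom poly \<Rightarrow> _)"
  by (simp add: derivation_def pderiv_add pderiv_mult algebra_simps)

lemma derivation_map_poly: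
  assumes D: "derivation D"
  shows "derivation (map_poly D)"
  unfolding derivation_def
proof (intro conjI allI)
  note D0 = derivation_0[OF D]
  show "map_poly D (a + b) = map_poly D a + map_poly D b" for a b
    by (rule poly_eqI) (simp add: coeff_map_poly D0 derivation_add[OF D])
  show "map_poly D (a * b) = a * map_poly D b + map_poly D a * b" for a b
    by (rule poly_eqI)
      (simp add: coeff_map_poly D0 coeff_mult derivation_sum[OF D] derivation_mult[OF D]
        sum.distrib)
qed

text \<open>The chain rule for substitution: \<open>map_poly D\<close> differentiates the
  coefficients, \<open>pderiv\<close> the variable that is replaced by \<open>Z\<close>.\<close>

lemma derivation_poly:
  assumes D: "derivation D"
  shows "D (poly F Z) = poly (map_poly D F) Z + poly (pderiv F) Z * D Z"
proof (induction F)
  case 0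
  then show ?case by (simp add: derivation_0[OF D])
next
  case (pCons a F)
  have "map_poly D (pCons a F) = pCons (D a) (map_poly D F)"
    using pCons.hyps by (intro map_poly_pCons) (auto simp: derivation_0[OF D])
  then show ?case
    by (simp add: derivation_simps[OF D] pCons.IH pderiv_pCons algebra_simps)
qed

subsection \<open>Partial degrees\<close>

lemma coeff_mult_le:
  assumes "degree p \<le> n" "degree q \<le> m"
  shows "coeff (p * q) (n + m) = coeff p n * coeff q m"
proof -
  have "coeff (p * q) (n + m) = (\<Sum>i\<le>n + m. coeff p i * coeff q (n + m - i))"
    by (simp add: coeff_mult)
  also have "\<dots> = (\<Sum>i\<in>{n}. coeff p i * coeff q (n + m - i))"
  proof (rule sum.mono_neutral_right)
    show "\<forall>i\<in>{..n + m} - {n}. coeff p i * coeff q (n + m - i) = 0"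
    proof
      fix i assume i: "i \<in> {..n + m} - {n}"
      show "coeff p i * coeff q (n + m - i) = 0"
      proof (cases "i > n")
        case True
        with assms show ?thesis by (simp add: coeff_eq_0)
      next
        case False
        with i have "n + m - i > m" by auto
        with assms show ?thesis by (simp add: coeff_eq_0)
      qed
    qed
  qed auto
  finally show ?thesis by simp
qed

text \<open>The names anticipate the nesting used for surfaces, with \<open>x\<close> outermost,
  \<open>z\<close> in the middle and \<open>y\<close> innermost: \<open>degree\<close>,
  \<open>zdeg\<close> and \<open>ydeg\<close> are then the degrees in \<open>x\<close>,
  \<open>z\<close> and \<open>y\<close>.\<close>

definition zdeg :: "'a::zero poly poly \<Rightarrow> nat" where
  "zdeg f = (LEAST n. \<forall>i. degree (coeff f i) \<le> n)"

definition ydeg :: "'a::zero poly poly poly \<Rightarrow> nat" where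
  "ydeg f = (LEAST n. \<forall>i j. degree (coeff (coeff f i) j) \<le> n)"

lemma zdeg: "degree (coeff f i) \<le> zdeg f"
proof -
  have "\<forall>i. degree (coeff f i) \<le> (\<Sum>i\<le>degree f. degree (coeff f i))"
  proof
    fix i show "degree (coeff f i) \<le> (\<Sum>i\<le>degree f. degree (coeff f i))"
    proof (cases "i \<le> degree f")
      case True
      then show ?thesis by (intro member_le_sum) auto
    qed (simp add: coeff_eq_0)
  qed
  from LeastI[where P = "\<lambda>n. \<forall>i. degree (coeff f i) \<le> n", OF this] show ?thesis
    by (simp add: zdeg_def)
qed

lemma zdeg_le: "(\<And>i. degree (coeff f i) \<le> n) \<Longrightarrow> zdeg f \<le> n"
  unfolding zdeg_def by (rule Least_le) simp

lemma ydeg: "degree (coeff (coeff f i) j) \<le> ydeg f"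
proof -
  have "\<forall>i j. degree (coeff (coeff f i) j) \<le> (\<Sum>i\<le>degree f. (\<Sum>j\<le>degree (coeff f i). degree (coeff (coeff f i) j)))"
  proof (intro allI)
    fix i j
    show "degree (coeff (coeff f i) j) \<le> (\<Sum>i\<le>degree f. (\<Sum>j\<le>degree (coeff f i). degree (coeff (coeff f i) j)))"
    proof (cases "i \<le> degree f \<and> j \<le> degree (coeff f i)")
      case True
      then have "degree (coeff (coeff f i) j) \<le> (\<Sum>j\<le>degree (coeff f i). degree (coeff (coeff f i) j))"
        by (intro member_le_sum) auto
      also have "\<dots> \<le> (\<Sum>i\<le>degree f. (\<Sum>j\<le>degree (coeff f i). degree (coeff (coeff f i) j)))"
        using True by (intro member_le_sum[of i _ "\<lambda>i. (\<Sum>j\<le>degree (coeff f i). degree (coeff (coeff f i) j))"]) auto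
      finally show ?thesis .
    qed (auto simp: coeff_eq_0)
  qed
  from LeastI[where P = "\<lambda>n. \<forall>i j. degree (coeff (coeff f i) j) \<le> n", OF this] show ?thesis
    by (simp add: ydeg_def)
qed

lemma ydeg_le: "(\<And>i j. degree (coeff (coeff f i) j) \<le> n) \<Longrightarrow> ydeg f \<le> n"
  unfolding ydeg_def by (rule Least_le) simp

lemma zdeg_attained:
  assumes "f \<noteq> 0"
  shows "\<exists>i. coeff (coeff f i) (zdeg f) \<noteq> 0"
proof (rule ccontr)
  assume a: "\<not> ?thesis"
  have lt: "degree (coeff f i) < zdeg f" if "coeff f i \<noteq> 0" for i
  proof -
    have "degree (coeff f i) \<noteq> zdeg f"
      using a that leading_coeff_0_iff[of "coeff f i"] by metis
    with zdeg[of f i] show ?thesis by simp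
  qed
  from assms have "lead_coeff f \<noteq> 0" by simp
  from lt[OF this] have pos: "zdeg f > 0" by simp
  have "degree (coeff f i) \<le> zdeg f - 1" for i
    using lt[of i] by (cases "coeff f i = 0") auto
  from zdeg_le[of f, OF this] pos show False by simp
qed

lemma ydeg_attained:
  assumes "f \<noteq> 0"
  shows "\<exists>i j. coeff (coeff (coeff f i) j) (ydeg f) \<noteq> 0"
proof (rule ccontr)
  assume a: "\<not> ?thesis"
  have lt: "degree (coeff (coeff f i) j) < ydeg f" if "coeff (coeff f i) j \<noteq> 0" for i j
  proof -
    have "degree (coeff (coeff f i) j) \<noteq> ydeg f"
      using a that leading_coeff_0_iff[of "coeff (coeff f i) j"] by metis
    with ydeg[of f i j] show ?thesis by simp
  qed
  from assms have "lead_coeff (lead_coeff f) \<noteq> 0" by simp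
  from lt[OF this] have pos: "ydeg f > 0" by simp
  have "degree (coeff (coeff f i) j) \<le> ydeg f - 1" for i j
    using lt[of i j] by (cases "coeff (coeff f i) j = 0") auto
  from ydeg_le[of f, OF this] pos show False by simp
qed

text \<open>Extracting the top coefficient in the inner variable from each outer coefficient turns
  the product into a product of nonzero polynomials over a domain, so no cancellation can lower the
  degree. The same idea proves \<open>ydeg_mult\<close>.\<close>

lemma zdeg_mult:
  fixes f g :: "'a::idom poly poly"
  assumes "f \<noteq> 0" "g \<noteq> 0"
  shows "zdeg (f * g) = zdeg f + zdeg g"
proof (rule antisym)
  show "zdeg (f * g) \<le> zdeg f + zdeg g"
    by (rule zdeg_le, subst coeff_mult, rule degree_sum_le)
      (auto intro!: order_trans[OF degree_mult_le] add_mono zdeg)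
  define F where "F n h = map_poly (\<lambda>c. coeff c n) h" for n and h :: "'a poly poly"
  have cF: "coeff (F n h) i = coeff (coeff h i) n" for n h i
    by (simp add: F_def coeff_map_poly)
  have "F (zdeg f + zdeg g) (f * g) = F (zdeg f) f * F (zdeg g) g"
    by (rule poly_eqI) (simp add: cF coeff_mult[of f] coeff_mult[of "F (zdeg f) f"] coeff_sum
        coeff_mult_le[OF zdeg zdeg])
  moreover have "F (zdeg f) f \<noteq> 0" "F (zdeg g) g \<noteq> 0"
    using zdeg_attained[OF assms(1)] zdeg_attained[OF assms(2)] cF by (metis coeff_0)+
  ultimately have "F (zdeg f + zdeg g) (f * g) \<noteq> 0" by simp
  then obtain i where "coeff (coeff (f * g) i) (zdeg f + zdeg g) \<noteq> 0"
    using cF by (metis leading_coeff_0_iff)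
  from le_degree[OF this] zdeg[of "f * g" i] show "zdeg f + zdeg g \<le> zdeg (f * g)" by simp
qed

lemma ydeg_mult:
  fixes f g :: "'a::idom poly poly poly"
  assumes "f \<noteq> 0" "g \<noteq> 0"
  shows "ydeg (f * g) = ydeg f + ydeg g"
proof (rule antisym)
  have cm: "coeff (coeff (h * k) i) j = (\<Sum>a\<le>i. \<Sum>b\<le>j. coeff (coeff h a) b * coeff (coeff k (i - a)) (j - b))"
    for h k :: "'b::comm_semiring_0 poly poly" and i j
    by (simp add: coeff_mult coeff_sum)
  show "ydeg (f * g) \<le> ydeg f + ydeg g"
  proof (rule ydeg_le)
    fix i j
    show "degree (coeff (coeff (f * g) i) j) \<le> ydeg f + ydeg g"
      unfolding cm
    proof (intro degree_sum_le finite_atMost)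
      fix a b
      show "degree (coeff (coeff f a) b * coeff (coeff g (i - a)) (j - b)) \<le> ydeg f + ydeg g"
        by (rule order_trans[OF degree_mult_le add_mono[OF ydeg ydeg]])
    qed
  qed
  define F where "F n h = map_poly (map_poly (\<lambda>c. coeff c n)) h" for n and h :: "'a poly poly poly"
  have cF: "coeff (coeff (F n h) i) j = coeff (coeff (coeff h i) j) n" for n h i j
    by (simp add: F_def coeff_map_poly)
  have "F (ydeg f + ydeg g) (f * g) = F (ydeg f) f * F (ydeg g) g"
    by (intro poly_eqI) (simp only: cF cm coeff_sum coeff_mult_le[OF ydeg ydeg])
  moreover have "F (ydeg f) f \<noteq> 0" "F (ydeg g) g \<noteq> 0"
    using ydeg_attained[OF assms(1)] ydeg_attained[OF assms(2)] cF by (metis coeff_0)+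
  ultimately have "F (ydeg f + ydeg g) (f * g) \<noteq> 0" by simp
  then obtain i j where "coeff (coeff (coeff (f * g) i) j) (ydeg f + ydeg g) \<noteq> 0"
    using cF by (metis leading_coeff_0_iff)
  from le_degree[OF this] ydeg[of "f * g" i j] show "ydeg f + ydeg g \<le> ydeg (f * g)" by simp
qed

text \<open>The sum of the partial degrees replaces the total degree. It is additive on products, is
  positive on nonzero nonunits over a field, and bounds the degree of a restriction to a
  line.\<close>

definition tdeg :: "'a::zero poly poly poly \<Rightarrow> nat" where
  "tdeg f = degree f + zdeg f + ydeg f"

lemma tdeg_mult:
  fixes f g :: "'a::idom poly poly poly"
  assumes "f \<noteq> 0" "g \<noteq> 0"
  shows "tdeg (f * g) = tdeg f + tdeg g"
  using assms by (simp add: tdeg_def zdeg_mult ydeg_mult degree_mult_eq)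

lemma tdeg_eq_0_imp_unit:
  fixes f :: "'a::field poly poly poly"
  assumes "f \<noteq> 0" "tdeg f = 0"
  shows "f dvd 1"
proof -
  from assms(2) have "degree f = 0" by (simp add: tdeg_def)
  then obtain c where c: "f = [:c:]" by (rule degree_eq_zeroE)
  have "degree c = 0" using zdeg[of f 0] assms(2) by (simp add: c tdeg_def)
  then obtain b where b: "c = [:b:]" by (rule degree_eq_zeroE)
  have "degree b = 0" using ydeg[of f 0 0] assms(2) by (simp add: c b tdeg_def)
  then obtain a where a: "b = [:a:]" by (rule degree_eq_zeroE)
  have "f * [:[:[:inverse a:]:]:] = 1" using assms(1) by (simp add: c b a pCons_one)
  then show ?thesis by (metis dvd_triv_left)
qed

subsection \<open>Homogeneous linear systems\<close>

text \<open>Gaussian elimination by cross-multiplication instead of division, because the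
  elimination below works with coefficients in a polynomial ring.\<close>

lemma homogeneous_system_solution:
  fixes a :: "'j \<Rightarrow> 'i \<Rightarrow> 'a::idom"
  assumes "finite J" "finite I" "card J < card I"
  shows "\<exists>c. (\<exists>i\<in>I. c i \<noteq> 0) \<and> (\<forall>j\<in>J. (\<Sum>i\<in>I. a j i * c i) = 0)"
  using assms
proof (induction J arbitrary: I a rule: finite_induct)
  case empty
  then obtain i where "i \<in> I" by fastforce
  then show ?case by (intro exI[of _ "\<lambda>_. 1"]) auto
next
  case (insert j J)
  show ?case
  proof (cases "\<forall>i\<in>I. a j i = 0")
    case True
    from insert have "card J < card I" by simp
    from insert.IH[OF insert.prems(1) this, of a] True show ?thesis by auto
  next
    case False
    then obtain i0 where i0: "i0 \<in> I" "a j i0 \<noteq> 0" by auto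
    let ?I = "I - {i0}"
    have "card J < card ?I" using insert i0 by simp
    from insert.IH[OF _ this, of "\<lambda>j' i. a j i0 * a j' i - a j' i0 * a j i"] insert.prems(1)
    obtain c where c: "\<exists>i\<in>?I. c i \<noteq> 0"
      "\<forall>j'\<in>J. (\<Sum>i\<in>?I. (a j i0 * a j' i - a j' i0 * a j i) * c i) = 0" by auto
    define c' where "c' i = (if i = i0 then - (\<Sum>i\<in>?I. a j i * c i) else a j i0 * c i)" for i
    have split: "(\<Sum>i\<in>I. b i * c' i) = (\<Sum>i\<in>?I. (a j i0 * b i - b i0 * a j i) * c i)" for b
    proof -
      have "(\<Sum>i\<in>I. b i * c' i) = b i0 * c' i0 + (\<Sum>i\<in>?I. b i * c' i)"
        using insert.prems(1) i0(1) by (rule sum.remove)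
      also have "(\<Sum>i\<in>?I. b i * c' i) = (\<Sum>i\<in>?I. b i * (a j i0 * c i))"
        by (rule sum.cong) (auto simp: c'_def)
      finally show ?thesis
        by (simp add: c'_def sum_distrib_left sum_subtractf[symmetric] sum_negf[symmetric]
            sum.distrib[symmetric] algebra_simps)
    qed
    show ?thesis
    proof (intro exI[of _ c'] conjI ballI)
      show "\<exists>i\<in>I. c' i \<noteq> 0" using c(1) i0 by (auto simp: c'_def)
    next
      fix j' assume "j' \<in> insert j J"
      then show "(\<Sum>i\<in>I. a j' i * c' i) = 0" using c(2) by (auto simp: split)
    qed
  qed
qed

subsection \<open>Restriction to lines\<close>

text \<open>
  A trivariate polynomial in \<open>x, y, z\<close> is nested with \<open>x\<close> outermost and \<open>y\<close> innermost. The triple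
  \<open>(t, u, g)\<close> with \<open>t \<noteq> 0\<close> stands for the line \<open>x = (y - u) / t\<close>, \<open>z = g + t y\<close>, whose direction is
  \<open>(1, t, t\<^sup>2)\<close>; \<open>res\<close> restricts to this line with \<open>y\<close> as parameter. For \<open>t = 0\<close> the formula is junk.
\<close>

type_synonym 'k line = "'k \<times> 'k \<times> 'k"

definition res :: "'k::field line \<Rightarrow> 'k poly poly poly \<Rightarrow> 'k poly" where
  "res l f = (case l of (t, u, g) \<Rightarrow> poly (poly f [:[:- u / t, 1 / t:]:]) [:g, t:])"

definition ev :: "'k::field \<Rightarrow> 'k \<Rightarrow> 'k \<Rightarrow> 'k poly poly poly \<Rightarrow> 'k" where
  "ev x y z f = poly (poly (poly f [:[:x:]:]) [:z:]) y"

lemma res_hom: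
  "res l 0 = 0" "res l 1 = 1" "res l (f + h) = res l f + res l h" "res l (f - h) = res l f - res l h"
  "res l (- f) = - res l f" "res l (f * h) = res l f * res l h"
  by (simp_all add: res_def split: prod.splits)

lemma ev_hom:
  "ev x y z 0 = 0" "ev x y z 1 = 1" "ev x y z (f + h) = ev x y z f + ev x y z h"
  "ev x y z (f - h) = ev x y z f - ev x y z h"
  "ev x y z (- f) = - ev x y z f" "ev x y z (f * h) = ev x y z f * ev x y z h"
  by (simp_all add: ev_def)

lemma ev_numeral: "ev x y z (numeral n) = numeral n"
  by (simp add: ev_def)

lemma ev_power: "ev x y z (f ^ n) = ev x y z f ^ n"
  by (induction n) (simp_all add: ev_hom)

lemma poly_res: "poly (res (t, u, g) f) y = ev ((y - u) / t) y (g + t * y) f"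
proof -
  have 1: "poly (poly F Z) y = poly (poly F [:poly Z y:]) y" for F :: "'a poly poly" and Z
    by (induction F) simp_all
  have 2: "poly (poly (poly f [:X:]) [:z:]) y = poly (poly (poly f [:[:poly X y:]:]) [:z:]) y" for X z
    by (induction f) simp_all
  have "poly [:- u / t, 1 / t:] y = (y - u) / t" by (simp add: field_simps diff_divide_distrib)
  moreover have "poly [:g, t:] y = g + t * y" by (simp add: mult.commute)
  ultimately show ?thesis unfolding res_def ev_def
    by (simp only: prod.case 1[of _ "[:g, t:]"] 2[of "[:- u / t, 1 / t:]"])
qed

definition dX :: "'k::idom poly poly poly \<Rightarrow> 'k poly poly poly" where "dX = pderiv"
definition dY :: "'k::idom poly poly poly \<Rightarrow> 'k poly poly poly" where "dY = map_poly (map_poly pderiv)"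
definition dZ :: "'k::idom poly poly poly \<Rightarrow> 'k poly poly poly" where "dZ = map_poly pderiv"

lemma derivation_dX: "derivation dX" and derivation_dY: "derivation dY" and derivation_dZ: "derivation dZ"
  by (simp_all add: dX_def dY_def dZ_def derivation_pderiv derivation_map_poly)

lemma pderiv_res:
  "pderiv (res (t, u, g) f) =
     res (t, u, g) (dY f) + smult (1 / t) (res (t, u, g) (dX f)) + smult t (res (t, u, g) (dZ f))"
proof -
  let ?X = "[:- u / t, 1 / t:]" and ?Z = "[:g, t:]"
  have mX: "map_poly pderiv [:?X:] = [:[:1 / t:]:]"
    by (rule poly_eqI) (simp add: coeff_map_poly coeff_pCons pderiv_pCons split: nat.split)
  have "pderiv (res (t, u, g) f) = poly (map_poly pderiv (poly f [:?X:])) ?Z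
      + poly (pderiv (poly f [:?X:])) ?Z * pderiv ?Z"
    unfolding res_def by (simp only: prod.case derivation_poly[OF derivation_pderiv])
  also have "map_poly pderiv (poly f [:?X:]) = poly (dY f) [:?X:] + poly (dX f) [:?X:] * [:[:1 / t:]:]"
    unfolding dX_def dY_def
    by (subst derivation_poly[OF derivation_map_poly[OF derivation_pderiv]]) (simp only: mX)
  also have "pderiv (poly f [:?X:]) = poly (dZ f) [:?X:]"
    unfolding dZ_def by (subst derivation_poly[OF derivation_pderiv]) (simp add: pderiv_pCons)
  finally show ?thesis by (simp add: res_def pderiv_pCons algebra_simps)
qed

lemma map_poly_comp_0: "g 0 = 0 \<Longrightarrow> h 0 = 0 \<Longrightarrow> map_poly g (map_poly h p) = map_poly (\<lambda>x. g (h x)) p"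
  by (rule poly_eqI) (simp add: coeff_map_poly)

lemma pderiv_map_poly:
  assumes D: "derivation D"
  shows "pderiv (map_poly D p) = map_poly D (pderiv p)"
proof (rule poly_eqI)
  have "D (of_nat m) = 0" for m
    by (induction m) (simp_all add: derivation_0[OF D] derivation_1[OF D] derivation_add[OF D])
  then show "coeff (pderiv (map_poly D p)) n = coeff (map_poly D (pderiv p)) n" for n
    by (simp add: coeff_pderiv coeff_map_poly derivation_0[OF D] derivation_mult[OF D] del: of_nat_Suc)
qed

lemma d_commute: "dX (dY f) = dY (dX f)" "dX (dZ f) = dZ (dX f)" "dZ (dY f) = dY (dZ f)"
  by (simp_all add: dX_def dY_def dZ_def pderiv_map_poly derivation_map_poly derivation_pderiv
      map_poly_comp_0 map_poly_0)

subsection \<open>Degree bounds\<close>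

definition pdeg_le :: "nat \<Rightarrow> nat \<Rightarrow> nat \<Rightarrow> 'k::zero poly poly poly \<Rightarrow> bool" where
  "pdeg_le a b c f \<longleftrightarrow> degree f \<le> a \<and> (\<forall>i. degree (coeff f i) \<le> b) \<and>
     (\<forall>i j. degree (coeff (coeff f i) j) \<le> c)"

lemma pdeg_le_self: "pdeg_le (degree f) (zdeg f) (ydeg f) f"
  by (simp add: pdeg_le_def zdeg ydeg)

lemma tdeg_le: "pdeg_le a b c f \<Longrightarrow> tdeg f \<le> a + b + c"
  unfolding pdeg_le_def tdeg_def by (intro add_mono zdeg_le ydeg_le) auto

lemma pdeg_le_add: "pdeg_le a b c f \<Longrightarrow> pdeg_le a b c g \<Longrightarrow> pdeg_le a b c (f + g)"
  by (simp add: pdeg_le_def degree_add_le)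

lemma pdeg_le_diff: "pdeg_le a b c f \<Longrightarrow> pdeg_le a b c g \<Longrightarrow> pdeg_le a b c (f - g)"
  for f g :: "'k::ab_group_add poly poly poly"
  by (simp add: pdeg_le_def degree_diff_le)

lemma coeff_coeff_mult:
  "coeff (coeff (h * k) i) j = (\<Sum>a\<le>i. \<Sum>b\<le>j. coeff (coeff h a) b * coeff (coeff k (i - a)) (j - b))"
  for h k :: "'b::comm_semiring_0 poly poly"
  by (simp add: coeff_mult coeff_sum)

lemma pdeg_le_mult:
  fixes f g :: "'k::comm_semiring_0 poly poly poly"
  assumes "pdeg_le a b c f" "pdeg_le a' b' c' g"
  shows "pdeg_le (a + a') (b + b') (c + c') (f * g)"
  unfolding pdeg_le_def
proof (intro conjI allI)
  note d = assms[unfolded pdeg_le_def]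
  show "degree (f * g) \<le> a + a'"
    using d by (intro order_trans[OF degree_mult_le] add_mono) auto
  show "degree (coeff (f * g) i) \<le> b + b'" for i
    unfolding coeff_mult
    using d by (intro degree_sum_le finite_atMost order_trans[OF degree_mult_le] add_mono) auto
  show "degree (coeff (coeff (f * g) i) j) \<le> c + c'" for i j
    unfolding coeff_coeff_mult
    using d by (intro degree_sum_le finite_atMost order_trans[OF degree_mult_le] add_mono) auto
qed

lemma degree_of_nat_mult_le: "degree (of_nat n * p) \<le> degree p"
  for p :: "'a::comm_semiring_1 poly"
  by (rule order_trans[OF degree_mult_le]) simp

lemma pdeg_le_d:
  fixes f :: "'k::idom poly poly poly"
  assumes "pdeg_le a b c f"
  shows "pdeg_le a b c (dX f)" "pdeg_le a b c (dY f)" "pdeg_le a b c (dZ f)"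
proof -
  note d = assms[unfolded pdeg_le_def]
  have pd: "degree (pderiv p) \<le> degree p" for p :: "'b::idom poly"
    by (rule degree_le) (simp add: coeff_pderiv coeff_eq_0)
  have on: "of_nat n * q = [:of_nat n:] * q" for n and q :: "'b::comm_semiring_1 poly"
    by (simp add: of_nat_poly)
  show "pdeg_le a b c (dX f)"
    unfolding pdeg_le_def dX_def coeff_pderiv
  proof (intro conjI allI)
    show "degree (pderiv f) \<le> a" using d pd order_trans by blast
    show "degree (of_nat (Suc i) * coeff f (Suc i)) \<le> b" for i
      using d degree_of_nat_mult_le order_trans by blast
    have "coeff (of_nat n * q) j = of_nat n * coeff q j" for n j and q :: "'k poly poly"
      by (simp add: on)
    then show "degree (coeff (of_nat (Suc i) * coeff f (Suc i)) j) \<le> c" for i j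
      using d degree_of_nat_mult_le order_trans by metis
  qed
  show "pdeg_le a b c (dY f)"
    unfolding pdeg_le_def dY_def
  proof (intro conjI allI)
    show "degree (map_poly (map_poly pderiv) f) \<le> a" using d map_poly_degree_leq order_trans by blast
    show "degree (coeff (map_poly (map_poly pderiv) f) i) \<le> b" for i
      using d map_poly_degree_leq[of pderiv "coeff f i"] order_trans by (simp add: coeff_map_poly) blast
    show "degree (coeff (coeff (map_poly (map_poly pderiv) f) i) j) \<le> c" for i j
      using d pd[of "coeff (coeff f i) j"] order_trans by (simp add: coeff_map_poly) blast
  qed
  show "pdeg_le a b c (dZ f)"
    unfolding pdeg_le_def dZ_def
  proof (intro conjI allI)
    show "degree (map_poly pderiv f) \<le> a" using d map_poly_degree_leq order_trans by blast
    show "degree (coeff (map_poly pderiv f) i) \<le> b" for i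
      using d pd[of "coeff f i"] order_trans by (simp add: coeff_map_poly) blast
    show "degree (coeff (coeff (map_poly pderiv f) i) j) \<le> c" for i j
      using d degree_of_nat_mult_le[of "Suc j" "coeff (coeff f i) (Suc j)"] order_trans
      by (simp add: coeff_map_poly coeff_pderiv) blast
  qed
qed

lemma degree_res:
  assumes "pdeg_le a b c f"
  shows "degree (res l f) \<le> a + b + c"
proof (cases l)
  case (fields t u g)
  note d = assms[unfolded pdeg_le_def]
  let ?X = "[:- u / t, 1 / t:]"
  have lin: "degree ([:v, w:] ^ n) \<le> n" for v w :: 'a and n
    by (rule order_trans[OF degree_power_le]) (simp add: degree_pCons_le le_trans[OF mult_le_mono1[of "degree [:v, w:]" 1]])
  define F where "F = poly f [:?X:]"
  have F: "F = (\<Sum>i\<le>degree f. smult (?X ^ i) (coeff f i))"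
    unfolding F_def poly_altdef by (rule sum.cong) (auto simp: poly_const_pow mult.commute)
  have F1: "degree F \<le> b"
    unfolding F using d by (intro degree_sum_le finite_atMost order_trans[OF degree_smult_le]) auto
  have F2: "degree (coeff F j) \<le> a + c" for j
    unfolding F coeff_sum coeff_smult
  proof (intro degree_sum_le finite_atMost)
    fix i assume "i \<in> {..degree f}"
    then have "i \<le> a" using d by auto
    then show "degree (?X ^ i * coeff (coeff f i) j) \<le> a + c"
      using d lin[of "- u / t" "1 / t" i] by (intro order_trans[OF degree_mult_le] add_mono) auto
  qed
  have "res l f = poly F [:g, t:]"
    by (simp add: res_def fields F_def)
  also have "\<dots> = (\<Sum>j\<le>degree F. coeff F j * [:g, t:] ^ j)"
    by (rule poly_altdef)
  also have "degree \<dots> \<le> a + b + c"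
  proof (intro degree_sum_le finite_atMost)
    fix j assume "j \<in> {..degree F}"
    then have "j \<le> b" using F1 by auto
    then show "degree (coeff F j * [:g, t:] ^ j) \<le> a + b + c"
      using F2[of j] lin[of g t j] degree_mult_le[of "coeff F j" "[:g, t:] ^ j"] by linarith
  qed
  finally show ?thesis .
qed

lemma degree_res_tdeg: "degree (res l f) \<le> tdeg f"
  using degree_res[OF pdeg_le_self] by (simp add: tdeg_def)

subsection \<open>Elimination and common lines\<close>

text \<open>
  A dimension count replaces the resultant: the pairs \<open>(A, B)\<close> of bounded degree outnumber the
  coefficients that have to vanish.
\<close>

lemma eliminate:
  fixes f g :: "'a::idom poly poly"
  assumes f: "prime_elem f" "\<not> f dvd g" "degree f \<ge> 1" "zdeg f \<le> b"
    and g: "degree g \<le> m" "m \<ge> 1" "zdeg g \<le> b'"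
  shows "\<exists>A B w. A * f + B * g = [:w:] \<and> w \<noteq> 0 \<and> degree w \<le> m * b + degree f * b'"
proof -
  define e where "e = degree f"
  \<comment> \<open>This is the degree of the resultant. With it there is exactly one unknown more
    than there are equations.\<close>
  define N where "N = m * b + e * b'"
  have e: "e \<ge> 1" using f by (simp add: e_def)
  have Nb: "b \<le> N" "b' \<le> N" using g e unfolding N_def
    by (metis le_add1 le_trans mult_le_mono1 nat_mult_1, metis le_add2 le_trans mult_le_mono1 nat_mult_1)
  \<comment> \<open>The flag distinguishes coefficients of \<open>A\<close> from those of
    \<open>B\<close>. In \<open>J\<close> the outer exponent starts at 1, since the constant term of
    \<open>A * f + B * g\<close> is the part that is kept.\<close>
  define I where "I = {True} \<times> ({..<m} \<times> {..N - b}) \<union> {False} \<times> ({..<e} \<times> {..N - b'})"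
  define J where "J = {1..e + m - 1} \<times> {..N}"
  define h where "h = (\<lambda>(s, i, j). monom (monom (1::'a) j) i * (if s then f else g))"
  have finI: "finite I" and finJ: "finite J" by (simp_all add: I_def J_def)
  have "card I = m * (N - b + 1) + e * (N - b' + 1)"
    unfolding I_def by (subst card_Un_disjoint) (auto simp: card_cartesian_product)
  moreover have "card J = (e + m - 1) * (N + 1)"
    unfolding J_def by (simp add: card_cartesian_product)
  moreover have "(e + m - 1) * (N + 1) < m * (N - b + 1) + e * (N - b' + 1)"
  proof -
    obtain x y where x: "N = b + x" and y: "N = b' + y" using Nb le_Suc_ex by metis
    have "m * (x + 1) + e * (y + 1) + N = m * (N + 1) + e * (N + 1)"
      by (subst N_def, subst (1) x, subst (1) y) (simp add: algebra_simps)
    also have "\<dots> = (e + m - 1) * (N + 1) + (N + 1)"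
      using e by (cases e) (simp_all add: algebra_simps)
    finally have "(e + m - 1) * (N + 1) < m * (x + 1) + e * (y + 1)" by linarith
    moreover have "N - b = x" "N - b' = y" using x y by linarith+
    ultimately show ?thesis by simp
  qed
  ultimately have "card J < card I" by simp
  from homogeneous_system_solution[OF finJ finI this, of "\<lambda>q s. coeff (coeff (h s) (fst q)) (snd q)"]
  obtain c where c: "\<exists>s\<in>I. c s \<noteq> 0"
    "\<forall>q\<in>J. (\<Sum>s\<in>I. coeff (coeff (h s) (fst q)) (snd q) * c s) = 0"
    by blast
  define A where "A = (\<Sum>(i, j)\<in>{..<m} \<times> {..N - b}. monom (monom (c (True, i, j)) j) i)"
  define B where "B = (\<Sum>(i, j)\<in>{..<e} \<times> {..N - b'}. monom (monom (c (False, i, j)) j) i)"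
  define H where "H = A * f + B * g"
  have mm: "[:[:x:]:] * monom (monom 1 j) i = monom (monom x j) i" for x :: 'a and i j
    by (simp add: smult_monom)
  have H: "H = (\<Sum>s\<in>I. [:[:c s:]:] * h s)"
  proof -
    have "(\<Sum>s\<in>I. [:[:c s:]:] * h s) = (\<Sum>s\<in>{True} \<times> ({..<m} \<times> {..N - b}). [:[:c s:]:] * h s)
       + (\<Sum>s\<in>{False} \<times> ({..<e} \<times> {..N - b'}). [:[:c s:]:] * h s)"
      unfolding I_def by (rule sum.union_disjoint) auto
    also have "(\<Sum>s\<in>{True} \<times> ({..<m} \<times> {..N - b}). [:[:c s:]:] * h s) = A * f"
      unfolding A_def sum_distrib_right
      by (rule sum.reindex_bij_witness[of _ "\<lambda>x. (True, x)" snd])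
        (auto simp: h_def mm mult.assoc[symmetric] simp del: mult_pCons_left)
    also have "(\<Sum>s\<in>{False} \<times> ({..<e} \<times> {..N - b'}). [:[:c s:]:] * h s) = B * g"
      unfolding B_def sum_distrib_right
      by (rule sum.reindex_bij_witness[of _ "\<lambda>x. (False, x)" snd])
        (auto simp: h_def mm mult.assoc[symmetric] simp del: mult_pCons_left)
    finally show ?thesis by (simp add: H_def)
  qed
  have dm: "degree (monom p i) \<le> i" for p :: "'b::zero" and i by (rule degree_monom_le)
  have degA: "degree A \<le> m - 1" "degree (coeff A i) \<le> N - b" for i
  proof -
    show "degree A \<le> m - 1"
      unfolding A_def
    proof (intro degree_sum_le)
      fix x assume "x \<in> {..<m} \<times> {..N - b}"
      then show "degree (case x of (i, j) \<Rightarrow> monom (monom (c (True, i, j)) j) i) \<le> m - 1"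
        using dm by (cases x) (auto intro: order_trans[OF dm])
    qed simp
    show "degree (coeff A i) \<le> N - b" unfolding A_def coeff_sum
    proof (intro degree_sum_le)
      fix x assume "x \<in> {..<m} \<times> {..N - b}"
      then show "degree (coeff (case x of (i, j) \<Rightarrow> monom (monom (c (True, i, j)) j) i) i) \<le> N - b"
        by (cases x) (auto intro: order_trans[OF dm])
    qed simp
  qed
  have degB: "degree B < e" "degree (coeff B i) \<le> N - b'" for i
  proof -
    have "degree B \<le> e - 1"
      unfolding B_def
    proof (intro degree_sum_le)
      fix x assume "x \<in> {..<e} \<times> {..N - b'}"
      then show "degree (case x of (i, j) \<Rightarrow> monom (monom (c (False, i, j)) j) i) \<le> e - 1"
        using dm by (cases x) (auto intro: order_trans[OF dm])
    qed simp
    then show "degree B < e" using e by simp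
    show "degree (coeff B i) \<le> N - b'" unfolding B_def coeff_sum
    proof (intro degree_sum_le)
      fix x assume "x \<in> {..<e} \<times> {..N - b'}"
      then show "degree (coeff (case x of (i, j) \<Rightarrow> monom (monom (c (False, i, j)) j) i) i) \<le> N - b'"
        by (cases x) (auto intro: order_trans[OF dm])
    qed simp
  qed
  have coA: "coeff (coeff A i) j = (if i < m \<and> j \<le> N - b then c (True, i, j) else 0)" for i j
  proof -
    have "coeff (coeff A i) j = (\<Sum>x\<in>{..<m} \<times> {..N - b}. if x = (i, j) then c (True, i, j) else 0)"
      unfolding A_def coeff_sum by (rule sum.cong) (auto split: prod.splits)
    then show ?thesis by simp
  qed
  have coB: "coeff (coeff B i) j = (if i < e \<and> j \<le> N - b' then c (False, i, j) else 0)" for i j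
  proof -
    have "coeff (coeff B i) j = (\<Sum>x\<in>{..<e} \<times> {..N - b'}. if x = (i, j) then c (False, i, j) else 0)"
      unfolding B_def coeff_sum by (rule sum.cong) (auto split: prod.splits)
    then show ?thesis by simp
  qed
  have degH: "degree H \<le> e + m - 1"
  proof -
    have "degree (A * f) \<le> e + m - 1" "degree (B * g) \<le> e + m - 1"
      using degA(1) degB(1) g e degree_mult_le[of A f] degree_mult_le[of B g] unfolding e_def[symmetric]
      by linarith+
    then show ?thesis unfolding H_def by (rule degree_add_le)
  qed
  have zH: "degree (coeff H i) \<le> N" for i
  proof -
    have "degree (coeff (A * f) i) \<le> N" unfolding coeff_mult
    proof (intro degree_sum_le finite_atMost)
      show "degree (coeff A k * coeff f (i - k)) \<le> N" for k
        using degree_mult_le[of "coeff A k" "coeff f (i - k)"] degA(2)[of k] zdeg[of f "i - k"] f(4) Nb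
        by linarith
    qed
    moreover have "degree (coeff (B * g) i) \<le> N" unfolding coeff_mult
    proof (intro degree_sum_le finite_atMost)
      show "degree (coeff B k * coeff g (i - k)) \<le> N" for k
        using degree_mult_le[of "coeff B k" "coeff g (i - k)"] degB(2)[of k] zdeg[of g "i - k"] g(3) Nb
        by linarith
    qed
    ultimately show ?thesis unfolding H_def by (simp add: degree_add_le)
  qed
  have "coeff H i = 0" if "i \<ge> 1" for i
  proof (cases "i \<le> e + m - 1")
    case True
    show ?thesis
    proof (rule poly_eqI)
      fix j
      show "coeff (coeff H i) j = coeff 0 j"
      proof (cases "j \<le> N")
        case j: True
        then have "(i, j) \<in> J" using True that by (simp add: J_def)
        from c(2)[rule_format, OF this] show ?thesis by (simp add: H coeff_sum mult.commute)
      next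
        case False
        then show ?thesis using zH[of i] by (simp add: coeff_eq_0)
      qed
    qed
  next
    case False
    then show ?thesis using degH by (simp add: coeff_eq_0)
  qed
  then have "degree H \<le> 0" by (intro degree_le) auto
  then have "degree H = 0" by simp
  then obtain w where w: "H = [:w:]" by (rule degree_eq_zeroE)
  \<comment> \<open>If the combination were zero, the prime \<open>f\<close> would divide
    \<open>B\<close>, whose degree is too small; then \<open>A\<close> and \<open>B\<close> would
    vanish and the solution \<open>c\<close> would be trivial.\<close>
  have "w \<noteq> 0"
  proof
    assume "w = 0"
    with w have H0: "A * f + B * g = 0" by (simp add: H_def)
    then have "B * g = f * (- A)" by (metis add_eq_0_iff mult.commute mult_minus_right)
    then have "f dvd B * g" by simp
    with f have "f dvd B" using prime_elem_dvd_multD by metis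
    then have "B = 0" using degB(1) dvd_imp_degree_le[of f B] unfolding e_def by linarith
    moreover have "f \<noteq> 0" using f(1) by (simp add: prime_elem_def)
    then have "A = 0" using H0 \<open>B = 0\<close> by simp
    ultimately have AB: "A = 0" "B = 0" by simp_all
    have "c s = 0" if "s \<in> I" for s
    proof -
      obtain q i j where s: "s = (q, i, j)" by (cases s) auto
      show ?thesis using that coA[of i j] coB[of i j] unfolding s AB I_def by (cases q) auto
    qed
    with c(1) show False by auto
  qed
  moreover have "degree w \<le> N" using zH[of 0] by (simp add: w)
  ultimately show ?thesis using w unfolding H_def N_def e_def by blast
qed

text \<open>A substitute for Bezout's theorem: eliminating \<open>x\<close> leaves a nonzero
  \<open>w\<close> in \<open>z\<close> and \<open>y\<close>, and every common line makes
  \<open>z = g + t y\<close> a root of \<open>w\<close> over the polynomials in \<open>y\<close>.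
  Injectivity of \<open>(t, g)\<close> makes these roots distinct.\<close>

lemma card_common_lines:
  fixes f h :: "'k::field poly poly poly"
  assumes f: "irreducible f" "\<not> f dvd h"
    and deg: "degree f \<le> e" "zdeg f \<le> e" "degree h \<le> m" "zdeg h \<le> m" "m \<ge> 1"
    and S: "finite S" "inj_on (\<lambda>(t, u, g). (t, g)) S"
    and on: "\<And>l. l \<in> S \<Longrightarrow> res l f = 0 \<and> res l h = 0"
  shows "card S \<le> 2 * e * m"
proof -
  have "\<exists>A B w. A * f + B * h = [:w:] \<and> w \<noteq> 0 \<and> degree w \<le> 2 * e * m"
  proof (cases "degree f = 0")
    \<comment> \<open>Here \<open>f\<close> is already free of \<open>x\<close> and serves as
      \<open>w\<close>.\<close>
    case True
    then obtain w where w: "f = [:w:]" by (rule degree_eq_zeroE)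
    have "e \<le> 2 * e * m" using deg(5) by (cases m) auto
    moreover have "degree w \<le> e" using zdeg[of f 0] deg(2) by (simp add: w)
    ultimately have "degree w \<le> 2 * e * m" by (rule order_trans[rotated])
    moreover have "w \<noteq> 0" using f(1) w by auto
    ultimately show ?thesis using w by (intro exI[of _ 1] exI[of _ 0] exI[of _ w]) auto
  next
    case False
    have "prime_elem f" using f(1) by simp
    from eliminate[OF this f(2) _ deg(2) deg(3) deg(5) deg(4)] False
    obtain A B w where "A * f + B * h = [:w:]" "w \<noteq> 0" "degree w \<le> m * e + degree f * m" by auto
    moreover have "m * e + degree f * m \<le> 2 * e * m"
      using deg(1) by (simp add: algebra_simps)
    ultimately show ?thesis using order_trans by blast
  qed
  then obtain A B w where w: "A * f + B * h = [:w:]" "w \<noteq> 0" "degree w \<le> 2 * e * m" by blast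
  have root: "poly w [:g, t:] = 0" if "(t, u, g) \<in> S" for t u g
  proof -
    have "res (t, u, g) (A * f + B * h) = 0" using on[OF that] by (simp add: res_hom)
    then show ?thesis by (simp add: w(1)) (simp add: res_def)
  qed
  let ?r = "\<lambda>(t, u, g). [:g, t:]"
  have "inj_on ?r S" using S(2) by (force simp: inj_on_def)
  then have "card S = card (?r ` S)" by (simp add: card_image)
  also have "\<dots> \<le> card {x. poly w x = 0}"
    using root by (intro card_mono poly_roots_finite w(2)) auto
  also have "\<dots> \<le> degree w" using w(2) by (rule card_poly_roots_bound)
  finally show ?thesis using w(3) by simp
qed

subsection \<open>Umbilic surfaces\<close>

text \<open>
  The variables are the partial derivatives of \<open>f\<close> up to order three at a point, with \<open>c\<close> for
  \<open>f\<^sub>z\<close>; \<open>M, N, L\<close> are \<open>- c\<^sup>3\<close> times the second derivatives \<open>z\<^sub>y\<^sub>y, z\<^sub>x\<^sub>y, z\<^sub>x\<^sub>x\<close> of the surface as a graph.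
  The hypotheses \<open>E0y\<close> to \<open>E1z\<close> say that the gradients of the umbilic equations are multiples of the
  gradient of \<open>f\<close>, that is, that the equations persist to first order along the surface.
\<close>

lemma umbilic_pointwise:
  fixes c fx fy xx xy xz yy yz zz xxy xxz xyy xyz xzz yyy yyz yzz zzz t s0 s1 :: "'a::field"
  assumes c: "c \<noteq> 0" and b: "fy + 2 * t * c \<noteq> 0"
    and tan: "fx + t * fy + t^2 * c = 0"
  defines "M \<equiv> yy * c^2 - 2 * fy * c * yz + fy^2 * zz"
    and "N \<equiv> xy * c^2 - fx * c * yz - fy * c * xz + fx * fy * zz"
    and "L \<equiv> xx * c^2 - 2 * fx * c * xz + fx^2 * zz"
  defines "dM \<equiv> \<lambda>cd fyd yyd yzd zzd. yyd * c^2 + 2 * yy * c * cd - 2 * (fyd * c * yz + fy * cd * yz + fy * c * yzd)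
      + 2 * fy * fyd * zz + fy^2 * zzd"
    and "dN \<equiv> \<lambda>cd fxd fyd xyd xzd yzd zzd. xyd * c^2 + 2 * xy * c * cd - (fxd * c * yz + fx * cd * yz + fx * c * yzd)
      - (fyd * c * xz + fy * cd * xz + fy * c * xzd) + (fxd * fy * zz + fx * fyd * zz + fx * fy * zzd)"
    and "dL \<equiv> \<lambda>cd fxd xxd xzd zzd. xxd * c^2 + 2 * xx * c * cd - 2 * (fxd * c * xz + fx * cd * xz + fx * c * xzd)
      + 2 * fx * fxd * zz + fx^2 * zzd"
  assumes E0: "c * L = fx * M" and E1: "2 * c * N = fy * M"
    and E0y: "yz * L + c * dL yz xy xxy xyz yzz - xy * M - fx * dM yz yy yyy yyz yzz = s0 * fy"
    and E0z: "zz * L + c * dL zz xz xxz xzz zzz - xz * M - fx * dM zz yz yyz yzz zzz = s0 * c"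
    and E1x: "2 * (xz * N + c * dN xz xx xy xxy xxz xyz xzz) - xy * M - fy * dM xz xy xyy xyz xzz = s1 * fx"
    and E1y: "2 * (yz * N + c * dN yz xy yy xyy xyz yyz yzz) - yy * M - fy * dM yz yy yyy yyz yzz = s1 * fy"
    and E1z: "2 * (zz * N + c * dN zz xz yz xyz xzz yzz zzz) - yz * M - fy * dM zz yz yyz yzz zzz = s1 * c"
  defines "Da \<equiv> xz + t * yz + t^2 * zz" and "Db \<equiv> (xy + t * yy + t^2 * yz) + 2 * t * (xz + t * yz + t^2 * zz)"
    and "DM \<equiv> dM xz xy xyy xyz xzz + t * dM yz yy yyy yyz yzz + t^2 * dM zz yz yyz yzz zzz"
  shows "2 * c^2 * (c * Db - (fy + 2 * t * c) * Da) = M * (fy + 2 * t * c)" (is ?A)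
    and "2 * c^2 * (c * DM - 3 * M * Da) = M^2" (is ?B)
proof -
  define P Q where "P = fx / c" and "Q = fy / c"
  have fx: "fx = P * c" and fy: "fy = Q * c" using c by (simp_all add: P_def Q_def)
  define m n l where "m = yy - 2 * Q * yz + Q^2 * zz" and "n = xy - P * yz - Q * xz + P * Q * zz"
    and "l = xx - 2 * P * xz + P^2 * zz"
  have M: "M = c^2 * m" and N: "N = c^2 * n" and L: "L = c^2 * l"
    unfolding M_def N_def L_def m_def n_def l_def fx fy by (simp_all add: algebra_simps power2_eq_square)
  have "P + t * Q + t^2 = 0"
  proof -
    have "c * (P + t * Q + t^2) = fx + t * fy + t^2 * c" by (simp add: fx fy algebra_simps)
    then show ?thesis using tan c by simp
  qed
  then have P: "P = - t * Q - t^2" by (simp add: algebra_simps eq_neg_iff_add_eq_0)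
  have l: "l = P * m"
  proof -
    have "c^3 * l = c^3 * (P * m)" using E0 by (simp add: M L fx algebra_simps power3_eq_cube power2_eq_square)
    then show ?thesis using c by simp
  qed
  have n: "2 * n = Q * m"
  proof -
    have "c^3 * (2 * n) = c^3 * (Q * m)" using E1 by (simp add: M N fy algebra_simps power3_eq_cube power2_eq_square)
    then show ?thesis using c by simp
  qed
  have bQ: "fy + 2 * t * c = c * (Q + 2 * t)" by (simp add: fy algebra_simps)
  with b have Qt: "Q + 2 * t \<noteq> 0" by auto
  show ?A
  proof -
    have "2 * (Db - (Q + 2 * t) * Da) = (Q + 2 * t) * m"
      using n l unfolding Da_def Db_def m_def n_def l_def P by Groebner_Basis.algebra
    then show ?thesis unfolding bQ M by Groebner_Basis.algebra
  qed
  \<comment> \<open>The suffixes 1 and 2 stand for the derivatives tangent to the surface,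
    \<open>d/dx - P d/dz\<close> and \<open>d/dy - Q d/dz\<close>; for \<open>m\<close>,
    \<open>n\<close>, \<open>l\<close> they carry an additional factor \<open>c\<close>.\<close>
  define c1 c2 where "c1 = xz - P * zz" and "c2 = yz - Q * zz"
  define m1 m2 n1 n2 l2 where
    "m1 = c * ((xyy - P * yyz) - 2 * Q * (xyz - P * yzz) + Q^2 * (xzz - P * zzz)) - 2 * n * (yz - Q * zz)"
    and "m2 = c * ((yyy - Q * yyz) - 2 * Q * (yyz - Q * yzz) + Q^2 * (yzz - Q * zzz)) - 2 * m * (yz - Q * zz)"
    and "n1 = c * ((xxy - P * xyz) - P * (xyz - P * yzz) - Q * (xxz - P * xzz) + P * Q * (xzz - P * zzz)) - l * (yz - Q * zz) - n * (xz - P * zz)"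
    and "n2 = c * ((xyy - Q * xyz) - P * (yyz - Q * yzz) - Q * (xyz - Q * xzz) + P * Q * (yzz - Q * zzz)) - n * (yz - Q * zz) - m * (xz - P * zz)"
    and "l2 = c * ((xxy - Q * xxz) - 2 * P * (xyz - Q * xzz) + P^2 * (yzz - Q * zzz)) - 2 * n * (xz - P * zz)"
  \<comment> \<open>The Codazzi equations: mixed third derivatives of the graph agree, so the second
    tangential derivative of \<open>l / c\<close> is the first of \<open>n / c\<close>, and likewise
    for \<open>n / c\<close> and \<open>m / c\<close>.\<close>
  have cod1: "l2 - l * c2 = n1 - n * c1"
    unfolding l2_def n1_def c1_def c2_def m_def n_def l_def by Groebner_Basis.algebra
  have cod2: "n2 - n * c2 = m1 - m * c1"
    unfolding n2_def m1_def c1_def c2_def m_def n_def l_def by Groebner_Basis.algebra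
  note big = dM_def dN_def dL_def M_def N_def L_def fx fy
  note red = l2_def n1_def n2_def m1_def m2_def c1_def c2_def m_def n_def l_def
  \<comment> \<open>Subtracting \<open>Q\<close> or \<open>P\<close> times the \<open>z\<close>
    equation cancels the multiplier \<open>s0\<close> or \<open>s1\<close>. What remains is the
    tangential derivative of \<open>l = P * m\<close>, here and of \<open>2 * n = Q * m\<close> in
    \<open>e2\<close> and \<open>e3\<close>.\<close>
  have e1: "l2 - n * m - P * m2 = 0"
  proof -
    have "(yz * L + c * dL yz xy xxy xyz yzz - xy * M - fx * dM yz yy yyy yyz yzz)
       - Q * (zz * L + c * dL zz xz xxz xzz zzz - xz * M - fx * dM zz yz yyz yzz zzz)
       = 3 * c^2 * c2 * (l - P * m) + c^2 * (l2 - n * m - P * m2)"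
      unfolding big red by Groebner_Basis.algebra
    then have "c^2 * (l2 - n * m - P * m2) = 0" unfolding E0y E0z by (simp add: l fy)
    then show ?thesis using c by simp
  qed
  have e2: "2 * n1 - n * m - Q * m1 = 0"
  proof -
    have "(2 * (xz * N + c * dN xz xx xy xxy xxz xyz xzz) - xy * M - fy * dM xz xy xyy xyz xzz)
       - P * (2 * (zz * N + c * dN zz xz yz xyz xzz yzz zzz) - yz * M - fy * dM zz yz yyz yzz zzz)
       = 3 * c^2 * c1 * (2 * n - Q * m) + c^2 * (2 * n1 - n * m - Q * m1)"
      unfolding big red by Groebner_Basis.algebra
    then have "c^2 * (2 * n1 - n * m - Q * m1) = 0" unfolding E1x E1z by (simp add: n fx)
    then show ?thesis using c by simp
  qed
  have e3: "2 * n2 - m * m - Q * m2 = 0"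
  proof -
    have "(2 * (yz * N + c * dN yz xy yy xyy xyz yyz yzz) - yy * M - fy * dM yz yy yyy yyz yzz)
       - Q * (2 * (zz * N + c * dN zz xz yz xyz xzz yzz zzz) - yz * M - fy * dM zz yz yyz yzz zzz)
       = 3 * c^2 * c2 * (2 * n - Q * m) + c^2 * (2 * n2 - m * m - Q * m2)"
      unfolding big red by Groebner_Basis.algebra
    then have "c^2 * (2 * n2 - m * m - Q * m2) = 0" unfolding E1y E1z by (simp add: n fy)
    then show ?thesis using c by simp
  qed
  \<comment> \<open>Up to a factor these are the derivatives of \<open>m / c\<close>. The system
    forces \<open>w2\<close> times the discriminant \<open>Q^2 - 4 * P = (Q + 2 * t)^2\<close> to
    vanish, and the discriminant is nonzero because the tangent plane contains two distinct null
    directions.\<close>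
  define w1 w2 where "w1 = m1 - m * c1" and "w2 = m2 - m * c2"
  have "(Q + 2 * t)^2 * w2 = 0"
    using cod1 cod2 e1 e2 e3 l n unfolding w1_def w2_def P by Groebner_Basis.algebra
  then have w2: "w2 = 0" using Qt by simp
  have w1: "2 * w1 = m^2"
    using cod2 e3 n w2 unfolding w1_def w2_def by Groebner_Basis.algebra
  have "c * DM - 3 * M * Da = c^2 * (w1 + t * w2)"
    unfolding DM_def Da_def w1_def w2_def big red P by Groebner_Basis.algebra
  then show ?B using w1 w2 unfolding M by Groebner_Basis.algebra
qed

text \<open>Both lines lie in the surface, so the second fundamental form vanishes on their
  directions. The conic form restricted to the tangent plane vanishes on the same two directions,
  and binary quadratic forms with two common zeros are proportional.\<close>

lemma umbilic_at_crossing: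
  fixes fx fy fz xx xy xz yy yz zz t t' :: "'a::field"
  assumes tt: "t \<noteq> t'"
    and "fx + t * fy + t^2 * fz = 0" "fx + t' * fy + t'^2 * fz = 0"
    and "xx + 2 * t * xy + t^2 * (2 * xz + yy) + 2 * t^3 * yz + t^4 * zz = 0"
    and "xx + 2 * t' * xy + t'^2 * (2 * xz + yy) + 2 * t'^3 * yz + t'^4 * zz = 0"
  defines "M \<equiv> yy * fz^2 - 2 * fy * fz * yz + fy^2 * zz"
    and "N \<equiv> xy * fz^2 - fx * fz * yz - fy * fz * xz + fx * fy * zz"
    and "L \<equiv> xx * fz^2 - 2 * fx * fz * xz + fx^2 * zz"
  shows "fy = - (t + t') * fz" "fx = t * t' * fz" "fz * L = fx * M" "2 * fz * N = fy * M"
proof -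
  have "(t - t') * (fy + (t + t') * fz) = 0" using assms(2,3) by Groebner_Basis.algebra
  with tt have "fy + (t + t') * fz = 0" by simp
  then show fy: "fy = - (t + t') * fz" by Groebner_Basis.algebra
  show fx: "fx = t * t' * fz" using assms(2) fy by Groebner_Basis.algebra
  let ?h = "2 * xy + (t + t') * (2 * xz + yy) + 2 * (t^2 + t * t' + t'^2) * yz + (t + t') * (t^2 + t'^2) * zz"
  have "(t - t') * ?h = 0" using assms(4,5) by Groebner_Basis.algebra
  with tt have h: "?h = 0" by simp
  show "fz * L = fx * M" using h assms(4) unfolding M_def L_def fx fy by Groebner_Basis.algebra
  show "2 * fz * N = fy * M" using h assms(4) unfolding M_def N_def fx fy by Groebner_Basis.algebra
qed

text \<open>Removing from \<open>u\<close> the multiple of \<open>v\<close> that kills the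
  coefficient at \<open>degree v\<close> makes the two degrees differ. The leading coefficient of
  the Wronskian then contains the difference of the degrees as a factor, which is nonzero in the
  field because both degrees are below \<open>p\<close>.\<close>

lemma wronskian_zero_imp_proportional:
  fixes u v :: "'k::field poly"
  assumes ch: "\<And>n. 0 < n \<Longrightarrow> n < p \<Longrightarrow> of_nat n \<noteq> (0::'k)"
    and v: "v \<noteq> 0" and deg: "degree u < p" "degree v < p"
    and w: "pderiv u * v = u * pderiv v"
  shows "\<exists>c. u = smult c v"
proof -
  define c where "c = coeff u (degree v) / lead_coeff v"
  define u1 where "u1 = u - smult c v"
  have w1: "pderiv u1 * v = u1 * pderiv v"
    using w by (simp add: u1_def pderiv_diff pderiv_smult algebra_simps)
  have c0: "coeff u1 (degree v) = 0" using v by (simp add: u1_def c_def)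
  have du: "degree u1 < p" unfolding u1_def
    using deg degree_smult_le[of c v] by (intro degree_diff_less) auto
  have "u1 = 0"
  proof (rule ccontr)
    assume u1: "u1 \<noteq> 0"
    define m n where "m = degree u1" and "n = degree v"
    have mn: "m \<noteq> n" using c0 u1 unfolding m_def n_def by (metis leading_coeff_0_iff)
    have lead: "of_nat m * (lead_coeff u1 * lead_coeff v) = of_nat n * (lead_coeff u1 * lead_coeff v)"
    proof (cases "m + n = 0")
      case False
      have pd: "coeff (pderiv p * q) (degree p + degree q - 1) = of_nat (degree p) * (lead_coeff p * lead_coeff q)"
        if "degree p + degree q \<noteq> 0" for p q :: "'k poly"
      proof (cases "degree p")
        case 0
        then have "pderiv p = 0" by (metis degree_eq_zeroE pderiv_singleton)
        then show ?thesis using 0 by simp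
      next
        case (Suc k)
        have "degree (pderiv p) \<le> k" using Suc by (intro degree_le) (auto simp: coeff_pderiv coeff_eq_0)
        then have "coeff (pderiv p * q) (k + degree q) = coeff (pderiv p) k * lead_coeff q"
          by (intro coeff_mult_le) auto
        then show ?thesis using Suc by (simp add: coeff_pderiv mult.assoc del: of_nat_Suc)
      qed
      from pd[of u1 v] pd[of v u1] False w1 show ?thesis
        by (auto simp: m_def n_def mult.commute add.commute)
    qed auto
    have "lead_coeff u1 * lead_coeff v \<noteq> 0" using u1 v by simp
    with lead have eq: "of_nat m = (of_nat n :: 'k)" by simp
    show False
    proof (cases "m < n")
      case True
      then have "of_nat (n - m) = (0::'k)" using eq by (simp add: of_nat_diff)
      with ch[of "n - m"] True deg(2) show False by (simp add: n_def)
    next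
      case False
      then have "of_nat (m - n) = (0::'k)" using eq by (simp add: of_nat_diff)
      with ch[of "m - n"] False mn du show False by (simp add: m_def)
    qed
  qed
  then show ?thesis unfolding u1_def by (intro exI[of _ c]) simp
qed

text \<open>As \<open>W / b^2\<close> is the derivative of \<open>a / b\<close>, the hypothesis says
  that the second derivative of \<open>a / b\<close> vanishes. Two applications of the Wronskian
  lemma integrate it, the first of them to \<open>b * b\<close>, whose degree explains the bound
  \<open>2 * e + 1 < p\<close>.\<close>

lemma quotient_affine:
  fixes a b :: "'k::field poly"
  assumes ch: "\<And>n. 0 < n \<Longrightarrow> n < p \<Longrightarrow> of_nat n \<noteq> (0::'k)"
    and b: "b \<noteq> 0" and deg: "degree a \<le> e" "degree b \<le> e" "2 * e + 1 < p"
    and w: "pderiv W * b = 2 * W * pderiv b" "W = pderiv a * b - a * pderiv b"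
  shows "\<exists>\<kappa> \<omega>. a = [:\<omega>, \<kappa>:] * b"
proof -
  have pd: "degree (pderiv p) \<le> degree p" for p :: "'k poly"
    by (rule degree_le) (simp add: coeff_pderiv coeff_eq_0)
  have "degree W \<le> 2 * e" unfolding w(2)
    using deg pd[of a] pd[of b] degree_mult_le[of "pderiv a" b] degree_mult_le[of a "pderiv b"]
    by (intro degree_diff_le) linarith+
  moreover have "degree (b * b) \<le> 2 * e" using deg degree_mult_le[of b b] by linarith
  moreover have "pderiv W * (b * b) = W * pderiv (b * b)"
    using w(1) unfolding pderiv_mult by Groebner_Basis.algebra
  ultimately obtain \<kappa> where k: "W = smult \<kappa> (b * b)"
    using wronskian_zero_imp_proportional[OF ch, of p "b * b" W] b deg by auto
  define a1 where "a1 = a - [:0, \<kappa>:] * b"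
  have "degree ([:0, \<kappa>:] * b) \<le> 1 + e"
    using degree_mult_le[of "[:0, \<kappa>:]" b] deg degree_pCons_le[of 0 "[:\<kappa>:]"] by simp
  then have "degree a1 \<le> e + 1" unfolding a1_def using deg by (intro degree_diff_le) auto
  moreover have "pderiv a1 * b = a1 * pderiv b"
  proof -
    have p: "pderiv [:0, \<kappa>:] = [:\<kappa>:]" by (simp add: pderiv_pCons)
    have "pderiv a1 * b - a1 * pderiv b = W - [:\<kappa>:] * (b * b)"
      unfolding a1_def w(2) pderiv_diff pderiv_mult p by Groebner_Basis.algebra
    then show ?thesis using k by simp
  qed
  moreover have "e + 1 < p" using deg(3) by simp
  ultimately obtain \<omega> where "a1 = smult \<omega> b"
    using wronskian_zero_imp_proportional[OF ch, of p b a1] b deg by auto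
  then have "a = [:\<omega>, \<kappa>:] * b" unfolding a1_def by (simp add: algebra_simps)
  then show ?thesis by blast
qed

lemma poly_eqI_infinite:
  fixes P Q :: "'k::field poly"
  assumes inf: "infinite (UNIV :: 'k set)" and ab: "a \<noteq> 0" "b \<noteq> 0"
    and eq: "\<And>y. poly a y \<noteq> 0 \<Longrightarrow> poly b y \<noteq> 0 \<Longrightarrow> poly P y = poly Q y"
  shows "P = Q"
proof -
  have "poly ((P - Q) * a * b) y = 0" for y using eq[of y] by auto
  then have "(P - Q) * a * b = 0" using poly_roots_finite[of "(P - Q) * a * b"] inf by auto
  with ab show ?thesis by simp
qed

text \<open>
  \<open>umb0 f\<close> and \<open>umb1 f\<close> vanish where the second fundamental form of \<open>f = 0\<close> is proportional to the
  conic form \<open>dx dz - dy\<^sup>2\<close> restricted to the tangent plane.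
\<close>

definition surfM :: "'k::idom poly poly poly \<Rightarrow> 'k poly poly poly" where
  "surfM f = dY (dY f) * dZ f^2 - 2 * dY f * dZ f * dY (dZ f) + dY f^2 * dZ (dZ f)"
definition surfN :: "'k::idom poly poly poly \<Rightarrow> 'k poly poly poly" where
  "surfN f = dY (dX f) * dZ f^2 - dX f * dZ f * dY (dZ f) - dY f * dZ f * dZ (dX f) + dX f * dY f * dZ (dZ f)"
definition surfL :: "'k::idom poly poly poly \<Rightarrow> 'k poly poly poly" where
  "surfL f = dX (dX f) * dZ f^2 - 2 * dX f * dZ f * dZ (dX f) + dX f^2 * dZ (dZ f)"
definition umb0 :: "'k::idom poly poly poly \<Rightarrow> 'k poly poly poly" where
  "umb0 f = dZ f * surfL f - dX f * surfM f"
definition umb1 :: "'k::idom poly poly poly \<Rightarrow> 'k poly poly poly" where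
  "umb1 f = 2 * dZ f * surfN f - dY f * surfM f"

text \<open>The parameter \<open>y\<close> gives the tangent vector \<open>(1 / t, 1, t)\<close>;
  scaling by \<open>t\<close> turns it into the point \<open>(1, t, t^2)\<close> of the
  conic.\<close>

lemma smult_t_pderiv_res:
  assumes "t \<noteq> 0"
  shows "smult t (pderiv (res (t, u, g) h)) =
    res (t, u, g) (dX h) + smult t (res (t, u, g) (dY h)) + smult (t^2) (res (t, u, g) (dZ h))"
  using assms by (simp add: pderiv_res smult_add_right power2_eq_square)

lemma poly_pderiv_res:
  assumes "t \<noteq> 0" and xz: "x = (y - u) / t" "z = g + t * y"
  shows "t * poly (pderiv (res (t, u, g) h)) y = ev x y z (dX h) + t * ev x y z (dY h) + t^2 * ev x y z (dZ h)"
  using arg_cong[OF smult_t_pderiv_res[OF assms(1), of u g h], of "\<lambda>q. poly q y"]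
  by (simp add: poly_res xz)

text \<open>A polynomial vanishing along a line has contact of every order with it; the equations
  are those of orders zero, one and two.\<close>

lemma line_contact:
  assumes t: "t \<noteq> 0" and on: "res (t, u, g) f = 0" and xz: "x = (y - u) / t" "z = g + t * y"
  shows "ev x y z f = 0" "ev x y z (dX f) + t * ev x y z (dY f) + t^2 * ev x y z (dZ f) = 0"
    "ev x y z (dX (dX f)) + 2 * t * ev x y z (dY (dX f)) + t^2 * (2 * ev x y z (dZ (dX f)) + ev x y z (dY (dY f)))
       + 2 * t^3 * ev x y z (dY (dZ f)) + t^4 * ev x y z (dZ (dZ f)) = 0"
proof -
  let ?l = "(t, u, g)"
  show "ev x y z f = 0" using poly_res[of t u g f y] on xz by simp
  have 1: "res ?l (dX f) + smult t (res ?l (dY f)) + smult (t^2) (res ?l (dZ f)) = 0"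
    using smult_t_pderiv_res[OF t, of u g f] on by simp
  from arg_cong[OF this, of "\<lambda>q. poly q y"]
  show "ev x y z (dX f) + t * ev x y z (dY f) + t^2 * ev x y z (dZ f) = 0"
    by (simp add: poly_res xz)
  from arg_cong[OF 1, of "\<lambda>q. t * poly (pderiv q) y"]
  have "t * poly (pderiv (res ?l (dX f))) y + t * (t * poly (pderiv (res ?l (dY f))) y)
      + t^2 * (t * poly (pderiv (res ?l (dZ f))) y) = 0"
    by (simp add: pderiv_add pderiv_smult algebra_simps)
  then show "ev x y z (dX (dX f)) + 2 * t * ev x y z (dY (dX f)) + t^2 * (2 * ev x y z (dZ (dX f)) + ev x y z (dY (dY f)))
       + 2 * t^3 * ev x y z (dY (dZ f)) + t^4 * ev x y z (dZ (dZ f)) = 0"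
    unfolding poly_pderiv_res[OF t xz] d_commute by Groebner_Basis.algebra
qed

lemma crossing_umbilic:
  assumes t: "t \<noteq> 0" "t' \<noteq> 0" "t \<noteq> t'"
    and on: "res (t, u, g) f = 0" "res (t', u', g') f = 0"
    and cross: "(y - u) / t = (y - u') / t'" "g + t * y = g' + t' * y"
  defines "v \<equiv> \<lambda>h. poly (res (t, u, g) h) y"
  shows "v (dY f) = - (t + t') * v (dZ f)" "v (dX f) = t * t' * v (dZ f)"
    "v (umb0 f) = 0" "v (umb1 f) = 0"
proof -
  define x z where "x = (y - u) / t" and "z = g + t * y"
  have v: "v h = ev x y z h" for h by (simp add: v_def poly_res x_def z_def)
  note u = umbilic_at_crossing[OF t(3) line_contact(2)[OF t(1) on(1) x_def z_def]
      line_contact(2)[OF t(2) on(2) x_def[unfolded cross(1)] z_def[unfolded cross(2)]]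
      line_contact(3)[OF t(1) on(1) x_def z_def]
      line_contact(3)[OF t(2) on(2) x_def[unfolded cross(1)] z_def[unfolded cross(2)]]]
  show "v (dY f) = - (t + t') * v (dZ f)" "v (dX f) = t * t' * v (dZ f)" using u(1,2) by (simp_all add: v)
  show "v (umb0 f) = 0" "v (umb1 f) = 0"
    using u(3,4) by (simp_all add: v umb0_def umb1_def surfM_def surfN_def surfL_def ev_hom ev_power ev_numeral)
qed

text \<open>At a smooth point the tangent plane contains the null direction of the line and a second
  one, of slope \<open>t'\<close>, and \<open>b / a = t - t'\<close> there. The conclusion says that
  the reciprocal of this difference is affine along the line, as for the rulings of a quadric or a
  plane.\<close>

lemma umbilic_line_affine:
  fixes f :: "'k::field poly poly poly"
  assumes inf: "infinite (UNIV :: 'k set)"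
    and ch: "\<And>n. 0 < n \<Longrightarrow> n < p \<Longrightarrow> of_nat n \<noteq> (0::'k)"
    and p2: "2 < p" and t: "t \<noteq> 0" and on: "res (t, u, g) f = 0"
    and dvd: "f dvd umb0 f" "f dvd umb1 f"
  defines "a \<equiv> res (t, u, g) (dZ f)"
    and "b \<equiv> res (t, u, g) (dY f) + smult (2 * t) (res (t, u, g) (dZ f))"
  assumes ab: "a \<noteq> 0" "b \<noteq> 0" and deg: "degree a \<le> e" "degree b \<le> e" "2 * e + 1 < p"
  shows "\<exists>\<kappa> \<omega>. a = [:\<omega>, \<kappa>:] * b"
proof -
  obtain s0 where s0: "umb0 f = f * s0" using dvd(1) by (elim dvdE)
  obtain s1 where s1: "umb1 f = f * s1" using dvd(2) by (elim dvdE)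
  define M where "M = res (t, u, g) (surfM f)"
  note dsimps = derivation_simps[OF derivation_dX] derivation_simps[OF derivation_dY] derivation_simps[OF derivation_dZ]
  define T where "T = [:t:]"
  have T: "T \<noteq> 0" "pderiv T = 0" using t by (simp_all add: T_def pderiv_pCons)
  \<comment> \<open>The pointwise identities hold where \<open>a\<close> and \<open>b\<close> are
    nonzero; since the field is infinite, they become polynomial identities \<open>al\<close> and
    \<open>be\<close>.\<close>
  have pt: "poly (2 * a^2 * (T * (a * pderiv b - b * pderiv a))) y = poly (M * b) y \<and>
      poly (2 * a^2 * (T * (a * pderiv M - 3 * M * pderiv a))) y = poly (M^2) y"
    if y: "poly a y \<noteq> 0" "poly b y \<noteq> 0" for y
  proof -
    define x z where "x = (y - u) / t" and "z = g + t * y"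
    define v where "v = ev x y z"
    have vh: "v 0 = 0" "v 1 = 1" "v (h + k) = v h + v k" "v (h - k) = v h - v k" "v (- h) = - v h"
      "v (h * k) = v h * v k" "v (h ^ n) = v h ^ n" "v (numeral q) = numeral q" for h k n q
      by (simp_all add: v_def ev_hom ev_power ev_numeral)
    have vr: "poly (res (t, u, g) h) y = v h" for h by (simp add: poly_res v_def x_def z_def)
    have vd: "t * poly (pderiv (res (t, u, g) h)) y = v (dX h) + t * v (dY h) + t^2 * v (dZ h)" for h
      using poly_pderiv_res[OF t x_def z_def] by (simp add: v_def)
    have f0: "v f = 0" using line_contact(1)[OF t on x_def z_def] by (simp add: v_def)
    \<comment> \<open>At a zero of \<open>f\<close>, the gradient of the multiple
      \<open>f * s0\<close> is \<open>s0\<close> times the gradient of \<open>f\<close>. This is how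
      divisibility supplies the first-order hypotheses of \<open>umbilic_pointwise\<close>.\<close>
    have um0: "v (umb0 f) = 0" "v (dX (umb0 f)) = v s0 * v (dX f)" "v (dY (umb0 f)) = v s0 * v (dY f)"
       "v (dZ (umb0 f)) = v s0 * v (dZ f)"
      unfolding s0 by (simp_all add: dsimps vh f0)
    have um1: "v (umb1 f) = 0" "v (dX (umb1 f)) = v s1 * v (dX f)" "v (dY (umb1 f)) = v s1 * v (dY f)"
       "v (dZ (umb1 f)) = v s1 * v (dZ f)"
      unfolding s1 by (simp_all add: dsimps vh f0)
    have c: "v (dZ f) \<noteq> 0" using y(1) by (simp add: a_def vr)
    have b': "v (dY f) + 2 * t * v (dZ f) \<noteq> 0" using y(2) by (simp add: b_def vr)
    have tan: "v (dX f) + t * v (dY f) + t^2 * v (dZ f) = 0"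
      using line_contact(2)[OF t on x_def z_def] by (simp add: v_def)
    note exp = umb0_def umb1_def surfM_def surfN_def surfL_def power2_eq_square dsimps d_commute vh
    let ?c = "v (dZ f)"
      and ?fx = "v (dX f)"
      and ?fy = "v (dY f)"
      and ?xx = "v (dX (dX f))"
      and ?xy = "v (dY (dX f))"
      and ?xz = "v (dZ (dX f))"
      and ?yy = "v (dY (dY f))"
      and ?yz = "v (dY (dZ f))"
      and ?zz = "v (dZ (dZ f))"
      and ?xxy = "v (dY (dX (dX f)))"
      and ?xxz = "v (dZ (dX (dX f)))"
      and ?xyy = "v (dY (dY (dX f)))"
      and ?xyz = "v (dY (dZ (dX f)))"
      and ?xzz = "v (dZ (dZ (dX f)))"
      and ?yyy = "v (dY (dY (dY f)))"
      and ?yyz = "v (dY (dY (dZ f)))"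
      and ?yzz = "v (dY (dZ (dZ f)))"
      and ?zzz = "v (dZ (dZ (dZ f)))"
    let ?M = "?yy * ?c^2 - 2 * ?fy * ?c * ?yz + ?fy^2 * ?zz"
    let ?N = "?xy * ?c^2 - ?fx * ?c * ?yz - ?fy * ?c * ?xz + ?fx * ?fy * ?zz"
    let ?L = "?xx * ?c^2 - 2 * ?fx * ?c * ?xz + ?fx^2 * ?zz"
    let ?dM = "\<lambda>cd fyd yyd yzd zzd. yyd * ?c^2 + 2 * ?yy * ?c * cd - 2 * (fyd * ?c * ?yz + ?fy * cd * ?yz + ?fy * ?c * yzd) + 2 * ?fy * fyd * ?zz + ?fy^2 * zzd"
    let ?dN = "\<lambda>cd fxd fyd xyd xzd yzd zzd. xyd * ?c^2 + 2 * ?xy * ?c * cd - (fxd * ?c * ?yz + ?fx * cd * ?yz + ?fx * ?c * yzd) - (fyd * ?c * ?xz + ?fy * cd * ?xz + ?fy * ?c * xzd) + (fxd * ?fy * ?zz + ?fx * fyd * ?zz + ?fx * ?fy * zzd)"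
    let ?dL = "\<lambda>cd fxd xxd xzd zzd. xxd * ?c^2 + 2 * ?xx * ?c * cd - 2 * (fxd * ?c * ?xz + ?fx * cd * ?xz + ?fx * ?c * xzd) + 2 * ?fx * fxd * ?zz + ?fx^2 * zzd"
    have E0: "?c * ?L = ?fx * ?M"
      using um0(1) unfolding exp by Groebner_Basis.algebra
    have E1: "2 * ?c * ?N = ?fy * ?M"
      using um1(1) unfolding exp by Groebner_Basis.algebra
    have E0y: "?yz * ?L + ?c * ?dL ?yz ?xy ?xxy ?xyz ?yzz - ?xy * ?M - ?fx * ?dM ?yz ?yy ?yyy ?yyz ?yzz = v s0 * ?fy"
      using um0(3) unfolding exp by Groebner_Basis.algebra
    have E0z: "?zz * ?L + ?c * ?dL ?zz ?xz ?xxz ?xzz ?zzz - ?xz * ?M - ?fx * ?dM ?zz ?yz ?yyz ?yzz ?zzz = v s0 * ?c"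
      using um0(4) unfolding exp by Groebner_Basis.algebra
    have E1x: "2 * (?xz * ?N + ?c * ?dN ?xz ?xx ?xy ?xxy ?xxz ?xyz ?xzz) - ?xy * ?M - ?fy * ?dM ?xz ?xy ?xyy ?xyz ?xzz = v s1 * ?fx"
      using um1(2) unfolding exp by Groebner_Basis.algebra
    have E1y: "2 * (?yz * ?N + ?c * ?dN ?yz ?xy ?yy ?xyy ?xyz ?yyz ?yzz) - ?yy * ?M - ?fy * ?dM ?yz ?yy ?yyy ?yyz ?yzz = v s1 * ?fy"
      using um1(3) unfolding exp by Groebner_Basis.algebra
    have E1z: "2 * (?zz * ?N + ?c * ?dN ?zz ?xz ?yz ?xyz ?xzz ?yzz ?zzz) - ?yz * ?M - ?fy * ?dM ?zz ?yz ?yyz ?yzz ?zzz = v s1 * ?c"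
      using um1(4) unfolding exp by Groebner_Basis.algebra
    note U = umbilic_pointwise[OF c b' tan E0 E1 E0y E0z E1x E1y E1z]
    have ta: "t * poly (pderiv a) y = v (dZ (dX f)) + t * v (dY (dZ f)) + t^2 * v (dZ (dZ f))"
      unfolding a_def vd by (simp add: d_commute)
    have tb: "t * poly (pderiv b) y = v (dY (dX f)) + t * v (dY (dY f)) + t^2 * v (dY (dZ f)) + 2 * t * (t * poly (pderiv a) y)"
      using vd[of "dY f"] by (simp add: a_def b_def pderiv_add pderiv_smult d_commute algebra_simps)
    have tM: "t * poly (pderiv M) y = v (dX (surfM f)) + t * v (dY (surfM f)) + t^2 * v (dZ (surfM f))"
      unfolding M_def vd ..
    have va: "poly a y = v (dZ f)" "poly b y = v (dY f) + 2 * t * v (dZ f)" "poly M y = v (surfM f)"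
      by (simp_all add: a_def b_def M_def vr)
    have e1: "poly (2 * a^2 * (T * (a * pderiv b - b * pderiv a))) y
        = 2 * poly a y^2 * (poly a y * (t * poly (pderiv b) y) - poly b y * (t * poly (pderiv a) y))"
      by (simp add: T_def algebra_simps)
    have e2: "poly (2 * a^2 * (T * (a * pderiv M - 3 * M * pderiv a))) y
        = 2 * poly a y^2 * (poly a y * (t * poly (pderiv M) y) - 3 * poly M y * (t * poly (pderiv a) y))"
      by (simp add: T_def algebra_simps)
    have vM: "v (surfM f) = ?M" unfolding exp by (rule refl)
    have vdM: "v (dX (surfM f)) = ?dM ?xz ?xy ?xyy ?xyz ?xzz" "v (dY (surfM f)) = ?dM ?yz ?yy ?yyy ?yyz ?yzz"
        "v (dZ (surfM f)) = ?dM ?zz ?yz ?yyz ?yzz ?zzz"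
      unfolding exp by Groebner_Basis.algebra+
    have "2 * poly a y^2 * (poly a y * (t * poly (pderiv b) y) - poly b y * (t * poly (pderiv a) y)) = poly M y * poly b y"
      unfolding tb ta va vM by (rule U(1))
    moreover have "2 * poly a y^2 * (poly a y * (t * poly (pderiv M) y) - 3 * poly M y * (t * poly (pderiv a) y)) = poly M y ^ 2"
      unfolding tM ta va vdM unfolding vM by (rule U(2))
    ultimately show ?thesis unfolding e1 e2 poly_power poly_mult[of M b] by blast
  qed
  have al: "2 * a^2 * (T * (a * pderiv b - b * pderiv a)) = M * b"
    using pt by (intro poly_eqI_infinite[OF inf ab]) blast
  have be: "2 * a^2 * (T * (a * pderiv M - 3 * M * pderiv a)) = M^2"
    using pt by (intro poly_eqI_infinite[OF inf ab]) blast
  define W where "W = pderiv a * b - a * pderiv b"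
  have two: "(2::'k poly) \<noteq> 0"
  proof
    assume "(2::'k poly) = 0"
    then have "poly (2::'k poly) 0 = 0" by simp
    with ch[of 2] p2 show False by simp
  qed
  have al': "M * b = - (2 * T * a^2 * W)" using al unfolding W_def by Groebner_Basis.algebra
  have be': "M^2 = 2 * T * a^2 * (a * pderiv M - 3 * M * pderiv a)" using be by Groebner_Basis.algebra
  have al2: "pderiv M * b + M * pderiv b = - (2 * T * (2 * a * pderiv a * W + a^2 * pderiv W))"
  proof -
    have p2: "pderiv (2::'k poly) = 0" by (metis derivation_numeral derivation_pderiv)
    have "pderiv (M * b) = pderiv (- (2 * T * (a * a) * W))" using al' by (simp add: power2_eq_square)
    then show ?thesis unfolding pderiv_mult pderiv_minus T(2) p2 by Groebner_Basis.algebra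
  qed
  \<comment> \<open>The identity \<open>al'\<close> expresses \<open>M\<close> through
    \<open>a\<close> and \<open>b\<close>; inserted into \<open>be'\<close> it leaves a differential
    equation for \<open>a / b\<close> alone.\<close>
  have "2 * 2 * T^2 * a^5 * (pderiv W * b - 2 * W * pderiv b) = 0"
    using al' be' al2 W_def by Groebner_Basis.algebra
  moreover have "2 * 2 * T^2 * a^5 \<noteq> 0" using two T(1) ab(1) no_zero_divisors power_not_zero by metis
  ultimately have "pderiv W * b - 2 * W * pderiv b = 0" using no_zero_divisors by blast
  then have "pderiv W * b = 2 * W * pderiv b" by simp
  from quotient_affine[OF ch ab(2) deg this W_def] show ?thesis .
qed

subsection \<open>Surfaces through prescribed lines\<close>

text \<open>There are \<open>(d + 1)^3\<close> coefficients, while a restriction to a line has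
  degree at most \<open>3 * d\<close>, so vanishing at \<open>3 * d + 1\<close> values of the
  parameter suffices for each line.\<close>

lemma surface_through_lines:
  fixes S :: "'k::field line set"
  assumes inf: "infinite (UNIV :: 'k set)" and S: "finite S" "card S * (3 * d + 1) < (d + 1)^3"
  shows "\<exists>f. f \<noteq> 0 \<and> pdeg_le d d d f \<and> (\<forall>l\<in>S. res l f = 0)"
proof -
  obtain Y :: "'k set" where Y: "finite Y" "card Y = 3 * d + 1"
    using inf infinite_arbitrarily_large by blast
  define I where "I = {..d} \<times> {..d} \<times> {..d}"
  define m :: "nat \<times> nat \<times> nat \<Rightarrow> 'k poly poly poly"
    where "m = (\<lambda>(i, j, k). monom (monom (monom 1 k) j) i)"
  have "finite (S \<times> Y)" "finite I" using S Y by (simp_all add: I_def)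
  moreover have "card (S \<times> Y) < card I"
    using S(2) Y by (simp add: I_def card_cartesian_product power3_eq_cube algebra_simps)
  ultimately obtain c where c: "\<exists>i\<in>I. c i \<noteq> 0"
    "\<forall>q\<in>S \<times> Y. (\<Sum>i\<in>I. poly (res (fst q) (m i)) (snd q) * c i) = 0"
    using homogeneous_system_solution[of "S \<times> Y" I "\<lambda>q i. poly (res (fst q) (m i)) (snd q)"] by blast
  define f where "f = (\<Sum>(i, j, k)\<in>I. monom (monom (monom (c (i, j, k)) k) j) i)"
  have co: "coeff (coeff (coeff f i) j) k = (if (i, j, k) \<in> I then c (i, j, k) else 0)" for i j k
  proof -
    have "coeff (coeff (coeff f i) j) k = (\<Sum>x\<in>I. if x = (i, j, k) then c (i, j, k) else 0)"
      unfolding f_def coeff_sum by (rule sum.cong) (auto split: prod.splits)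
    then show ?thesis by (simp add: I_def)
  qed
  have f: "f = (\<Sum>x\<in>I. [:[:[:c x:]:]:] * m x)"
    unfolding f_def by (rule sum.cong) (auto simp: m_def smult_monom)
  have "f \<noteq> 0"
  proof
    assume "f = 0"
    then have "c x = 0" if "x \<in> I" for x using co[of "fst x" "fst (snd x)" "snd (snd x)"] that by simp
    with c(1) show False by blast
  qed
  moreover have pd: "pdeg_le d d d f"
    unfolding pdeg_le_def
    by (intro conjI allI degree_le impI poly_eqI) (auto simp: co I_def)
  moreover have "res l f = 0" if l: "l \<in> S" for l
  proof (rule ccontr)
    assume n: "res l f \<noteq> 0"
    have rc: "res l [:[:[:z:]:]:] = [:z:]" for z by (simp add: res_def split: prod.splits)
    have rs: "res l (sum h A) = (\<Sum>x\<in>A. res l (h x))" for h :: "nat \<times> nat \<times> nat \<Rightarrow> _" and A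
      by (induction A rule: infinite_finite_induct) (simp_all add: res_hom)
    have "poly (res l f) y = 0" if "y \<in> Y" for y
    proof -
      have "poly (res l f) y = (\<Sum>i\<in>I. poly (res l (m i)) y * c i)"
        unfolding f rs res_hom rc poly_sum by (rule sum.cong) simp_all
      then show ?thesis using c(2) l that by auto
    qed
    then have "card Y \<le> card {y. poly (res l f) y = 0}"
      using n by (intro card_mono poly_roots_finite) auto
    also have "\<dots> \<le> degree (res l f)" using n by (rule card_poly_roots_bound)
    also have "\<dots> \<le> d + d + d" using pd by (rule degree_res)
    finally show False using Y by simp
  qed
  ultimately show ?thesis by blast
qed

section \<open>Irreducible factors, separability and degrees of the umbilic equations\<close>

lemma nonunit_imp_tdeg_pos:
  fixes f :: "'k::field poly poly poly"
  shows "f \<noteq> 0 \<Longrightarrow> \<not> f dvd 1 \<Longrightarrow> tdeg f > 0"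
  using tdeg_eq_0_imp_unit by blast

text \<open>In a factorization \<open>h = h1 * h2\<close> every line lies on one of the factors and
  \<open>tdeg\<close> is additive, so one factor carries at least its proportional share of the
  lines. This ratio survives down to an irreducible factor.\<close>

lemma irreducible_factor_many_lines:
  fixes h :: "'k::field poly poly poly"
  assumes "h \<noteq> 0" "\<not> h dvd 1" "finite S" "\<And>l. l \<in> S \<Longrightarrow> res l h = 0"
  shows "\<exists>f. irreducible f \<and> f dvd h \<and> card S * tdeg f \<le> card {l\<in>S. res l f = 0} * tdeg h"
  using assms
proof (induction "tdeg h" arbitrary: h S rule: less_induct)
  case less
  show ?case
  proof (cases "irreducible h")
    case True
    have "{l\<in>S. res l h = 0} = S" using less.prems by auto
    with True show ?thesis by (intro exI[of _ h]) auto
  next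
    case False
    then obtain h1 h2 where h: "h = h1 * h2" "\<not> h1 dvd 1" "\<not> h2 dvd 1"
      using less.prems by (auto simp: irreducible_def)
    have nz: "h1 \<noteq> 0" "h2 \<noteq> 0" using h less.prems by auto
    have td: "tdeg h = tdeg h1 + tdeg h2" using nz h by (simp add: tdeg_mult)
    have pos: "tdeg h1 > 0" "tdeg h2 > 0" using nz h nonunit_imp_tdeg_pos by blast+
    define S1 S2 where "S1 = {l\<in>S. res l h1 = 0}" and "S2 = {l\<in>S. res l h2 = 0}"
    have "S = S1 \<union> S2" using less.prems(4) by (auto simp: S1_def S2_def h res_hom)
    then have "card S \<le> card S1 + card S2" by (simp add: card_Un_le)
    then have "card S * tdeg h1 + card S * tdeg h2 \<le> card S1 * tdeg h + card S2 * tdeg h"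
      unfolding td by (metis add_mult_distrib add_mult_distrib2 mult_le_mono1)
    then have or: "card S * tdeg h1 \<le> card S1 * tdeg h \<or> card S * tdeg h2 \<le> card S2 * tdeg h" by linarith
    have *: "\<exists>f. irreducible f \<and> f dvd h \<and> card S * tdeg f \<le> card {l\<in>S. res l f = 0} * tdeg h"
      if h': "tdeg h' < tdeg h" "h' \<noteq> 0" "\<not> h' dvd 1" "h' dvd h" "tdeg h' > 0"
        and c: "card S * tdeg h' \<le> card {l\<in>S. res l h' = 0} * tdeg h" for h'
    proof -
      let ?S = "{l\<in>S. res l h' = 0}"
      have "\<exists>f. irreducible f \<and> f dvd h' \<and> card ?S * tdeg f \<le> card {l\<in>?S. res l f = 0} * tdeg h'"
        by (rule less.hyps[OF h'(1-3)]) (use less.prems(3) in simp_all)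
      then obtain f where f: "irreducible f" "f dvd h'" "card ?S * tdeg f \<le> card {l\<in>?S. res l f = 0} * tdeg h'"
        by blast
      have "card {l\<in>?S. res l f = 0} \<le> card {l\<in>S. res l f = 0}"
        using less.prems(3) by (intro card_mono) auto
      then have "card ?S * tdeg f \<le> card {l\<in>S. res l f = 0} * tdeg h'"
        using f(3) by (meson le_trans mult_le_mono1)
      then have "card ?S * tdeg f * tdeg h \<le> card {l\<in>S. res l f = 0} * tdeg h' * tdeg h"
        by (rule mult_le_mono1)
      moreover have "card S * tdeg h' * tdeg f \<le> card ?S * tdeg h * tdeg f"
        using c by (rule mult_le_mono1)
      moreover have "tdeg h' * (card S * tdeg f) = card S * tdeg h' * tdeg f"
        "card ?S * tdeg h * tdeg f = card ?S * tdeg f * tdeg h"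
        "card {l\<in>S. res l f = 0} * tdeg h' * tdeg h = tdeg h' * (card {l\<in>S. res l f = 0} * tdeg h)"
        by (simp_all only: ac_simps)
      ultimately have "tdeg h' * (card S * tdeg f) \<le> tdeg h' * (card {l\<in>S. res l f = 0} * tdeg h)"
        by linarith
      then have "card S * tdeg f \<le> card {l\<in>S. res l f = 0} * tdeg h" using h'(5) by simp
      with f h'(4) show ?thesis using dvd_trans by blast
    qed
    from or show ?thesis
    proof
      assume "card S * tdeg h1 \<le> card S1 * tdeg h"
      then show ?thesis unfolding S1_def by (intro *[of h1]) (use pos nz h td in simp_all)
    next
      assume "card S * tdeg h2 \<le> card S2 * tdeg h"
      then show ?thesis unfolding S2_def by (intro *[of h2]) (use pos nz h td in simp_all)
    qed
  qed
qed

text \<open>Differentiation in a variable that occurs in \<open>f\<close> lowers the degree in that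
  variable, and the result is nonzero since the degree is below \<open>p\<close>. By additivity of
  the partial degrees \<open>f\<close> cannot divide it. So \<open>f\<close> is singular only on a
  proper subset of its zero set.\<close>

lemma exists_partial_not_dvd:
  fixes f :: "'k::field poly poly poly"
  assumes ch: "\<And>n. 0 < n \<Longrightarrow> n < p \<Longrightarrow> of_nat n \<noteq> (0::'k)"
    and f: "f \<noteq> 0" "tdeg f > 0" "tdeg f < p"
  shows "\<exists>h\<in>{dX f, dY f, dZ f}. h \<noteq> 0 \<and> \<not> f dvd h"
proof -
  have ch1: "of_nat n \<noteq> (0::'k poly)" if "0 < n" "n < p" for n
    using ch[OF that] unfolding of_nat_poly by simp
  have ch2: "of_nat n \<noteq> (0::'k poly poly)" if "0 < n" "n < p" for n
    using ch1[OF that] unfolding of_nat_poly[where 'a = "'k poly"] by simp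
  have pd: "degree (pderiv q) \<le> degree q - 1" for q :: "'b::idom poly"
    by (rule degree_le) (simp add: coeff_pderiv coeff_eq_0)
  consider "degree f > 0" | "zdeg f > 0" | "ydeg f > 0" using f(2) by (auto simp: tdeg_def)
  then show ?thesis
  proof cases
    case 1
    have "degree f < p" using f(3) by (simp add: tdeg_def)
    then have "coeff (dX f) (degree f - 1) \<noteq> 0"
      using 1 ch2[of "degree f"] f(1) by (simp add: dX_def coeff_pderiv del: of_nat_Suc)
    then have n: "dX f \<noteq> 0" by auto
    have "\<not> f dvd dX f"
    proof
      assume "f dvd dX f"
      from dvd_imp_degree_le[OF this n] pd[of f] 1 show False by (simp add: dX_def)
    qed
    with n show ?thesis by blast
  next
    case 2
    obtain i where i: "coeff (coeff f i) (zdeg f) \<noteq> 0" using zdeg_attained[OF f(1)] by blast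
    have "zdeg f < p" using f(3) by (simp add: tdeg_def)
    then have "coeff (coeff (dZ f) i) (zdeg f - 1) \<noteq> 0"
      using 2 ch1[of "zdeg f"] i by (simp add: dZ_def coeff_map_poly coeff_pderiv del: of_nat_Suc)
    then have n: "dZ f \<noteq> 0" by auto
    have "\<not> f dvd dZ f"
    proof
      assume "f dvd dZ f"
      then obtain q where q: "dZ f = f * q" by (elim dvdE)
      have "zdeg (dZ f) = zdeg f + zdeg q" using q n f(1) by (auto simp: zdeg_mult)
      moreover have "zdeg (dZ f) \<le> zdeg f - 1"
      proof (rule zdeg_le)
        fix i
        have "coeff (dZ f) i = pderiv (coeff f i)" by (simp add: dZ_def coeff_map_poly)
        then show "degree (coeff (dZ f) i) \<le> zdeg f - 1" using pd[of "coeff f i"] zdeg[of f i] by simp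
      qed
      ultimately show False using 2 by simp
    qed
    with n show ?thesis by blast
  next
    case 3
    obtain i j where i: "coeff (coeff (coeff f i) j) (ydeg f) \<noteq> 0" using ydeg_attained[OF f(1)] by blast
    have "ydeg f < p" using f(3) by (simp add: tdeg_def)
    then have "coeff (coeff (coeff (dY f) i) j) (ydeg f - 1) \<noteq> 0"
      using 3 ch[of "ydeg f"] i by (simp add: dY_def coeff_map_poly coeff_pderiv del: of_nat_Suc)
    then have n: "dY f \<noteq> 0" by auto
    have "\<not> f dvd dY f"
    proof
      assume "f dvd dY f"
      then obtain q where q: "dY f = f * q" by (elim dvdE)
      have "ydeg (dY f) = ydeg f + ydeg q" using q n f(1) by (auto simp: ydeg_mult)
      moreover have "ydeg (dY f) \<le> ydeg f - 1"
      proof (rule ydeg_le)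
        fix i j
        have "coeff (coeff (dY f) i) j = pderiv (coeff (coeff f i) j)" by (simp add: dY_def coeff_map_poly)
        then show "degree (coeff (coeff (dY f) i) j) \<le> ydeg f - 1"
          using pd[of "coeff (coeff f i) j"] ydeg[of f i j] by simp
      qed
      ultimately show False using 3 by simp
    qed
    with n show ?thesis by blast
  qed
qed

text \<open>The umbilic equations are homogeneous of degree four in the partial derivatives of
  \<open>f\<close>.\<close>

lemma umb_pdeg:
  fixes f :: "'k::idom poly poly poly"
  assumes "pdeg_le a b c f"
  shows "pdeg_le (4 * a) (4 * b) (4 * c) (umb0 f)" "pdeg_le (4 * a) (4 * b) (4 * c) (umb1 f)"
proof -
  have num: "pdeg_le 0 0 0 (numeral n :: 'k poly poly poly)" for n
  proof -
    have "(numeral n :: 'k poly poly poly) = [:[:[:numeral n:]:]:]" by (simp add: numeral_poly)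
    moreover have "pdeg_le 0 0 0 [:[:[:x:]:]:]" for x :: 'k
      by (simp add: pdeg_le_def coeff_pCons split: nat.split)
    ultimately show ?thesis by metis
  qed
  note d = pdeg_le_d[OF assms] and d2 = pdeg_le_d(1)[OF pdeg_le_d(1)[OF assms]]
    pdeg_le_d(2)[OF pdeg_le_d(1)[OF assms]] pdeg_le_d(3)[OF pdeg_le_d(1)[OF assms]]
    pdeg_le_d(2)[OF pdeg_le_d(2)[OF assms]] pdeg_le_d(2)[OF pdeg_le_d(3)[OF assms]]
    pdeg_le_d(3)[OF pdeg_le_d(3)[OF assms]]
  have m3: "pdeg_le (3 * a) (3 * b) (3 * c) (h1 * h2 * h3)" "pdeg_le (3 * a) (3 * b) (3 * c) (h1 * (h2 * h3))"
    if "pdeg_le a b c h1" "pdeg_le a b c h2" "pdeg_le a b c h3" for h1 h2 h3 :: "'k poly poly poly"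
    using pdeg_le_mult[OF pdeg_le_mult[OF that(1,2)] that(3)] by (simp_all add: ac_simps numeral_3_eq_3)
  have n3: "pdeg_le (3 * a) (3 * b) (3 * c) (2 * h1 * h2 * h3)"
    if "pdeg_le a b c h1" "pdeg_le a b c h2" "pdeg_le a b c h3" for h1 h2 h3 :: "'k poly poly poly"
    using pdeg_le_mult[OF num m3(1)[OF that], of "num.Bit0 num.One"] by (simp add: mult.assoc)
  have M: "pdeg_le (3 * a) (3 * b) (3 * c) (surfM f)"
    unfolding surfM_def power2_eq_square by (intro pdeg_le_add pdeg_le_diff m3 n3 d d2)
  have N: "pdeg_le (3 * a) (3 * b) (3 * c) (surfN f)"
    unfolding surfN_def power2_eq_square by (intro pdeg_le_add pdeg_le_diff m3 n3 d d2)
  have L: "pdeg_le (3 * a) (3 * b) (3 * c) (surfL f)"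
    unfolding surfL_def power2_eq_square by (intro pdeg_le_add pdeg_le_diff m3 n3 d d2)
  have m4: "pdeg_le (4 * a) (4 * b) (4 * c) (h1 * h)"
    if "pdeg_le a b c h1" "pdeg_le (3 * a) (3 * b) (3 * c) h" for h1 h :: "'k poly poly poly"
    using pdeg_le_mult[OF that] by (simp add: numeral_eq_Suc)
  have n4: "pdeg_le (4 * a) (4 * b) (4 * c) (2 * h1 * h)"
    if "pdeg_le a b c h1" "pdeg_le (3 * a) (3 * b) (3 * c) h" for h1 h :: "'k poly poly poly"
    using pdeg_le_mult[OF num m4[OF that], of "num.Bit0 num.One"] by (simp add: mult.assoc)
  show "pdeg_le (4 * a) (4 * b) (4 * c) (umb0 f)" unfolding umb0_def
    by (intro pdeg_le_diff m4 d M L)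
  show "pdeg_le (4 * a) (4 * b) (4 * c) (umb1 f)" unfolding umb1_def
    by (intro pdeg_le_diff m4 n4 d M N)
qed

section \<open>Double counting and greedy sampling\<close>

lemma card_filter_eq_sum: "finite A \<Longrightarrow> card {a\<in>A. P a} = (\<Sum>a\<in>A. if P a then 1 else 0)"
  by (simp flip: sum.inter_filter)

lemma sum_card_swap:
  assumes "finite A" "finite B"
  shows "(\<Sum>a\<in>A. card {b\<in>B. P a b}) = (\<Sum>b\<in>B. card {a\<in>A. P a b})"
  unfolding card_filter_eq_sum[OF assms(1)] card_filter_eq_sum[OF assms(2)] by (rule sum.swap)

text \<open>Random sampling made deterministic. While more than a quarter of \<open>R\<close> has
  fewer than \<open>h\<close> neighbours in \<open>B0\<close>, averaging over \<open>B\<close>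
  yields an element that lowers the total deficiency \<open>\<Phi>\<close> by at least
  \<open>card R * (D - h) / (4 * card B)\<close>.\<close>

lemma greedy_cover:
  fixes E :: "'r \<Rightarrow> 'b \<Rightarrow> bool"
  assumes fin: "finite R" "finite B" and R: "R \<noteq> {}" and D: "h < D"
    and deg: "\<And>r. r \<in> R \<Longrightarrow> D \<le> card {b\<in>B. E r b}"
  shows "\<exists>B0\<subseteq>B. card B0 * (D - h) \<le> 4 * card B * h + (D - h) \<and>
    4 * card {r\<in>R. card {b\<in>B0. E r b} < h} \<le> card R"
proof -
  define hits where "hits B0 r = card {b\<in>B0. E r b}" for B0 r
  define unsat where "unsat B0 = {r\<in>R. hits B0 r < h}" for B0
  define \<Phi> where "\<Phi> B0 = (\<Sum>r\<in>R. h - hits B0 r)" for B0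
  have claim: "\<exists>B0\<subseteq>B. card B0 \<le> n \<and> (4 * card (unsat B0) \<le> card R \<or>
      4 * card B * \<Phi> B0 + n * card R * (D - h) \<le> 4 * card B * (card R * h))" for n
  proof (induction n)
    case 0
    show ?case by (intro exI[of _ "{}"]) (simp add: \<Phi>_def hits_def)
  next
    case (Suc n)
    then obtain B0 where B0: "B0 \<subseteq> B" "card B0 \<le> n" and
      or: "4 * card (unsat B0) \<le> card R \<or> 4 * card B * \<Phi> B0 + n * card R * (D - h) \<le> 4 * card B * (card R * h)"
      by blast
    show ?case
    proof (cases "4 * card (unsat B0) \<le> card R")
      case True
      with B0 show ?thesis by (intro exI[of _ B0]) auto
    next
      case False
      have finB0: "finite B0" using B0 fin finite_subset by blast
      define gain where "gain b = card {r\<in>unsat B0. E r b}" for b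
      have "card (unsat B0) * (D - h) \<le> (\<Sum>r\<in>unsat B0. card {b\<in>B - B0. E r b})"
      proof -
        have "D - h \<le> card {b\<in>B - B0. E r b}" if "r \<in> unsat B0" for r
        proof -
          have "{b\<in>B. E r b} \<subseteq> {b\<in>B - B0. E r b} \<union> {b\<in>B0. E r b}" by auto
          then have "card {b\<in>B. E r b} \<le> card ({b\<in>B - B0. E r b} \<union> {b\<in>B0. E r b})"
            using fin finB0 by (intro card_mono) auto
          then have "card {b\<in>B. E r b} \<le> card {b\<in>B - B0. E r b} + card {b\<in>B0. E r b}"
            using card_Un_le order_trans by blast
          moreover have "D \<le> card {b\<in>B. E r b}" "card {b\<in>B0. E r b} < h"
            using that deg by (auto simp: unsat_def hits_def)
          ultimately show ?thesis by linarith
        qed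
        then have "(\<Sum>r\<in>unsat B0. D - h) \<le> (\<Sum>r\<in>unsat B0. card {b\<in>B - B0. E r b})"
          by (rule sum_mono)
        then show ?thesis by simp
      qed
      also have "(\<Sum>r\<in>unsat B0. card {b\<in>B - B0. E r b}) = (\<Sum>b\<in>B - B0. gain b)"
        unfolding gain_def using fin by (intro sum_card_swap) (auto simp: unsat_def)
      finally have tot: "card (unsat B0) * (D - h) \<le> (\<Sum>b\<in>B - B0. gain b)" .
      have "\<exists>b\<in>B - B0. card (unsat B0) * (D - h) \<le> card B * gain b"
      proof (rule ccontr)
        assume "\<not> ?thesis"
        then have lt: "card B * gain b < card (unsat B0) * (D - h)" if "b \<in> B - B0" for b
          using that not_le by blast
        have pos: "card (unsat B0) * (D - h) > 0" using False D by auto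
        have ne: "B - B0 \<noteq> {}"
        proof
          assume "B - B0 = {}"
          then have "(\<Sum>b\<in>B - B0. gain b) = 0" by (simp only: sum.empty)
          with tot pos show False by linarith
        qed
        have "card B * (\<Sum>b\<in>B - B0. gain b) = (\<Sum>b\<in>B - B0. card B * gain b)"
          by (simp add: sum_distrib_left)
        also have "\<dots> < (\<Sum>b\<in>B - B0. card (unsat B0) * (D - h))"
          using lt ne fin by (intro sum_strict_mono) auto
        also have "\<dots> = card (B - B0) * (card (unsat B0) * (D - h))" by simp
        also have "\<dots> \<le> card B * (\<Sum>b\<in>B - B0. gain b)"
          using tot fin by (intro mult_le_mono card_mono) auto
        finally show False by simp
      qed
      then obtain b where b: "b \<in> B" "b \<notin> B0" "card (unsat B0) * (D - h) \<le> card B * gain b" by auto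
      have hi: "hits (insert b B0) r = hits B0 r + (if E r b then 1 else 0)" for r
      proof -
        have "{x\<in>insert b B0. E r x} = (if E r b then insert b {x\<in>B0. E r x} else {x\<in>B0. E r x})" by auto
        then show ?thesis using b finB0 by (simp add: hits_def)
      qed
      have "\<Phi> (insert b B0) + gain b \<le> \<Phi> B0"
      proof -
        have "gain b = (\<Sum>r\<in>R. if r \<in> unsat B0 \<and> E r b then 1 else 0)"
          unfolding gain_def using fin
          by (subst card_filter_eq_sum[symmetric]) (auto simp: unsat_def intro!: arg_cong[where f = card])
        then have "\<Phi> (insert b B0) + gain b = (\<Sum>r\<in>R. (h - hits (insert b B0) r) + (if r \<in> unsat B0 \<and> E r b then 1 else 0))"
          by (simp add: \<Phi>_def sum.distrib)
        also have "\<dots> \<le> \<Phi> B0" unfolding \<Phi>_def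
          by (rule sum_mono) (auto simp: hi unsat_def)
        finally show ?thesis .
      qed
      then have "4 * card B * (\<Phi> (insert b B0) + gain b) \<le> 4 * card B * \<Phi> B0"
        by (rule mult_le_mono2)
      moreover have "4 * card B * (\<Phi> (insert b B0) + gain b) = 4 * card B * \<Phi> (insert b B0) + 4 * (card B * gain b)"
        by (simp add: algebra_simps)
      moreover have "card R * (D - h) \<le> 4 * card (unsat B0) * (D - h)"
        by (rule mult_le_mono1) (use False in linarith)
      moreover have "4 * card (unsat B0) * (D - h) = 4 * (card (unsat B0) * (D - h))" by simp
      moreover have "Suc n * card R * (D - h) = card R * (D - h) + n * card R * (D - h)" by (simp add: algebra_simps)
      moreover have "4 * card B * \<Phi> B0 + n * card R * (D - h) \<le> 4 * card B * (card R * h)" using or False by blast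
      ultimately have "4 * card B * \<Phi> (insert b B0) + Suc n * card R * (D - h) \<le> 4 * card B * (card R * h)"
        using b(3) by linarith
      with B0 b finB0 show ?thesis by (intro exI[of _ "insert b B0"]) auto
    qed
  qed
  \<comment> \<open>The first number of steps at which the deficiency, initially at most
    \<open>card R * h\<close>, would have to be negative.\<close>
  define n where "n = 4 * card B * h div (D - h) + 1"
  have "4 * card B * h < n * (D - h)"
  proof -
    have "4 * card B * h = 4 * card B * h div (D - h) * (D - h) + 4 * card B * h mod (D - h)"
      by (rule div_mult_mod_eq[symmetric])
    moreover have "4 * card B * h mod (D - h) < D - h" using D by simp
    moreover have "n * (D - h) = 4 * card B * h div (D - h) * (D - h) + (D - h)" by (simp add: n_def)
    ultimately show ?thesis by linarith
  qed
  then have big: "4 * card B * (card R * h) < n * card R * (D - h)"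
  proof -
    have "card R > 0" using R fin by (simp add: card_gt_0_iff)
    then have "card R * (4 * card B * h) < card R * (n * (D - h))"
      using \<open>4 * card B * h < n * (D - h)\<close> by simp
    then show ?thesis by (simp add: ac_simps)
  qed
  from claim[of n] obtain B0 where B0: "B0 \<subseteq> B" "card B0 \<le> n" and or: "4 * card (unsat B0) \<le> card R \<or>
      4 * card B * \<Phi> B0 + n * card R * (D - h) \<le> 4 * card B * (card R * h)"
    by blast
  from or big have un: "4 * card (unsat B0) \<le> card R" by linarith
  have "card B0 * (D - h) \<le> n * (D - h)" using B0(2) by simp
  also have "\<dots> \<le> 4 * card B * h + (D - h)"
    unfolding n_def using div_times_less_eq_dividend[of "4 * card B * h" "D - h"] by (simp add: add_mult_distrib)
  finally show ?thesis using B0 un unfolding unsat_def hits_def by blast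
qed

subsection \<open>Crossing lines\<close>

text \<open>For distinct nonzero slopes this is intersection in space with the common point
  eliminated, and \<open>crossing\<close> is its \<open>y\<close> coordinate. In this form the
  condition is the symplectic equation on parameters.\<close>

definition meets :: "'k::field line \<Rightarrow> 'k line \<Rightarrow> bool" where
  "meets l l' \<longleftrightarrow> (case l of (t, u, g) \<Rightarrow> case l' of (t', u', g') \<Rightarrow> g - g' = t' * u - t * u')"

definition crossing :: "'k::field line \<Rightarrow> 'k line \<Rightarrow> 'k" where
  "crossing l l' = (case l of (t, u, g) \<Rightarrow> case l' of (t', u', g') \<Rightarrow> (g - g') / (t' - t))"

text \<open>Collinearity of the parameter triples, not a statement about points in the space that
  contains the lines.\<close>

definition on_common_line :: "'k::field line set \<Rightarrow> bool" where
  "on_common_line S \<longleftrightarrow> (\<exists>t0 u0 g0 a b c. (a, b, c) \<noteq> (0, 0, 0) \<and>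
     (\<forall>l\<in>S. \<exists>\<mu>. l = (t0 + \<mu> * a, u0 + \<mu> * b, g0 + \<mu> * c)))"

lemma meets_sym: "meets l l' \<longleftrightarrow> meets l' l"
  by (auto simp: meets_def algebra_simps split: prod.splits)

lemma meets_crossing:
  assumes "meets (t, u, g) (t', u', g')" "t \<noteq> t'" "t \<noteq> 0" "t' \<noteq> 0"
  defines "y \<equiv> crossing (t, u, g) (t', u', g')"
  shows "(y - u) / t = (y - u') / t'" "g + t * y = g' + t' * y"
proof -
  have tt: "t' - t \<noteq> 0" using assms(2) by simp
  have y: "y * (t' - t) = g - g'" using tt by (simp add: y_def crossing_def)
  then show "g + t * y = g' + t' * y" by (simp add: algebra_simps)
  have "g - g' = t' * u - t * u'" using assms(1) by (simp add: meets_def)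
  then have "(y - u) * t' = (y - u') * t" using y by Groebner_Basis.algebra
  then show "(y - u) / t = (y - u') / t'" using assms by (simp add: frac_eq_eq)
qed

lemma same_point_meets:
  assumes "(y - u) / t = (y - u') / t'" "g + t * y = g' + t' * y" "t \<noteq> 0" "t' \<noteq> 0"
  shows "meets (t, u, g) (t', u', g')"
proof -
  have "(y - u) * t' = (y - u') * t" using assms by (simp add: frac_eq_eq)
  then show ?thesis using assms(2) unfolding meets_def by (simp add: algebra_simps) Groebner_Basis.algebra
qed

lemma poly_res_crossing:
  assumes "meets l l'" "fst l \<noteq> fst l'" "fst l \<noteq> 0" "fst l' \<noteq> 0"
  shows "poly (res l f) (crossing l l') = poly (res l' f) (crossing l l')"
proof -
  obtain t u g t' u' g' where l: "l = (t, u, g)" "l' = (t', u', g')" by (metis prod_cases3)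
  note m = meets_crossing[OF assms(1)[unfolded l]] assms(2-4)[unfolded l]
  show ?thesis unfolding l poly_res using m by simp
qed

text \<open>Two lines crossing \<open>l\<close> at the same point meet each other. This is where
  freedom from meetings inside one colour is used: it makes crossings countable as zeros of a
  polynomial on \<open>l\<close>.\<close>

lemma crossing_inj:
  assumes "fst l \<noteq> 0" and C: "\<And>c. c \<in> C \<Longrightarrow> meets l c \<and> fst l \<noteq> fst c \<and> fst c \<noteq> 0"
    and non: "\<And>c c'. c \<in> C \<Longrightarrow> c' \<in> C \<Longrightarrow> c \<noteq> c' \<Longrightarrow> \<not> meets c c'"
  shows "inj_on (crossing l) C"
proof (rule inj_onI, rule ccontr)
  fix c c' assume c: "c \<in> C" "c' \<in> C" "crossing l c = crossing l c'" "c \<noteq> c'"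
  obtain t u g where l: "l = (t, u, g)" by (metis prod_cases3)
  obtain t1 u1 g1 where c1: "c = (t1, u1, g1)" by (metis prod_cases3)
  obtain t2 u2 g2 where c2: "c' = (t2, u2, g2)" by (metis prod_cases3)
  note C1 = C[OF c(1)] and C2 = C[OF c(2)]
  have "meets (t1, u1, g1) (t2, u2, g2)"
  proof (rule same_point_meets)
    show "t1 \<noteq> 0" "t2 \<noteq> 0" using C1 C2 c1 c2 by auto
    show "(crossing l c - u1) / t1 = (crossing l c - u2) / t2"
      using meets_crossing(1)[of t u g t1 u1 g1] meets_crossing(1)[of t u g t2 u2 g2] C1 C2 assms(1) c(3)
      unfolding l c1 c2 by (metis fst_conv)
    show "g1 + t1 * crossing l c = g2 + t2 * crossing l c"
      using meets_crossing(2)[of t u g t1 u1 g1] meets_crossing(2)[of t u g t2 u2 g2] C1 C2 assms(1) c(3)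
      unfolding l c1 c2 by (metis fst_conv)
  qed
  with non[OF c(1,2,4)] c1 c2 show False by simp
qed

lemma card_crossing_zeros:
  assumes "fst l \<noteq> 0" and C: "\<And>c. c \<in> C \<Longrightarrow> meets l c \<and> fst l \<noteq> fst c \<and> fst c \<noteq> 0"
    and non: "\<And>c c'. c \<in> C \<Longrightarrow> c' \<in> C \<Longrightarrow> c \<noteq> c' \<Longrightarrow> \<not> meets c c'"
    and q: "q \<noteq> 0" and z: "\<And>c. c \<in> C \<Longrightarrow> poly q (crossing l c) = 0"
  shows "card C \<le> degree q"
proof -
  have "card C = card (crossing l ` C)"
    using crossing_inj[OF assms(1-3)] by (simp add: card_image)
  also have "\<dots> \<le> card {y. poly q y = 0}" using q z by (intro card_mono poly_roots_finite) auto
  also have "\<dots> \<le> degree q" using q by (rule card_poly_roots_bound)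
  finally show ?thesis .
qed

text \<open>Multiplying out, \<open>crossing (t, u, g) c * (t - t') = g' - g\<close> turns the
  condition into a linear equation in \<open>t'\<close> and \<open>g'\<close>. Meeting
  \<open>(t, u, g)\<close> is a second linear equation, which determines \<open>u'\<close>; together
  they cut out a line.\<close>

lemma reciprocal_affine_imp_common_line:
  fixes C :: "'k::field line set"
  assumes t: "t \<noteq> 0"
    and C: "\<And>c. c \<in> C \<Longrightarrow> meets (t, u, g) c \<and> t \<noteq> fst c \<and>
        1 = (\<omega> + \<kappa> * crossing (t, u, g) c) * (t - fst c)"
  shows "on_common_line C"
proof (cases "C = {}")
  case True
  then show ?thesis unfolding on_common_line_def by (intro exI[of _ 1]) auto
next
  case False
  have eq: "1 = \<omega> * (t - t') + \<kappa> * (g' - g)" "u' = (g' - g + u * t') / t" if "(t', u', g') \<in> C" for t' u' g'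
  proof -
    have m: "g - g' = t' * u - t * u'" and tt: "t \<noteq> t'"
      and e: "1 = (\<omega> + \<kappa> * ((g - g') / (t' - t))) * (t - t')"
      using C[OF that] by (auto simp only: meets_def crossing_def prod.case fst_conv)
    have "t' - t \<noteq> 0" using tt by simp
    define q where "q = (g - g') / (t' - t)"
    have q: "q * (t' - t) = g - g'" using \<open>t' - t \<noteq> 0\<close> by (simp add: q_def)
    show "1 = \<omega> * (t - t') + \<kappa> * (g' - g)"
      using e[folded q_def] q by Groebner_Basis.algebra
    have "t * u' = g' - g + u * t'" using m by (simp add: algebra_simps)
    then show "u' = (g' - g + u * t') / t" using t by (simp add: field_simps)
  qed
  show ?thesis
  \<comment> \<open>For nonzero \<open>\<kappa>\<close> the line is parametrized by
    \<open>t'\<close>; otherwise \<open>t'\<close> is constant and \<open>g'\<close> is the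
    parameter.\<close>
  proof (cases "\<kappa> = 0")
    case False
    define g0 where "g0 = g + (1 - \<omega> * t) / \<kappa>"
    have *: "(t', u', g') = (0 + t' * 1, (g0 - g) / t + t' * ((\<omega> / \<kappa> + u) / t), g0 + t' * (\<omega> / \<kappa>))"
      if "(t', u', g') \<in> C" for t' u' g'
    proof -
      have g': "g' = g0 + t' * (\<omega> / \<kappa>)" using eq(1)[OF that] False
        by (simp add: g0_def field_simps)
      have "u' = (g0 + t' * (\<omega> / \<kappa>) - g + u * t') / t" using eq(2)[OF that] g' by simp
      also have "\<dots> = (g0 - g) / t + t' * ((\<omega> / \<kappa> + u) / t)"
        by (simp add: add_divide_distrib diff_divide_distrib algebra_simps)
      finally show ?thesis using g' by simp
    qed
    have "\<forall>l\<in>C. \<exists>\<mu>. l = (0 + \<mu> * 1, (g0 - g) / t + \<mu> * ((\<omega> / \<kappa> + u) / t), g0 + \<mu> * (\<omega> / \<kappa>))"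
      using * by (metis prod_cases3)
    then show ?thesis unfolding on_common_line_def
      by (intro exI[of _ 0] exI[of _ "(g0 - g) / t"] exI[of _ g0] exI[of _ 1]
          exI[of _ "(\<omega> / \<kappa> + u) / t"] exI[of _ "\<omega> / \<kappa>"] conjI) simp_all
  next
    case True
    then have w: "\<omega> \<noteq> 0" using eq(1) \<open>C \<noteq> {}\<close> by fastforce
    define t0 where "t0 = t - 1 / \<omega>"
    have *: "(t', u', g') = (t0 + g' * 0, (- g + u * t0) / t + g' * (1 / t), 0 + g' * 1)"
      if "(t', u', g') \<in> C" for t' u' g'
    proof -
      have "\<omega> * t' = \<omega> * t - 1" using eq(1)[OF that] True by (simp add: algebra_simps)
      then have t': "t' = t0" using w by (simp add: t0_def field_simps)
      then show ?thesis using eq(2)[OF that] t by (simp add: field_simps)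
    qed
    have "\<forall>l\<in>C. \<exists>\<mu>. l = (t0 + \<mu> * 0, (- g + u * t0) / t + \<mu> * (1 / t), 0 + \<mu> * 1)"
      using * by (metis prod_cases3)
    then show ?thesis unfolding on_common_line_def
      by (intro exI[of _ t0] exI[of _ "(- g + u * t0) / t"] exI[of _ 0] exI[of _ 0]
          exI[of _ "1 / t"] exI[of _ 1] conjI) simp_all
  qed
qed

text \<open>
  A small subset \<open>B0\<close> of \<open>B\<close> lies on a surface of degree about \<open>d\<close>, which then contains most of \<open>R\<close>.
  Taking the surface of minimal degree provides an irreducible factor \<open>f\<close> that carries its share of the
  lines and does not divide the cofactor, so only few of these lines lie on both.
\<close>

lemma rich_lines_give_common_line:
  fixes R B :: "'k::field line set"
  assumes inf: "infinite (UNIV :: 'k set)"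
    and ch: "\<And>n. 0 < n \<Longrightarrow> n < p \<Longrightarrow> of_nat n \<noteq> (0::'k)"
    and fin: "finite R" "finite B"
    and tR: "\<And>l. l \<in> R \<Longrightarrow> fst l \<noteq> 0" and tB: "\<And>l. l \<in> B \<Longrightarrow> fst l \<noteq> 0"
    and tRB: "\<And>l l'. l \<in> R \<Longrightarrow> l' \<in> B \<Longrightarrow> fst l \<noteq> fst l'"
    and nR: "\<And>l l'. l \<in> R \<Longrightarrow> l' \<in> R \<Longrightarrow> l \<noteq> l' \<Longrightarrow> \<not> meets l l'"
    and nB: "\<And>l l'. l \<in> B \<Longrightarrow> l' \<in> B \<Longrightarrow> l \<noteq> l' \<Longrightarrow> \<not> meets l l'"
    and injR: "inj_on (\<lambda>(t, u, g). (t, g)) R"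
    and deg: "\<And>l. l \<in> R \<Longrightarrow> D \<le> card {l'\<in>B. meets l l'}"
    and d: "d \<ge> 3" "72 * card B \<le> (d - 2) * D" "216 * d^2 < card R" "36 * d < D" "12 * d + 2 * k < D"
      "6 * d + 1 < p"
  shows "\<exists>S\<subseteq>B. k < card S \<and> on_common_line S"
proof -
  have Rne: "R \<noteq> {}" using d(3) by auto
  \<comment> \<open>One more than the degree \<open>3 * d\<close> of the surface on a line, so that
    \<open>h\<close> crossings with lines of the surface put a line into it.\<close>
  define h where "h = 3 * d + 1"
  obtain B0 where B0: "B0 \<subseteq> B" "card B0 * (D - h) \<le> 4 * card B * h + (D - h)"
      "4 * card {l\<in>R. card {b\<in>B0. meets l b} < h} \<le> card R"
    using greedy_cover[OF fin Rne, of h D meets] deg d by (auto simp: h_def)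
  have finB0: "finite B0" using B0 fin finite_subset by blast
  \<comment> \<open>The factor 72 is \<open>4 * 18\<close>, with 4 from \<open>greedy_cover\<close>.
    It yields \<open>9 * card B0 \<le> h * (d - 2) + 9\<close>, and \<open>h^2 / 9\<close> is about
    \<open>d^2\<close>.\<close>
  have "card B0 * h < (d + 1)^3"
  proof -
    have Dh: "D \<le> 2 * (D - h)" using d(1,4) by (simp add: h_def)
    have "18 * (card B0 * (D - h)) \<le> h * (72 * card B) + 18 * (D - h)" using B0(2) by (simp add: algebra_simps)
    also have "\<dots> \<le> h * ((d - 2) * D) + 18 * (D - h)" using d(2) by simp
    also have "\<dots> \<le> h * ((d - 2) * (2 * (D - h))) + 18 * (D - h)"
      using Dh by (intro add_mono mult_le_mono) auto
    also have "\<dots> = (D - h) * (2 * (h * (d - 2)) + 18)"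
      by (simp only: distrib_left ac_simps)
    finally have "(D - h) * (18 * card B0) \<le> (D - h) * (2 * (h * (d - 2)) + 18)" by (simp add: ac_simps)
    moreover have "D - h > 0" using d(1,4) by (simp add: h_def)
    ultimately have "18 * card B0 \<le> 2 * (h * (d - 2)) + 18" by simp
    then have "9 * card B0 * h \<le> (h * (d - 2) + 9) * h" by (intro mult_le_mono1) simp
    also have "\<dots> < 9 * (d + 1)^3"
    proof -
      obtain x where x: "d = x + 2" using d(1) that[of "d - 2"] by simp
      show ?thesis unfolding h_def x by (simp add: power3_eq_cube algebra_simps)
    qed
    finally show ?thesis by simp
  qed
  then obtain f' where f': "f' \<noteq> 0" "pdeg_le d d d f'" "\<And>l. l \<in> B0 \<Longrightarrow> res l f' = 0"
    using surface_through_lines[OF inf finB0, of d] by (auto simp: h_def)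
  have degf': "degree (res l f') \<le> 3 * d" for l using degree_res[OF f'(2), of l] by simp
  define R1 where "R1 = {l\<in>R. h \<le> card {b\<in>B0. meets l b}}"
  have R1R: "R1 \<subseteq> R" by (auto simp: R1_def)
  have R1: "res l f' = 0" if "l \<in> R1" for l
  proof (rule ccontr)
    assume n: "res l f' \<noteq> 0"
    have l: "l \<in> R" "h \<le> card {b\<in>B0. meets l b}" using that by (auto simp: R1_def)
    have "card {b\<in>B0. meets l b} \<le> degree (res l f')"
    proof (rule card_crossing_zeros[of l, OF tR[OF l(1)] _ _ n])
      fix c assume c: "c \<in> {b\<in>B0. meets l b}"
      then have cB: "c \<in> B" "meets l c" using B0(1) by auto
      show "meets l c \<and> fst l \<noteq> fst c \<and> fst c \<noteq> 0" using cB tRB[OF l(1) cB(1)] tB by auto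
      then show "poly (res l f') (crossing l c) = 0"
        using poly_res_crossing[of l c f'] tR[OF l(1)] f'(3)[of c] c by auto
    next
      fix c c' assume "c \<in> {b\<in>B0. meets l b}" "c' \<in> {b\<in>B0. meets l b}" "c \<noteq> c'"
      then show "\<not> meets c c'" using nB B0(1) by blast
    qed
    with degf'[of l] l(2) show False by (simp add: h_def)
  qed
  \<comment> \<open>A line of \<open>B\<close> off the surface crosses at most \<open>3 * d\<close>
    lines of \<open>R1\<close>, so most incidences of \<open>R1\<close> are with
    \<open>B1\<close>.\<close>
  define B1 where "B1 = {b\<in>B. res b f' = 0}"
  have few: "card {l\<in>R1. meets l b} \<le> 3 * d" if b: "b \<in> B - B1" for b
  proof -
    have n: "res b f' \<noteq> 0" and bB: "b \<in> B" using b by (auto simp: B1_def)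
    have "card {l\<in>R1. meets l b} \<le> degree (res b f')"
    proof (rule card_crossing_zeros[of b, OF tB[OF bB] _ _ n])
      fix c assume c: "c \<in> {l\<in>R1. meets l b}"
      then have cR: "c \<in> R" "meets b c" using R1R meets_sym by blast+
      show "meets b c \<and> fst b \<noteq> fst c \<and> fst c \<noteq> 0" using cR tRB[OF cR(1) bB] tR by auto
      then show "poly (res b f') (crossing b c) = 0"
        using poly_res_crossing[of b c f'] tB[OF bB] R1[of c] c by auto
    next
      fix c c' assume "c \<in> {l\<in>R1. meets l b}" "c' \<in> {l\<in>R1. meets l b}" "c \<noteq> c'"
      then show "\<not> meets c c'" using nR R1R by blast
    qed
    with degf'[of b] show ?thesis by simp
  qed
  define R2 where "R2 = {l\<in>R1. 2 * card {b\<in>B - B1. meets l b} < D}"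
  have R2R: "R2 \<subseteq> R" "finite R2" using R1R fin by (auto simp: R2_def intro: finite_subset)
  have finR1: "finite R1" using R1R fin finite_subset by blast
  have cR2: "card R \<le> 2 * card R2"
  proof -
    have "card (R1 - R2) * D = (\<Sum>l\<in>R1 - R2. D)" by simp
    also have "\<dots> \<le> (\<Sum>l\<in>R1 - R2. 2 * card {b\<in>B - B1. meets l b})"
      by (rule sum_mono) (auto simp: R2_def)
    also have "\<dots> \<le> (\<Sum>l\<in>R1. 2 * card {b\<in>B - B1. meets l b})"
      using finR1 by (intro sum_mono2) auto
    also have "\<dots> = 2 * (\<Sum>b\<in>B - B1. card {l\<in>R1. meets l b})"
      by (simp only: sum_distrib_left[symmetric] sum_card_swap[OF finR1 finite_Diff[OF fin(2)]])
    also have "\<dots> \<le> 2 * (\<Sum>b\<in>B - B1. 3 * d)" using few by (intro mult_le_mono2 sum_mono) auto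
    also have "\<dots> \<le> 6 * d * card B" using fin by (simp add: card_mono)
    finally have "12 * (card (R1 - R2) * D) \<le> 12 * (6 * d * card B)" by (rule mult_le_mono2)
    also have "\<dots> = d * (72 * card B)" by simp
    also have "\<dots> \<le> d * ((d - 2) * D)" using d(2) by simp
    also have "\<dots> \<le> d * (d * D)" by simp
    finally have "D * (12 * card (R1 - R2)) \<le> D * (d * d)" by (simp add: ac_simps)
    then have c12: "12 * card (R1 - R2) \<le> d^2" using d(4) by (simp add: power2_eq_square)
    have "R = {l\<in>R. card {b\<in>B0. meets l b} < h} \<union> (R1 - R2) \<union> R2" by (auto simp: R1_def R2_def)
    then have "card R \<le> card {l\<in>R. card {b\<in>B0. meets l b} < h} + card (R1 - R2) + card R2"
      by (metis (no_types, lifting) card_Un_le add_le_mono1 le_trans)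
    then show ?thesis using B0(3) c12 d(3) by linarith
  qed
  have rich: "D \<le> 2 * card {b\<in>B1. meets l b}" if "l \<in> R2" for l
  proof -
    have "{b\<in>B. meets l b} \<subseteq> {b\<in>B1. meets l b} \<union> {b\<in>B - B1. meets l b}" by auto
    then have "card {b\<in>B. meets l b} \<le> card ({b\<in>B1. meets l b} \<union> {b\<in>B - B1. meets l b})"
      using fin by (intro card_mono) (auto simp: B1_def)
    also have "\<dots> \<le> card {b\<in>B1. meets l b} + card {b\<in>B - B1. meets l b}" by (rule card_Un_le)
    finally show ?thesis using deg[of l] that R2R(1) by (auto simp: R2_def)
  qed
  have B1B: "B1 \<subseteq> B" "finite B1" using fin by (auto simp: B1_def)
  define P where "P q \<longleftrightarrow> q \<noteq> 0 \<and> (\<forall>l\<in>R2 \<union> B1. res l q = 0)" for q :: "'k poly poly poly"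
  have "P f'" using f' R1 by (auto simp: P_def B1_def R2_def)
  then obtain f0 where f0: "P f0" and min: "\<And>q. P q \<Longrightarrow> tdeg f0 \<le> tdeg q"
    using ex_has_least_nat[of P f' tdeg] by blast
  have t0: "tdeg f0 \<le> 3 * d" using min[OF \<open>P f'\<close>] tdeg_le[OF f'(2)] by linarith
  have R2ne: "R2 \<noteq> {}" using cR2 d(3) by auto
  have "\<not> f0 dvd 1"
  proof
    assume "f0 dvd 1"
    then obtain q where "1 = f0 * q" by (elim dvdE)
    moreover obtain l where "l \<in> R2" using R2ne by blast
    ultimately have "(1::'k poly) = res l f0 * res l q" by (metis res_hom(2,6))
    moreover have "res l f0 = 0" using f0 \<open>l \<in> R2\<close> by (auto simp: P_def)
    ultimately show False by simp
  qed
  with f0 R2R irreducible_factor_many_lines[of f0 R2]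
  obtain f where f: "irreducible f" "f dvd f0" "card R2 * tdeg f \<le> card {l\<in>R2. res l f = 0} * tdeg f0"
    by (auto simp: P_def)
  define e where "e = tdeg f"
  have fne: "f \<noteq> 0" "\<not> f dvd 1" using f(1) by (auto simp: irreducible_def)
  have e1: "e \<ge> 1" using nonunit_imp_tdeg_pos[OF fne] by (simp add: e_def)
  obtain q where q: "f0 = f * q" using f(2) by (elim dvdE)
  have qne: "q \<noteq> 0" using q f0 by (auto simp: P_def)
  have tq: "tdeg f0 = e + tdeg q" using q qne fne by (simp add: tdeg_mult e_def)
  then have e3: "e \<le> 3 * d" "tdeg q \<le> 3 * d" using t0 by auto
  \<comment> \<open>A repeated factor could be dropped without losing any of the lines, against the
    minimality of \<open>f0\<close>.\<close>
  have nfq: "\<not> f dvd q"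
  proof
    assume "f dvd q"
    then obtain q' where "q = f * q'" by (elim dvdE)
    then have "P q" using f0 qne by (auto simp: P_def q res_hom)
    from min[OF this] tq e1 show False by simp
  qed
  have ep: "e < p" using e3 d(6) by simp
  \<comment> \<open>The partial derivative \<open>w\<close> is a witness of smoothness: at its
    nonzeros the gradient of \<open>f\<close> does not vanish.\<close>
  obtain w where w: "w \<in> {dX f, dY f, dZ f}" "w \<noteq> 0" "\<not> f dvd w"
    using exists_partial_not_dvd[of p f] ch fne e1 ep by (auto simp: e_def)
  have pw: "pdeg_le (degree f) (zdeg f) (ydeg f) w"
    using w(1) pdeg_le_d[OF pdeg_le_self[of f]] by auto
  have degw: "degree (res l w) \<le> e" for l using degree_res[OF pw, of l] by (simp add: e_def tdeg_def)
  have dle: "degree w \<le> e" "zdeg w \<le> e" "degree f \<le> e" "zdeg f \<le> e"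
    using pw by (auto simp: pdeg_le_def e_def tdeg_def intro!: zdeg_le) (metis add.commute trans_le_add1 trans_le_add2)
  define Rf where "Rf = {l\<in>R2. res l f = 0}"
  have Rf: "Rf \<subseteq> R" "finite Rf" using R2R by (auto simp: Rf_def)
  have injRf: "inj_on (\<lambda>(t, u, g). (t, g)) S" if "S \<subseteq> Rf" for S
    using inj_on_subset[OF injR] Rf that by blast
  have common: "card {l\<in>Rf. res l v = 0} \<le> 2 * e * m"
    if "\<not> f dvd v" "degree v \<le> m" "zdeg v \<le> m" "m \<ge> 1" for v m
  proof (rule card_common_lines[OF f(1) that(1) dle(3,4) that(2-4)])
    show "finite {l\<in>Rf. res l v = 0}" using Rf(2) by simp
    show "inj_on (\<lambda>(t, u, g). (t, g)) {l\<in>Rf. res l v = 0}" by (rule injRf) auto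
    show "res l f = 0 \<and> res l v = 0" if "l \<in> {l\<in>Rf. res l v = 0}" for l using that by (simp add: Rf_def)
  qed
  \<comment> \<open>Lines on the cofactor \<open>q\<close>, or with \<open>w\<close> identically
    zero along them, are discarded; \<open>card_common_lines\<close> shows that they are
    few.\<close>
  define R3 where "R3 = {l\<in>Rf. res l q \<noteq> 0 \<and> res l w \<noteq> 0}"
  have R3: "R3 \<subseteq> Rf" "finite R3" using Rf by (auto simp: R3_def)
  have cR3: "8 * e^2 < card R3"
  proof -
    have q1: "card {l\<in>Rf. res l q = 0} \<le> 2 * e * (3 * d)"
      by (rule common[OF nfq]) (use e3(2) d(1) in \<open>auto simp: tdeg_def\<close>)
    have q2: "card {l\<in>Rf. res l w = 0} \<le> 2 * e * e"
      by (rule common[OF w(3) dle(1,2) e1])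
    have "Rf = R3 \<union> {l\<in>Rf. res l q = 0} \<union> {l\<in>Rf. res l w = 0}" by (auto simp: R3_def)
    then have "card Rf \<le> card R3 + card {l\<in>Rf. res l q = 0} + card {l\<in>Rf. res l w = 0}"
      by (metis (no_types, lifting) card_Un_le add_le_mono1 le_trans)
    with q1 q2 have a: "card Rf \<le> card R3 + 6 * (e * d) + 2 * (e * e)" by simp
    have "108 * d^2 * e < card R2 * e" using cR2 d(3) e1 by simp
    also have "\<dots> \<le> card Rf * tdeg f0" using f(3) by (simp add: e_def Rf_def)
    also have "\<dots> \<le> card Rf * (3 * d)" using t0 by simp
    finally have "(3 * d) * (36 * (e * d)) < (3 * d) * card Rf" by (simp add: power2_eq_square ac_simps)
    then have "36 * (e * d) < card Rf" by (metis mult_less_cancel1)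
    moreover have "e * e \<le> 3 * (e * d)" using e3(1) by (simp add: mult_le_mono2 ac_simps)
    ultimately show ?thesis using a unfolding power2_eq_square by linarith
  qed
  \<comment> \<open>At such a crossing \<open>dX f\<close> and \<open>dY f\<close> are multiples of
    \<open>dZ f\<close>, so \<open>w\<close> being nonzero there implies that \<open>dZ f\<close> is
    nonzero.\<close>
  define Cl where "Cl l = {b\<in>B1. meets l b \<and> res b f = 0 \<and> poly (res l w) (crossing l b) \<noteq> 0}" for l
  have Cl: "D \<le> 2 * card (Cl l) + 12 * d" if l: "l \<in> R3" for l
  proof -
    have lR: "l \<in> R" "l \<in> R2" "res l q \<noteq> 0" "res l w \<noteq> 0" "res l f = 0"
      using l R3 Rf by (auto simp: R3_def Rf_def)
    have props: "meets l c \<and> fst l \<noteq> fst c \<and> fst c \<noteq> 0" if "c \<in> B1" "meets l c" for c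
      using that B1B tRB[OF lR(1)] tB by blast
    let ?Z = "\<lambda>v. {b\<in>B1. meets l b \<and> poly (res l v) (crossing l b) = 0}"
    have z: "card (?Z v) \<le> degree (res l v)" if "res l v \<noteq> 0" for v
      by (rule card_crossing_zeros[of l, OF tR[OF lR(1)] _ _ that]) (use props nB B1B in blast)+
    have "{b\<in>B1. meets l b} \<subseteq> Cl l \<union> ?Z q \<union> ?Z w"
    proof
      fix b assume b: "b \<in> {b\<in>B1. meets l b}"
      have "res b f * res b q = 0" using f0 b by (auto simp: P_def q res_hom)
      then consider "res b f = 0" | "res b q = 0" by auto
      then show "b \<in> Cl l \<union> ?Z q \<union> ?Z w"
      proof cases
        case 1
        then show ?thesis using b by (auto simp: Cl_def)
      next
        case 2
        then have "poly (res l q) (crossing l b) = 0"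
          using poly_res_crossing[of l b q] b props[of b] tR[OF lR(1)] by auto
        then show ?thesis using b by auto
      qed
    qed
    then have "card {b\<in>B1. meets l b} \<le> card (Cl l \<union> ?Z q \<union> ?Z w)"
      using B1B by (intro card_mono) (auto simp: Cl_def)
    also have "\<dots> \<le> card (Cl l) + card (?Z q) + card (?Z w)"
      by (metis (no_types, lifting) card_Un_le add_le_mono1 le_trans)
    finally show ?thesis
      using rich[OF lR(2)] z[OF lR(3)] z[OF lR(4)] degree_res_tdeg[of l q] degw[of l] e3 by linarith
  qed
  have cross: "poly (res l (umb0 f)) (crossing l b) = 0" "poly (res l (umb1 f)) (crossing l b) = 0"
    "poly (res l (dZ f)) (crossing l b) \<noteq> 0"
    "poly (res l (dY f)) (crossing l b) = - (fst l + fst b) * poly (res l (dZ f)) (crossing l b)"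
    "meets l b" "fst l \<noteq> fst b" "fst b \<noteq> 0" "b \<in> B" if l: "l \<in> R3" and b: "b \<in> Cl l" for l b
  proof -
    have lR: "l \<in> R" "res l f = 0" using l R3 Rf by (auto simp: R3_def Rf_def)
    have bB: "b \<in> B" "meets l b" "res b f = 0" "poly (res l w) (crossing l b) \<noteq> 0"
      using b B1B by (auto simp: Cl_def)
    show t: "fst l \<noteq> fst b" "fst b \<noteq> 0" "meets l b" "b \<in> B" using bB tRB[OF lR(1)] tB by auto
    obtain t u g where l': "l = (t, u, g)" by (metis prod_cases3)
    obtain t' u' g' where b': "b = (t', u', g')" by (metis prod_cases3)
    have tt: "t \<noteq> 0" "t' \<noteq> 0" "t \<noteq> t'" using t tR[OF lR(1)] by (auto simp: l' b')
    note mc = meets_crossing[OF t(3)[unfolded l' b'] tt(3,1,2)]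
    note cu = crossing_umbilic[OF tt lR(2)[unfolded l'] bB(3)[unfolded b'] mc]
    show "poly (res l (umb0 f)) (crossing l b) = 0" "poly (res l (umb1 f)) (crossing l b) = 0"
      using cu(3,4) by (simp_all add: l' b')
    show dy: "poly (res l (dY f)) (crossing l b) = - (fst l + fst b) * poly (res l (dZ f)) (crossing l b)"
      using cu(1) by (simp add: l' b')
    have dx: "poly (res l (dX f)) (crossing l b) = fst l * fst b * poly (res l (dZ f)) (crossing l b)"
      using cu(2) by (simp add: l' b')
    show "poly (res l (dZ f)) (crossing l b) \<noteq> 0"
    proof
      assume z: "poly (res l (dZ f)) (crossing l b) = 0"
      with dx dy w(1) have "poly (res l w) (crossing l b) = 0" by auto
      with bB(4) show False by simp
    qed
  qed
  \<comment> \<open>On each line of \<open>R3\<close> the restriction of \<open>v\<close> has degree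
    at most \<open>4 * e\<close> but vanishes at more crossings, hence it is zero. More than
    \<open>2 * e * (4 * e)\<close> common lines force divisibility.\<close>
  have um: "f dvd v" if v: "v = umb0 f \<or> v = umb1 f" for v
  proof (rule ccontr)
    assume n: "\<not> f dvd v"
    have pv: "pdeg_le (4 * degree f) (4 * zdeg f) (4 * ydeg f) v"
      using v umb_pdeg[OF pdeg_le_self[of f]] by auto
    have on: "res l v = 0" if l: "l \<in> R3" for l
    proof (rule ccontr)
      assume nz: "res l v \<noteq> 0"
      have lR: "l \<in> R" using l R3 Rf by auto
      have "card (Cl l) \<le> degree (res l v)"
        by (rule card_crossing_zeros[of l, OF tR[OF lR] _ _ nz]) (use cross[OF l] v nB in auto)
      also have "\<dots> \<le> 4 * e" using degree_res[OF pv, of l] by (simp add: e_def tdeg_def)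
      finally show False using Cl[OF l] d(1,4) e3 by linarith
    qed
    have "degree v \<le> 4 * e" using pv dle(3) unfolding pdeg_le_def by linarith
    moreover have "zdeg v \<le> 4 * e"
    proof (rule zdeg_le)
      show "degree (coeff v i) \<le> 4 * e" for i
        using pv dle(4) unfolding pdeg_le_def by (meson le_trans mult_le_mono2)
    qed
    moreover have "R3 \<subseteq> {l\<in>Rf. res l v = 0}" using on R3 by auto
    then have "card R3 \<le> card {l\<in>Rf. res l v = 0}" using Rf(2) by (intro card_mono) auto
    ultimately have "card R3 \<le> 2 * e * (4 * e)" using common[OF n, of "4 * e"] e1 by linarith
    with cR3 show False by (simp add: power2_eq_square)
  qed
  have "R3 \<noteq> {}" using cR3 by auto
  then obtain l where l: "l \<in> R3" by blast
  have lR: "l \<in> R" "res l f = 0" using l R3 Rf by (auto simp: R3_def Rf_def)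
  obtain t u g where l': "l = (t, u, g)" by (metis prod_cases3)
  have t: "t \<noteq> 0" using tR[OF lR(1)] by (simp add: l')
  have big: "k < card (Cl l)" using Cl[OF l] d(5) by linarith
  then obtain b where b: "b \<in> Cl l" by (metis card.empty ex_in_conv not_less_zero)
  define \<alpha> where "\<alpha> = res (t, u, g) (dZ f)"
  define \<beta> where "\<beta> = res (t, u, g) (dY f) + smult (2 * t) (res (t, u, g) (dZ f))"
  \<comment> \<open>The quotient of \<open>\<beta>\<close> by \<open>\<alpha>\<close> at a crossing
    is the difference of the two slopes.\<close>
  have \<beta>val: "poly \<beta> (crossing l c) = (t - fst c) * poly \<alpha> (crossing l c)" if "c \<in> Cl l" for c
    using cross(4)[OF l that] by (simp add: \<alpha>_def \<beta>_def l' algebra_simps)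
  have \<alpha>val: "poly \<alpha> (crossing l c) \<noteq> 0" if "c \<in> Cl l" for c
    using cross(3)[OF l that] by (simp add: \<alpha>_def l')
  have ne: "\<alpha> \<noteq> 0" "\<beta> \<noteq> 0"
    using \<alpha>val[OF b] \<beta>val[OF b] cross(6)[OF l b] by (auto simp: l')
  have pd: "degree (res (t, u, g) (dY f)) \<le> e" "degree \<alpha> \<le> e"
    using degree_res[OF pdeg_le_d(2)[OF pdeg_le_self[of f]]] degree_res[OF pdeg_le_d(3)[OF pdeg_le_self[of f]]]
    by (auto simp: e_def tdeg_def \<alpha>_def)
  then have pdb: "degree \<beta> \<le> e" unfolding \<beta>_def
    by (intro degree_add_le order_trans[OF degree_smult_le]) (simp_all add: \<alpha>_def)
  have "\<exists>\<kappa> \<omega>. res (t, u, g) (dZ f) =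
      [:\<omega>, \<kappa>:] * (res (t, u, g) (dY f) + smult (2 * t) (res (t, u, g) (dZ f)))"
  proof (rule umbilic_line_affine[where p = p and e = e, OF inf])
    show "of_nat n \<noteq> (0::'k)" if "0 < n" "n < p" for n using ch that by blast
    show "2 < p" "2 * e + 1 < p" using d(1,6) e3(1) by linarith+
    show "t \<noteq> 0" by (rule t)
    show "res (t, u, g) f = 0" using lR(2) by (simp add: l')
    show "f dvd umb0 f" "f dvd umb1 f" using um by blast+
    show "res (t, u, g) (dZ f) \<noteq> 0" "degree (res (t, u, g) (dZ f)) \<le> e"
      using ne(1) pd(2) by (simp_all add: \<alpha>_def)
    show "res (t, u, g) (dY f) + smult (2 * t) (res (t, u, g) (dZ f)) \<noteq> 0"
      "degree (res (t, u, g) (dY f) + smult (2 * t) (res (t, u, g) (dZ f))) \<le> e"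
      using ne(2) pdb by (simp_all add: \<beta>_def)
  qed
  then obtain \<kappa> \<omega> where aff: "\<alpha> = [:\<omega>, \<kappa>:] * \<beta>" unfolding \<alpha>_def \<beta>_def by blast
  have "on_common_line (Cl l)"
  proof (rule reciprocal_affine_imp_common_line[OF t])
    fix c assume c: "c \<in> Cl l"
    define y where "y = crossing l c"
    have "poly \<alpha> y = (\<omega> + \<kappa> * y) * ((t - fst c) * poly \<alpha> y)"
      using arg_cong[OF aff, of "\<lambda>q. poly q y"] \<beta>val[OF c] by (simp add: y_def algebra_simps)
    then have "poly \<alpha> y * (1 - (\<omega> + \<kappa> * y) * (t - fst c)) = 0" by (simp add: algebra_simps)
    then have "1 = (\<omega> + \<kappa> * y) * (t - fst c)" using \<alpha>val[OF c] by (simp add: y_def)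
    then show "meets (t, u, g) c \<and> t \<noteq> fst c \<and> 1 = (\<omega> + \<kappa> * crossing (t, u, g) c) * (t - fst c)"
      using cross(5,6)[OF l c] by (simp add: l' y_def)
  qed
  moreover have "Cl l \<subseteq> B" using B1B by (auto simp: Cl_def)
  ultimately show ?thesis using big by blast
qed

subsection \<open>Incidences between two families of lines\<close>

text \<open>If every line of \<open>R\<close> were rich, surfaces of degree proportional to
  \<open>sqrt (card R)\<close> would apply. The bound \<open>card R \<le> p^2\<close> keeps this
  degree below the characteristic.\<close>

lemma exists_poor_line:
  fixes R B :: "'k::field line set" and p k :: nat
  assumes inf: "infinite (UNIV :: 'k set)"
    and ch: "\<And>n. 0 < n \<Longrightarrow> n < p \<Longrightarrow> of_nat n \<noteq> (0::'k)"
    and fin: "finite R" "finite B"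
    and tR: "\<And>l. l \<in> R \<Longrightarrow> fst l \<noteq> 0" and tB: "\<And>l. l \<in> B \<Longrightarrow> fst l \<noteq> 0"
    and tRB: "\<And>l l'. l \<in> R \<Longrightarrow> l' \<in> B \<Longrightarrow> fst l \<noteq> fst l'"
    and nR: "\<And>l l'. l \<in> R \<Longrightarrow> l' \<in> R \<Longrightarrow> l \<noteq> l' \<Longrightarrow> \<not> meets l l'"
    and nB: "\<And>l l'. l \<in> B \<Longrightarrow> l' \<in> B \<Longrightarrow> l \<noteq> l' \<Longrightarrow> \<not> meets l l'"
    and injR: "inj_on (\<lambda>(t, u, g). (t, g)) R"
    and col: "\<And>S. S \<subseteq> B \<Longrightarrow> on_common_line S \<Longrightarrow> card S \<le> k"
    and R: "R \<noteq> {}" "card R \<le> p^2"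
  shows "\<exists>l\<in>R. real (card {l'\<in>B. meets l l'}) \<le>
    4320 * card B / sqrt (card R) + 4 * sqrt (card R) + (2 * k + 3)"
proof (rule ccontr)
  define s where "s = sqrt (card R)"
  define b where "b = card B"
  define bound where "bound = 4320 * b / s + 4 * s + (2 * k + 3)"
  assume "\<not> ?thesis"
  then have gt: "real (card {l'\<in>B. meets l l'}) > bound" if "l \<in> R" for l
    using that by (auto simp: bound_def s_def b_def not_le)
  have s1: "s \<ge> 1" using R fin by (simp add: s_def card_gt_0_iff Suc_le_eq)
  have s2: "s^2 = card R" by (simp add: s_def)
  \<comment> \<open>The divisor 15 satisfies \<open>216 < 15^2\<close>, which yields
    \<open>216 * d^2 < card R\<close>.\<close>
  define d where "d = nat \<lfloor>s / 15\<rfloor>"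
  have "real d = of_int \<lfloor>s / 15\<rfloor>" using s1 by (simp add: d_def)
  then have d_le: "real d \<le> s / 15" and d_ge: "s / 15 < real d + 1" by linarith+
  \<comment> \<open>For smaller \<open>s\<close> the claimed bound exceeds the trivial bound
    \<open>card B\<close>. From 45 on, \<open>d\<close> is at least 3.\<close>
  have s45: "s \<ge> 45"
  proof (rule ccontr)
    assume lt: "\<not> s \<ge> 45"
    obtain l where l: "l \<in> R" using R by blast
    have "card {l'\<in>B. meets l l'} \<le> b" using fin by (simp add: b_def card_mono)
    then have "bound < real b" using gt[OF l] by linarith
    moreover have "real b \<le> 4320 * b / s"
    proof -
      have "real b * s \<le> real b * 4320" using lt by (intro mult_left_mono) auto
      then show ?thesis using s1 by (simp add: field_simps)
    qed
    ultimately show False using s1 by (simp add: bound_def)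
  qed
  have d3: "d \<ge> 3" using d_ge s45 by linarith
  have sp: "s \<le> real p"
  proof -
    have "real (card R) \<le> real p ^ 2" using R(2) by (metis of_nat_le_iff of_nat_power)
    then show ?thesis by (simp add: s_def real_le_lsqrt)
  qed
  define D where "D = nat \<lfloor>bound\<rfloor> + 1"
  have bpos: "bound \<ge> 0" using s1 by (simp add: bound_def)
  have D_gt: "bound < real D" using bpos by (simp add: D_def) linarith
  have deg: "D \<le> card {l'\<in>B. meets l l'}" if "l \<in> R" for l
    using gt[OF that] bpos unfolding D_def by linarith
  have c1: "72 * card B \<le> (d - 2) * D"
  proof -
    \<comment> \<open>For \<open>d \<ge> 3\<close> one has \<open>d + 1 \<le> 4 * (d - 2)\<close>,
      so \<open>s / 60\<close> is below \<open>d - 2\<close>. The constant 4320 is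
      \<open>60 * 72\<close>.\<close>
    have "s / 60 \<le> real (d - 2)" using d_ge d3 by (simp add: of_nat_diff)
    then have "s / 60 * (4320 * b / s) \<le> real (d - 2) * real D"
      using D_gt s1 by (intro mult_mono) (auto simp: bound_def)
    moreover have "s / 60 * (4320 * b / s) = 72 * b" using s1 by simp
    ultimately have "real (72 * b) \<le> real ((d - 2) * D)" by simp
    then show ?thesis unfolding b_def by (simp only: of_nat_le_iff)
  qed
  have c2: "216 * d^2 < card R"
  proof -
    have "real d ^ 2 \<le> (s / 15)^2" using d_le by (intro power_mono) auto
    then have "225 * real d ^ 2 \<le> card R" by (simp add: power_divide s2)
    moreover have "real d ^ 2 > 0" using d3 by simp
    ultimately have "216 * real d ^ 2 < real (card R)" by linarith
    then have "real (216 * d^2) < real (card R)" by simp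
    then show ?thesis by (simp only: of_nat_less_iff)
  qed
  have c3: "36 * d < D"
  proof -
    have "4320 * b / s \<ge> 0" using s1 by simp
    then have "36 * real d < real D" using D_gt d_le s1 unfolding bound_def by linarith
    then have "real (36 * d) < real D" by simp
    then show ?thesis by (simp only: of_nat_less_iff)
  qed
  have c4: "12 * d + 2 * k < D"
  proof -
    have "4320 * b / s \<ge> 0" using s1 by simp
    then have "12 * real d + 2 * real k < real D" using D_gt d_le s1 unfolding bound_def by linarith
    then have "real (12 * d + 2 * k) < real D" by simp
    then show ?thesis by (simp only: of_nat_less_iff)
  qed
  have c5: "6 * d + 1 < p"
  proof -
    have "real (6 * d + 1) < real p" using d_le sp s45 by simp
    then show ?thesis by (simp only: of_nat_less_iff)
  qed
  have "\<exists>S\<subseteq>B. k < card S \<and> on_common_line S"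
    by (rule rich_lines_give_common_line[where R = R and D = D and d = d and p = p])
      (use inf ch fin tR tB tRB nR nB injR deg d3 c1 c2 c3 c4 c5 in blast)+
  then show False using col by (meson not_le)
qed

text \<open>Poor lines are removed one at a time. The sum of the terms \<open>1 / sqrt n\<close> is
  at most \<open>2 * sqrt (card R)\<close>, which doubles 4320 to 8640.\<close>

lemma line_incidence_bound:
  fixes R B :: "'k::field line set" and p k :: nat
  assumes inf: "infinite (UNIV :: 'k set)"
    and ch: "\<And>n. 0 < n \<Longrightarrow> n < p \<Longrightarrow> of_nat n \<noteq> (0::'k)"
    and finB: "finite B" and tB: "\<And>l. l \<in> B \<Longrightarrow> fst l \<noteq> 0"
    and nB: "\<And>l l'. l \<in> B \<Longrightarrow> l' \<in> B \<Longrightarrow> l \<noteq> l' \<Longrightarrow> \<not> meets l l'"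
    and col: "\<And>S. S \<subseteq> B \<Longrightarrow> on_common_line S \<Longrightarrow> card S \<le> k"
    and finR: "finite R" and tR: "\<And>l. l \<in> R \<Longrightarrow> fst l \<noteq> 0"
    and tRB: "\<And>l l'. l \<in> R \<Longrightarrow> l' \<in> B \<Longrightarrow> fst l \<noteq> fst l'"
    and nR: "\<And>l l'. l \<in> R \<Longrightarrow> l' \<in> R \<Longrightarrow> l \<noteq> l' \<Longrightarrow> \<not> meets l l'"
    and injR: "inj_on (\<lambda>(t, u, g). (t, g)) R"
    and R: "card R \<le> p^2"
  shows "real (\<Sum>l\<in>R. card {l'\<in>B. meets l l'}) \<le>
    8640 * card B * sqrt (card R) + 4 * card R * sqrt (card R) + (2 * k + 3) * card R"
  using finR tR tRB nR injR R
proof (induction "card R" arbitrary: R)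
  case 0
  then show ?case by simp
next
  case (Suc n)
  have ne: "R \<noteq> {}" using Suc.hyps(2) by auto
  obtain l where l: "l \<in> R" and le: "real (card {l'\<in>B. meets l l'}) \<le>
    4320 * card B / sqrt (card R) + 4 * sqrt (card R) + (2 * k + 3)"
    using exists_poor_line[OF inf ch Suc.prems(1) finB Suc.prems(2) tB Suc.prems(3,4) nB Suc.prems(5) col ne Suc.prems(6)]
    by blast
  let ?R = "R - {l}"
  have cR: "card ?R = n" using l Suc.hyps(2) Suc.prems(1) by simp
  have IH: "real (\<Sum>l\<in>?R. card {l'\<in>B. meets l l'}) \<le>
    8640 * card B * sqrt (card ?R) + 4 * card ?R * sqrt (card ?R) + (2 * k + 3) * card ?R"
  proof (rule Suc.hyps(1))
    show "n = card ?R" using cR by simp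
    show "finite ?R" using Suc.prems(1) by simp
    show "inj_on (\<lambda>(t, u, g). (t, g)) ?R" using Suc.prems(5) by (rule inj_on_subset) auto
    show "card ?R \<le> p^2" using Suc.prems(6) cR Suc.hyps(2) by simp
  qed (use Suc.prems(2-4) in blast)+
  define s where "s = sqrt (real (Suc n))"
  define s' where "s' = sqrt (real n)"
  have s: "s > 0" "s' \<ge> 0" "s' \<le> s" "s^2 = s'^2 + 1" "s'^2 = real n" by (simp_all add: s_def s'_def)
  have diff: "1 / (2 * s) \<le> s - s'"
  proof -
    have "(s - s') * (s + s') = 1" using s(4) by (simp add: power2_eq_square algebra_simps)
    moreover have "(s - s') * (s + s') \<le> (s - s') * (2 * s)" using s by (intro mult_left_mono) auto
    ultimately have "1 \<le> (s - s') * (2 * s)" by linarith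
    then show ?thesis using s(1) by (simp add: divide_le_eq)
  qed
  have "4320 * card B / s = 8640 * card B * (1 / (2 * s))" by simp
  also have "\<dots> \<le> 8640 * card B * (s - s')" using diff by (intro mult_left_mono) auto
  finally have a: "4320 * card B / s \<le> 8640 * card B * s - 8640 * card B * s'" by (simp add: algebra_simps)
  have b: "4 * s \<le> 4 * Suc n * s - 4 * n * s'"
  proof -
    have "real n * s' \<le> real n * s" using s by (intro mult_left_mono) auto
    then show ?thesis by (simp add: algebra_simps)
  qed
  have "real (\<Sum>l\<in>R. card {l'\<in>B. meets l l'}) = real (card {l'\<in>B. meets l l'}) + real (\<Sum>l\<in>?R. card {l'\<in>B. meets l l'})"
    using l Suc.prems(1) by (simp add: sum.remove)
  also have "\<dots> \<le> (4320 * card B / s + 4 * s + (2 * k + 3)) + (8640 * card B * s' + 4 * n * s' + (2 * k + 3) * n)"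
    using le IH unfolding cR Suc.hyps(2)[symmetric] s_def s'_def by (intro add_mono) auto
  also have "\<dots> \<le> 8640 * card B * s + 4 * Suc n * s + (2 * k + 3) * Suc n"
    using a b by (simp add: algebra_simps)
  finally show ?case unfolding Suc.hyps(2)[symmetric] s_def .
qed

subsection \<open>Incidences over the base field\<close>

definition collinear_bound :: "nat \<Rightarrow> ('f::field \<times> 'f \<times> 'f) set \<Rightarrow> bool" where
  "collinear_bound k S \<longleftrightarrow> (\<forall>a b c a' b' c'. (a', b', c') \<noteq> (0, 0, 0) \<longrightarrow>
     card {P\<in>S. \<exists>\<mu>. P = (a + \<mu> * a', b + \<mu> * b', c + \<mu> * c')} \<le> k)"

text \<open>
  Points over the base field may share coordinates, and the lines they encode may meet within a colour
  class. Moving to the field of rational functions in an indeterminate \<open>tr\<close> allows two different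
  perturbed encodings, for which red lines are pairwise disjoint, blue lines are pairwise disjoint, and a
  red and a blue line meet under the original bilinear condition.
\<close>

definition emb :: "'f::field \<Rightarrow> 'f poly fract" where "emb c = to_fract [:c:]"

definition tr :: "'f::field poly fract" where "tr = to_fract [:0, 1:]"

lemma emb_hom: "emb 0 = 0" "emb 1 = 1" "emb (x + y) = emb x + emb y" "emb (x - y) = emb x - emb y"
  "emb (x * y) = emb x * emb y" "emb x = emb y \<longleftrightarrow> x = y" "emb x = 0 \<longleftrightarrow> x = 0"
  by (simp_all add: emb_def pCons_one flip: to_fract_add to_fract_diff to_fract_mult)

lemma emb_of_nat: "emb (of_nat n) = of_nat n"
  by (induction n) (simp_all add: emb_hom)

lemma tr_indep:
  "emb c0 + emb c1 * tr + emb c2 * tr^2 + emb c3 * tr^3 = 0 \<longleftrightarrow> c0 = 0 \<and> c1 = 0 \<and> c2 = 0 \<and> c3 = 0"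
proof -
  have "emb c0 + emb c1 * tr + emb c2 * tr^2 + emb c3 * tr^3 = to_fract [:c0, c1, c2, c3:]"
    by (simp add: emb_def tr_def power2_eq_square power3_eq_cube flip: to_fract_add to_fract_mult)
  then show ?thesis by simp
qed

lemma tr_nz [simp]: "tr \<noteq> 0" by (simp add: tr_def)

lemma infinite_poly_fract: "infinite (UNIV :: 'f::field poly fract set)"
proof -
  have "inj (\<lambda>n. to_fract (monom (1::'f) n))"
    by (rule injI) (metis degree_monom_eq one_neq_zero to_fract_eq_iff)
  then show ?thesis using infinite_UNIV_nat finite_imageD finite_subset[OF subset_UNIV] by blast
qed

text \<open>The factor \<open>tr^3\<close> sits in the red \<open>u\<close> and in the denominator
  of the blue \<open>t\<close>, and the shifts of the blue \<open>t\<close> and \<open>u\<close>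
  compensate the extra terms in the red \<open>g\<close>; so the mixed condition is free of
  \<open>tr\<close>. Within one colour the coordinate differences appear at different powers of
  \<open>tr\<close>, which excludes meetings. The slopes of the two colours also differ.\<close>

definition redl :: "'f::field \<times> 'f \<times> 'f \<Rightarrow> 'f poly fract line" where
  "redl P = (case P of (a, b, c) \<Rightarrow> (emb a, tr^3 * emb b, emb c + tr * emb a + tr^2 * emb b))"

definition bluel :: "'f::field \<times> 'f \<times> 'f \<Rightarrow> 'f poly fract line" where
  "bluel P = (case P of (a, b, c) \<Rightarrow> ((tr^2 + emb a) / tr^3, emb b - tr, emb c))"

lemma red_meets_blue:
  "meets (redl (a, b, c)) (bluel (a', b', c')) \<longleftrightarrow> c - c' = a' * b - a * b'"
proof -
  have "meets (redl (a, b, c)) (bluel (a', b', c')) \<longleftrightarrow>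
      emb c + tr * emb a + tr^2 * emb b - emb c' = (tr^2 + emb a') / tr^3 * (tr^3 * emb b) - emb a * (emb b' - tr)"
    by (simp add: meets_def redl_def bluel_def)
  also have "(tr^2 + emb a') / tr^3 * (tr^3 * emb b) = (tr^2 + emb a') * emb b" by simp
  also have "emb c + tr * emb a + tr^2 * emb b - emb c' = (tr^2 + emb a') * emb b - emb a * (emb b' - tr) \<longleftrightarrow>
      emb c - emb c' = emb a' * emb b - emb a * emb b'" by (auto simp: algebra_simps)
  also have "\<dots> \<longleftrightarrow> emb (c - c') = emb (a' * b - a * b')" by (simp add: emb_hom)
  finally show ?thesis by (simp add: emb_hom(6))
qed

lemma red_not_meets:
  assumes "meets (redl P) (redl Q)"
  shows "P = Q"
proof -
  obtain a b c a' b' c' where PQ: "P = (a, b, c)" "Q = (a', b', c')" by (metis prod_cases3)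
  have "emb (c - c') + emb (a - a') * tr + emb (b - b') * tr^2 + emb (a * b' - a' * b) * tr^3 = 0"
    using assms by (simp add: meets_def redl_def PQ emb_hom algebra_simps)
  then show ?thesis by (simp add: tr_indep PQ)
qed

lemma blue_not_meets:
  assumes "meets (bluel P) (bluel Q)"
  shows "P = Q"
proof -
  obtain a b c a' b' c' where PQ: "P = (a, b, c)" "Q = (a', b', c')" by (metis prod_cases3)
  have "emb c - emb c' = (tr^2 + emb a') / tr^3 * (emb b - tr) - (tr^2 + emb a) / tr^3 * (emb b' - tr)"
    using assms by (simp add: meets_def bluel_def PQ)
  also have "\<dots> = ((tr^2 + emb a') * (emb b - tr) - (tr^2 + emb a) * (emb b' - tr)) / tr^3"
    by (simp add: diff_divide_distrib)
  finally have "tr^3 * (emb c - emb c') = (tr^2 + emb a') * (emb b - tr) - (tr^2 + emb a) * (emb b' - tr)"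
    by (simp only: eq_divide_eq mult.commute) simp
  then have "emb (a * b' - a' * b) + emb (a' - a) * tr + emb (b' - b) * tr^2 + emb (c - c') * tr^3 = 0"
    by (simp add: emb_hom algebra_simps)
  then show ?thesis by (simp add: tr_indep PQ)
qed

lemma red_inj:
  "inj_on (\<lambda>(t, u, g). (t, g)) (range (redl :: 'a::field \<times> 'a \<times> 'a \<Rightarrow> _))"
  "inj (redl :: 'a \<times> 'a \<times> 'a \<Rightarrow> _)"
proof -
  have *: "P = Q" if "fst (redl P) = fst (redl Q)" "snd (snd (redl P)) = snd (snd (redl Q))" for P Q :: "'a \<times> 'a \<times> 'a"
  proof -
    obtain a b c a' b' c' where PQ: "P = (a, b, c)" "Q = (a', b', c')" by (metis prod_cases3)
    have "emb (c - c') + emb (a - a') * tr + emb (b - b') * tr^2 + emb 0 * tr^3 = 0"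
      using that by (simp add: redl_def PQ emb_hom algebra_simps)
    then show ?thesis by (simp only: tr_indep PQ) simp
  qed
  show "inj_on (\<lambda>(t, u, g). (t, g)) (range (redl :: 'a \<times> 'a \<times> 'a \<Rightarrow> _))"
  proof (rule inj_onI)
    fix x y assume "x \<in> range (redl :: 'a \<times> 'a \<times> 'a \<Rightarrow> _)" "y \<in> range (redl :: 'a \<times> 'a \<times> 'a \<Rightarrow> _)"
      and e: "(\<lambda>(t, u, g). (t, g)) x = (\<lambda>(t, u, g). (t, g)) y"
    then obtain P Q where "x = redl P" "y = redl Q" by auto
    then show "x = y" using *[of P Q] e by (auto split: prod.splits)
  qed
  show "inj (redl :: 'a \<times> 'a \<times> 'a \<Rightarrow> _)" using * by (metis injI)
qed

lemma blue_inj: "inj bluel"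
  by (rule injI, rule blue_not_meets) (auto simp: meets_def algebra_simps split: prod.splits)

text \<open>The common line is defined over the function field only. Measured from two fixed points
  of \<open>S\<close>, the position of any other point is a quotient of coordinate differences,
  hence comes from the base field, and so does the line.\<close>

lemma blue_collinear:
  fixes S :: "('f::field \<times> 'f \<times> 'f) set"
  assumes "on_common_line (bluel ` S)" "collinear_bound k S" "k \<ge> 1" "finite S"
  shows "card S \<le> k"
proof (cases "\<exists>P Q. P \<in> S \<and> Q \<in> S \<and> P \<noteq> Q")
  case False
  then have "card S \<le> 1" using card_le_Suc0_iff_eq[OF assms(4)] by auto
  then show ?thesis using assms(3) by simp
next
  case True
  then obtain P Q where PQ: "P \<in> S" "Q \<in> S" "P \<noteq> Q" by blast
  obtain a0 b0 c0 where P: "P = (a0, b0, c0)" by (metis prod_cases3)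
  obtain a1 b1 c1 where Q: "Q = (a1, b1, c1)" by (metis prod_cases3)
  from assms(1)[unfolded on_common_line_def] obtain t0 u0 g0 a b c
    where ln: "\<forall>l\<in>bluel ` S. \<exists>\<mu>. l = (t0 + \<mu> * a, u0 + \<mu> * b, g0 + \<mu> * c)"
    by (elim exE conjE)
  obtain \<mu>0 where m0: "bluel P = (t0 + \<mu>0 * a, u0 + \<mu>0 * b, g0 + \<mu>0 * c)" using ln PQ by blast
  obtain \<mu>1 where m1: "bluel Q = (t0 + \<mu>1 * a, u0 + \<mu>1 * b, g0 + \<mu>1 * c)" using ln PQ by blast
  have mm: "\<mu>1 - \<mu>0 \<noteq> 0" using m0 m1 PQ(3) blue_inj by (metis eq_iff_diff_eq_0 injD)
  have "S \<subseteq> {R\<in>S. \<exists>\<mu>. R = (a0 + \<mu> * (a1 - a0), b0 + \<mu> * (b1 - b0), c0 + \<mu> * (c1 - c0))}"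
  proof
    fix R assume R: "R \<in> S"
    obtain x y z where Rx: "R = (x, y, z)" by (metis prod_cases3)
    obtain \<mu> where m: "bluel R = (t0 + \<mu> * a, u0 + \<mu> * b, g0 + \<mu> * c)" using ln R by blast
    define \<nu> where "\<nu> = (\<mu> - \<mu>0) / (\<mu>1 - \<mu>0)"
    have nu: "\<nu> * (\<mu>1 - \<mu>0) = \<mu> - \<mu>0" using mm by (simp add: \<nu>_def)
    have e1: "emb y - emb b0 = \<nu> * (emb b1 - emb b0)" and e2: "emb z - emb c0 = \<nu> * (emb c1 - emb c0)"
    proof -
      have "emb y - tr = u0 + \<mu> * b" "emb b0 - tr = u0 + \<mu>0 * b" "emb b1 - tr = u0 + \<mu>1 * b"
        "emb z = g0 + \<mu> * c" "emb c0 = g0 + \<mu>0 * c" "emb c1 = g0 + \<mu>1 * c"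
        using m m0 m1 by (simp_all add: bluel_def P Q Rx)
      then show "emb y - emb b0 = \<nu> * (emb b1 - emb b0)" "emb z - emb c0 = \<nu> * (emb c1 - emb c0)"
        using nu by Groebner_Basis.algebra+
    qed
    have e3: "emb x - emb a0 = \<nu> * (emb a1 - emb a0)"
    proof -
      have "(tr^2 + emb x) / tr^3 = t0 + \<mu> * a" "(tr^2 + emb a0) / tr^3 = t0 + \<mu>0 * a" "(tr^2 + emb a1) / tr^3 = t0 + \<mu>1 * a"
        using m m0 m1 by (simp_all add: bluel_def P Q Rx)
      then have "tr^2 + emb x = (t0 + \<mu> * a) * tr^3" "tr^2 + emb a0 = (t0 + \<mu>0 * a) * tr^3" "tr^2 + emb a1 = (t0 + \<mu>1 * a) * tr^3"
        by (simp_all add: divide_eq_eq)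
      then show ?thesis using nu by Groebner_Basis.algebra
    qed
    have "\<exists>c. \<nu> = emb c"
    proof -
      have key: "\<exists>c. \<nu> = emb c" if "r \<noteq> 0" "emb q = \<nu> * emb r" for q r
      proof -
        have "emb (q / r) * emb r = emb q" using that(1) by (simp flip: emb_hom(5))
        then have "emb (q / r) * emb r = \<nu> * emb r" using that(2) by simp
        then have "emb (q / r) = \<nu>" using that(1) by (simp add: emb_hom)
        then show ?thesis by blast
      qed
      have "a1 - a0 \<noteq> 0 \<or> b1 - b0 \<noteq> 0 \<or> c1 - c0 \<noteq> 0" using PQ(3) P Q by auto
      then show ?thesis
        using key[of "a1 - a0" "x - a0"] key[of "b1 - b0" "y - b0"] key[of "c1 - c0" "z - c0"] e1 e2 e3
        by (auto simp: emb_hom)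
    qed
    then obtain v where v: "\<nu> = emb v" by blast
    have "emb (x - a0) = emb (v * (a1 - a0))" "emb (y - b0) = emb (v * (b1 - b0))" "emb (z - c0) = emb (v * (c1 - c0))"
      using e1 e2 e3 v by (simp_all add: emb_hom(4,5))
    then have "x - a0 = v * (a1 - a0)" "y - b0 = v * (b1 - b0)" "z - c0 = v * (c1 - c0)"
      by (simp_all only: emb_hom(6))
    then have "R = (a0 + v * (a1 - a0), b0 + v * (b1 - b0), c0 + v * (c1 - c0))"
      by (simp add: Rx algebra_simps)
    with R show "R \<in> {R\<in>S. \<exists>\<mu>. R = (a0 + \<mu> * (a1 - a0), b0 + \<mu> * (b1 - b0), c0 + \<mu> * (c1 - c0))}" by blast
  qed
  then have "card S \<le> card {R\<in>S. \<exists>\<mu>. R = (a0 + \<mu> * (a1 - a0), b0 + \<mu> * (b1 - b0), c0 + \<mu> * (c1 - c0))}"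
    using assms(4) by (intro card_mono) auto
  also have "\<dots> \<le> k"
  proof -
    have "(a1 - a0, b1 - b0, c1 - c0) \<noteq> (0, 0, 0)" using PQ(3) P Q by auto
    then show ?thesis using assms(2) unfolding collinear_bound_def by blast
  qed
  finally show ?thesis .
qed

text \<open>A red and a blue copy of the same \<open>S\<close> turn ordered solutions, including the
  diagonal, into crossings. The condition on \<open>fst P\<close> makes the red slopes nonzero; the
  blue ones are nonzero by the perturbation.\<close>

theorem symplectic_incidence_bound:
  fixes S :: "('f::field \<times> 'f \<times> 'f) set" and p k :: nat
  assumes ch: "\<And>n. 0 < n \<Longrightarrow> n < p \<Longrightarrow> of_nat n \<noteq> (0::'f)"
    and S: "finite S" "\<And>P. P \<in> S \<Longrightarrow> fst P \<noteq> 0" "card S \<le> p^2"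
    and col: "collinear_bound k S" "k \<ge> 1"
  shows "real (card {(P, Q). P \<in> S \<and> Q \<in> S \<and>
      snd (snd P) - snd (snd Q) = fst Q * fst (snd P) - fst P * fst (snd Q)})
    \<le> 10000 * (card S * sqrt (card S) + k * card S)"
proof -
  let ?R = "redl ` S" and ?B = "bluel ` S"
  have cR: "card ?R = card S" by (rule card_image) (rule inj_on_subset[OF red_inj(2) subset_UNIV])
  have cB: "card ?B = card S" by (rule card_image) (rule inj_on_subset[OF blue_inj subset_UNIV])
  have bl: "real (\<Sum>l\<in>?R. card {l'\<in>?B. meets l l'}) \<le>
    8640 * card ?B * sqrt (card ?R) + 4 * card ?R * sqrt (card ?R) + (2 * k + 3) * card ?R"
  proof (rule line_incidence_bound[where p = p])
    show "infinite (UNIV :: 'f poly fract set)" by (rule infinite_poly_fract)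
    show "of_nat n \<noteq> (0 :: 'f poly fract)" if "0 < n" "n < p" for n
      using ch[OF that] emb_of_nat[of n, where 'a = 'f] emb_hom(7) by metis
    show "finite ?B" "finite ?R" using S by simp_all
    show "fst l \<noteq> 0" if l: "l \<in> ?B" for l
    proof
      assume "fst l = 0"
      obtain a b c where "l = bluel (a, b, c)" using l by auto
      then have "tr^2 + emb a = 0" using \<open>fst l = 0\<close> by (simp add: bluel_def)
      then have "emb a + emb 0 * tr + emb 1 * tr^2 + emb 0 * tr^3 = 0" by (simp add: emb_hom algebra_simps)
      then show False unfolding tr_indep by simp
    qed
    show "\<not> meets l l'" if "l \<in> ?B" "l' \<in> ?B" "l \<noteq> l'" for l l' using that blue_not_meets by blast
    show "\<not> meets l l'" if "l \<in> ?R" "l' \<in> ?R" "l \<noteq> l'" for l l' using that red_not_meets by blast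
    show "card T \<le> k" if T: "T \<subseteq> ?B" "on_common_line T" for T
    proof -
      obtain S' where S': "S' \<subseteq> S" "T = bluel ` S'" using T(1) subset_imageE by blast
      have fS': "finite S'" using S' S(1) finite_subset by blast
      have "collinear_bound k S'" unfolding collinear_bound_def
      proof (intro allI impI)
        fix a b c a' b' c' :: 'f assume n: "(a', b', c') \<noteq> (0, 0, 0)"
        have "card {P\<in>S'. \<exists>\<mu>. P = (a + \<mu> * a', b + \<mu> * b', c + \<mu> * c')} \<le> card {P\<in>S. \<exists>\<mu>. P = (a + \<mu> * a', b + \<mu> * b', c + \<mu> * c')}"
          using S'(1) S(1) by (intro card_mono) auto
        also have "\<dots> \<le> k" using col(1) n unfolding collinear_bound_def by blast
        finally show "card {P\<in>S'. \<exists>\<mu>. P = (a + \<mu> * a', b + \<mu> * b', c + \<mu> * c')} \<le> k" .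
      qed
      then have "card S' \<le> k" using blue_collinear T(2) S'(2) col(2) fS' by blast
      then show ?thesis using S'(2) fS' card_image_le le_trans by blast
    qed
    show "fst l \<noteq> 0" if "l \<in> ?R" for l using that S(2) by (auto simp: redl_def emb_hom(7))
    show "fst l \<noteq> fst l'" if l: "l \<in> ?R" "l' \<in> ?B" for l l'
    proof
      assume e: "fst l = fst l'"
      obtain a b c where l1: "l = redl (a, b, c)" using l by auto
      obtain a' b' c' where l2: "l' = bluel (a', b', c')" using l by auto
      have "emb a = (tr^2 + emb a') / tr^3" using e by (simp add: l1 l2 redl_def bluel_def)
      then have "emb a * tr^3 = tr^2 + emb a'" by (simp add: field_simps)
      then have "emb a' + emb 0 * tr + emb 1 * tr^2 + emb (- a) * tr^3 = 0"
        using emb_hom(4)[of 0 a] by (simp add: emb_hom algebra_simps)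
      then show False unfolding tr_indep by simp
    qed
    show "inj_on (\<lambda>(t, u, g). (t, g)) ?R" using red_inj(1) by (rule inj_on_subset) auto
    show "card ?R \<le> p^2" using cR S(3) by simp
  qed
  let ?I = "{(P, Q). P \<in> S \<and> Q \<in> S \<and> snd (snd P) - snd (snd Q) = fst Q * fst (snd P) - fst P * fst (snd Q)}"
  have "(\<Sum>l\<in>?R. card {l'\<in>?B. meets l l'}) = (\<Sum>P\<in>S. card {l'\<in>?B. meets (redl P) l'})"
    by (subst sum.reindex[OF inj_on_subset[OF red_inj(2) subset_UNIV]]) simp
  also have "\<dots> = (\<Sum>P\<in>S. card {Q\<in>S. snd (snd P) - snd (snd Q) = fst Q * fst (snd P) - fst P * fst (snd Q)})"
  proof (rule sum.cong[OF refl])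
    fix P
    have "{l'\<in>?B. meets (redl P) l'} = bluel ` {Q\<in>S. meets (redl P) (bluel Q)}" by auto
    also have "card \<dots> = card {Q\<in>S. meets (redl P) (bluel Q)}"
      by (rule card_image) (rule inj_on_subset[OF blue_inj subset_UNIV])
    also have "{Q\<in>S. meets (redl P) (bluel Q)} = {Q\<in>S. snd (snd P) - snd (snd Q) = fst Q * fst (snd P) - fst P * fst (snd Q)}"
    proof -
      have "meets (redl P) (bluel Q) \<longleftrightarrow> snd (snd P) - snd (snd Q) = fst Q * fst (snd P) - fst P * fst (snd Q)" for Q
        using red_meets_blue[of "fst P" "fst (snd P)" "snd (snd P)" "fst Q" "fst (snd Q)" "snd (snd Q)"] by simp
      then show ?thesis by simp
    qed
    finally show "card {l'\<in>?B. meets (redl P) l'} = card {Q\<in>S. snd (snd P) - snd (snd Q) = fst Q * fst (snd P) - fst P * fst (snd Q)}" .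
  qed
  also have "\<dots> = card (SIGMA P:S. {Q\<in>S. snd (snd P) - snd (snd Q) = fst Q * fst (snd P) - fst P * fst (snd Q)})"
    using S(1) by (subst card_SigmaI) auto
  also have "(SIGMA P:S. {Q\<in>S. snd (snd P) - snd (snd Q) = fst Q * fst (snd P) - fst P * fst (snd Q)}) = ?I" by auto
  finally have "real (card ?I) \<le> 8640 * card S * sqrt (card S) + 4 * card S * sqrt (card S) + (2 * k + 3) * card S"
    using bl unfolding cR cB by simp
  also have "\<dots> \<le> 10000 * (card S * sqrt (card S)) + 10000 * (k * card S)"
  proof -
    have "(2 * k + 3) * card S \<le> 5 * k * card S" using col(2) by (intro mult_le_mono1) simp
    then have "real ((2 * k + 3) * card S) \<le> real (5 * k * card S)" by (simp only: of_nat_le_iff)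
    then have a: "real ((2 * k + 3) * card S) \<le> 5 * (real k * real (card S))" by simp
    have "0 \<le> real (card S) * sqrt (card S)" "0 \<le> real k * real (card S)" by simp_all
    moreover have "8640 * card S * sqrt (card S) + 4 * card S * sqrt (card S) = 8644 * (real (card S) * sqrt (card S))"
      by simp
    moreover have "real (10000 * (k * card S)) = 10000 * (real k * real (card S))" by simp
    ultimately show ?thesis using a by linarith
  qed
  finally show ?thesis by (simp add: algebra_simps)
qed

subsection \<open>Growth of sums of squared differences\<close>

text \<open>Cauchy-Schwarz for the sizes of the fibres of \<open>f\<close>.\<close>

lemma card_sq_le_image_energy:
  assumes "finite W"
  shows "real (card W)^2 \<le> real (card (f ` W)) * real (card {(w, w'). w \<in> W \<and> w' \<in> W \<and> f w = f w'})"
proof -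
  let ?c = "\<lambda>v. card {w\<in>W. f w = v}"
  have fin: "finite (f ` W)" using assms by simp
  have 1: "card W = (\<Sum>v\<in>f ` W. ?c v)"
    using sum_fun_comp[OF assms fin subset_refl, of "\<lambda>_. 1::nat"] by simp
  have "{(w, w'). w \<in> W \<and> w' \<in> W \<and> f w = f w'} = (SIGMA w:W. {w'\<in>W. f w' = f w})" by auto
  then have "card {(w, w'). w \<in> W \<and> w' \<in> W \<and> f w = f w'} = (\<Sum>w\<in>W. ?c (f w))"
    using assms by (simp add: card_SigmaI)
  also have "\<dots> = (\<Sum>v\<in>f ` W. ?c v * ?c v)"
    using sum_fun_comp[OF assms fin subset_refl, of ?c] by simp
  finally have 2: "card {(w, w'). w \<in> W \<and> w' \<in> W \<and> f w = f w'} = (\<Sum>v\<in>f ` W. ?c v * ?c v)" .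
  have "(\<Sum>v\<in>f ` W. real (?c v))^2 \<le> (\<Sum>v\<in>f ` W. (real (?c v))^2) * card (f ` W)"
    by (rule sum_squared_le_sum_of_squares)
  then show ?thesis unfolding 1 2 by (simp add: power2_eq_square mult.commute)
qed

text \<open>In \<open>(x - y)^2 + z = (x' - y')^2 + z'\<close> only the products
  \<open>x * y\<close> and \<open>x' * y'\<close> couple variables. Exchanging \<open>y\<close> and
  \<open>y'\<close> makes the equation symplectic for the points \<open>\<phi> (x, y', z)\<close>
  and \<open>\<phi> (x', y, z')\<close>. Since \<open>card X \<le> card A ^ 2\<close>, the
  collinearity bound is at most the square root of the number of points, so the second term of the
  incidence bound is absorbed by the first.\<close>

lemma square_sums_growth:
  fixes A X :: "'f::field set" and p :: nat
  assumes ch: "\<And>n. 0 < n \<Longrightarrow> n < p \<Longrightarrow> of_nat n \<noteq> (0::'f)" and p: "2 < p"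
    and fin: "finite A" "finite X" and ne: "A \<noteq> {}" "X \<noteq> {}" "0 \<notin> A"
    and small: "card X \<le> card A ^ 2" "card A ^ 2 * card X \<le> p^2"
  shows "real (card A) * sqrt (card X) / 20000 \<le> real (card {(x - y)^2 + z |x y z. x \<in> A \<and> y \<in> A \<and> z \<in> X})"
proof -
  have two: "(2::'f) \<noteq> 0" using ch[of 2] p by simp
  define W where "W = A \<times> A \<times> X"
  define f where "f = (\<lambda>(x, y, z). (x - y)^2 + z :: 'f)"
  define \<phi> where "\<phi> = (\<lambda>(x, y, z). (2 * y, x, x^2 + z - y^2) :: 'f \<times> 'f \<times> 'f)"
  have finW: "finite W" using fin by (simp add: W_def)
  have inj: "inj \<phi>" using two by (auto simp: inj_def \<phi>_def)
  define S where "S = \<phi> ` W"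
  define a x where "a = card A" and "x = card X"
  have ax: "a \<ge> 1" "x \<ge> 1" using fin ne by (simp_all add: a_def x_def Suc_le_eq card_gt_0_iff)
  have cW: "card W = a^2 * x" by (simp add: W_def a_def x_def card_cartesian_product power2_eq_square)
  have cS: "card S = card W" unfolding S_def by (rule card_image) (rule inj_on_subset[OF inj subset_UNIV])
  have finS: "finite S" using finW by (simp add: S_def)
  have inA: "fst P / 2 \<in> A" and inX: "snd (snd P) - (fst (snd P))^2 + (fst P / 2)^2 \<in> X" if PS: "P \<in> S" for P
  proof -
    obtain x1 y1 z1 where P: "P = \<phi> (x1, y1, z1)" "y1 \<in> A" "z1 \<in> X" using PS by (auto simp: S_def W_def)
    then have "fst P / 2 = y1" "snd (snd P) - (fst (snd P))^2 + (fst P / 2)^2 = z1" using two by (simp_all add: \<phi>_def)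
    then show "fst P / 2 \<in> A" "snd (snd P) - (fst (snd P))^2 + (fst P / 2)^2 \<in> X" using P(2,3) by metis+
  qed
  have col: "collinear_bound (max a x) S" unfolding collinear_bound_def
  proof (intro allI impI)
    fix a0 b0 c0 a1 b1 c1 :: 'f assume n: "(a1, b1, c1) \<noteq> (0, 0, 0)"
    let ?T = "{P\<in>S. \<exists>\<mu>. P = (a0 + \<mu> * a1, b0 + \<mu> * b1, c0 + \<mu> * c1)}"
    consider "b1 \<noteq> 0" | "a1 \<noteq> 0" | "a1 = 0" "b1 = 0" "c1 \<noteq> 0" using n by auto
    then show "card ?T \<le> max a x"
    proof cases
      case 1
      have "card ?T \<le> card A"
      proof (rule card_inj_on_le[OF _ _ fin(1)])
        show "inj_on (\<lambda>P. fst (snd P)) ?T" using 1 by (auto simp: inj_on_def)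
        show "(\<lambda>P. fst (snd P)) ` ?T \<subseteq> A" by (auto simp: S_def \<phi>_def W_def)
      qed
      then show ?thesis by (simp add: a_def)
    next
      case 2
      have "card ?T \<le> card A"
      proof (rule card_inj_on_le[OF _ _ fin(1)])
        show "inj_on (\<lambda>P. fst P / 2) ?T" using 2 two by (auto simp: inj_on_def)
        show "(\<lambda>P. fst P / 2) ` ?T \<subseteq> A" using inA by auto
      qed
      then show ?thesis by (simp add: a_def)
    next
      case 3
      have "card ?T \<le> card X"
      proof (rule card_inj_on_le[OF _ _ fin(2)])
        show "inj_on (\<lambda>P. snd (snd P) - (fst (snd P))^2 + (fst P / 2)^2) ?T" using 3 by (auto simp: inj_on_def)
        show "(\<lambda>P. snd (snd P) - (fst (snd P))^2 + (fst P / 2)^2) ` ?T \<subseteq> X"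
          using inX by auto
      qed
      then show ?thesis by (simp add: x_def)
    qed
  qed
  have nz: "fst P \<noteq> 0" if PS: "P \<in> S" for P
  proof -
    obtain x1 y1 z1 where "P = \<phi> (x1, y1, z1)" "y1 \<in> A" using PS by (auto simp: S_def W_def)
    then show ?thesis using two ne(3) by (auto simp: \<phi>_def)
  qed
  let ?I = "{(P, Q). P \<in> S \<and> Q \<in> S \<and> snd (snd P) - snd (snd Q) = fst Q * fst (snd P) - fst P * fst (snd Q)}"
  let ?E = "{(w, w'). w \<in> W \<and> w' \<in> W \<and> f w = f w'}"
  have "card ?E \<le> card ?I"
  proof (rule card_inj_on_le)
    show "finite ?I" by (rule finite_subset[of _ "S \<times> S"]) (use finS in auto)
    let ?g = "\<lambda>(w, w'). (\<phi> (fst w, fst (snd w'), snd (snd w)), \<phi> (fst w', fst (snd w), snd (snd w')))"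
    show "inj_on ?g ?E"
    proof (rule inj_onI)
      fix e e' assume "e \<in> ?E" "e' \<in> ?E" and eq: "?g e = ?g e'"
      obtain x y z x' y' z' where e: "e = ((x, y, z), (x', y', z'))" by (metis prod_cases3 surj_pair)
      obtain x1 y1 z1 x1' y1' z1' where e': "e' = ((x1, y1, z1), (x1', y1', z1'))" by (metis prod_cases3 surj_pair)
      have "\<phi> (x, y', z) = \<phi> (x1, y1', z1)" "\<phi> (x', y, z') = \<phi> (x1', y1, z1')" using eq by (simp_all add: e e')
      then have "(x, y', z) = (x1, y1', z1)" "(x', y, z') = (x1', y1, z1')" using inj by (meson injD)+
      then show "e = e'" by (simp add: e e')
    qed
    show "?g ` ?E \<subseteq> ?I"
    proof
      fix q assume "q \<in> ?g ` ?E"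
      then obtain e where e0: "e \<in> ?E" "q = ?g e" by blast
      obtain x y z x' y' z' where e: "e = ((x, y, z), (x', y', z'))" by (metis prod_cases3 surj_pair)
      have m: "x \<in> A" "y \<in> A" "z \<in> X" "x' \<in> A" "y' \<in> A" "z' \<in> X" and eq: "(x - y)^2 + z = (x' - y')^2 + z'"
        using e0 by (auto simp: e W_def f_def)
      have q: "q = (\<phi> (x, y', z), \<phi> (x', y, z'))" using e0 by (simp add: e)
      have "\<phi> (x, y', z) \<in> S" "\<phi> (x', y, z') \<in> S" using m by (auto simp: S_def W_def)
      moreover have "(x^2 + z - y'^2) - (x'^2 + z' - y^2) = (2 * y) * x - (2 * y') * x'"
        using eq by (simp add: power2_eq_square algebra_simps)
      ultimately show "q \<in> ?I" unfolding q by (simp add: \<phi>_def)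
    qed
  qed
  then have "real (card ?E) \<le> real (card ?I)" by simp
  also have "\<dots> \<le> 10000 * (card S * sqrt (card S) + max a x * card S)"
    by (rule symplectic_incidence_bound[where p = p])
      (use ch finS nz small col ax cS cW in \<open>auto simp: a_def x_def\<close>)
  also have "\<dots> \<le> 10000 * (2 * (card S * sqrt (card S)))"
  proof -
    have "real (max a x) \<le> sqrt (card S)"
    proof (rule real_le_rsqrt)
      have "a^2 \<le> a^2 * x" using ax by simp
      moreover have "x^2 \<le> a^2 * x" using small(1) by (simp add: power2_eq_square a_def x_def mult_le_mono1)
      ultimately have "(max a x)^2 \<le> a^2 * x" by (simp add: max_def)
      then have "real ((max a x)^2) \<le> real (a^2 * x)" by (simp only: of_nat_le_iff)
      then show "(real (max a x))^2 \<le> real (card S)" by (simp only: cS cW of_nat_power)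
    qed
    then have "real (max a x) * real (card S) \<le> sqrt (card S) * real (card S)" by (intro mult_right_mono) auto
    then show ?thesis by (simp add: algebra_simps)
  qed
  finally have E: "real (card ?E) \<le> 20000 * (real (card W) * sqrt (card W))" by (simp add: cS)
  have fW: "f ` W = {(x - y)^2 + z |x y z. x \<in> A \<and> y \<in> A \<and> z \<in> X}" by (force simp: f_def W_def)
  define n where "n = real (card W)"
  have n: "n > 0" using ax cW by (simp add: n_def)
  have "n^2 \<le> real (card (f ` W)) * real (card ?E)" unfolding n_def by (rule card_sq_le_image_energy[OF finW])
  also have "\<dots> \<le> real (card (f ` W)) * (20000 * (n * sqrt n))" using E by (intro mult_left_mono) (auto simp: n_def)
  finally have "n * n \<le> n * (real (card (f ` W)) * 20000 * sqrt n)" by (simp add: power2_eq_square ac_simps)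
  then have "n \<le> real (card (f ` W)) * 20000 * sqrt n" using n by simp
  then have "sqrt n * sqrt n \<le> (real (card (f ` W)) * 20000) * sqrt n" using n by simp
  then have "sqrt n \<le> real (card (f ` W)) * 20000" using n by (simp only: mult_le_cancel_right) auto
  moreover have "sqrt n = real a * sqrt x" by (simp add: n_def cW real_sqrt_mult)
  ultimately show ?thesis unfolding fW[symmetric] a_def x_def by simp
qed

section \<open>Iterated sums of squared differences\<close>

fun sq_sums :: "nat \<Rightarrow> 'f::comm_ring_1 set \<Rightarrow> 'f set" where
  "sq_sums 0 A = {0}"
| "sq_sums (Suc k) A = {(x - y)^2 + z |x y z. x \<in> A \<and> y \<in> A \<and> z \<in> sq_sums k A}"

lemma finite_sq_sums: "finite A \<Longrightarrow> finite (sq_sums k A)"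
proof (induction k)
  case (Suc k)
  have "sq_sums (Suc k) A = (\<lambda>(x, y, z). (x - y)^2 + z) ` (A \<times> A \<times> sq_sums k A)" by force
  then show ?case using Suc by simp
qed simp

lemma sq_sums_add: "v \<in> sq_sums j A \<Longrightarrow> w \<in> sq_sums k A \<Longrightarrow> v + w \<in> sq_sums (j + k) A"
proof (induction j arbitrary: v)
  case (Suc j)
  then obtain x y z where v: "v = (x - y)^2 + z" "x \<in> A" "y \<in> A" "z \<in> sq_sums j A" by auto
  from Suc.IH[OF v(4) Suc.prems(2)] v show ?case by (auto simp: add.assoc)
qed simp

lemma card_sq_sums_1:
  fixes A :: "'f::field set"
  assumes "finite A"
  shows "card A \<le> 2 * card (sq_sums (Suc 0) A)"
proof (cases "A = {}")
  case False
  then obtain y where y: "y \<in> A" by blast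
  let ?f = "\<lambda>x. (x - y)^2"
  have sub: "?f ` A \<subseteq> sq_sums (Suc 0) A" using y by auto
  have "card A = (\<Sum>v\<in>?f ` A. card {x\<in>A. ?f x = v})"
    using sum_fun_comp[OF assms finite_imageI[OF assms] subset_refl, of "\<lambda>_. 1::nat" ?f] by simp
  also have "\<dots> \<le> (\<Sum>v\<in>?f ` A. 2)"
  proof (rule sum_mono)
    fix v assume "v \<in> ?f ` A"
    then obtain x0 where v: "v = (x0 - y)^2" by blast
    have "{x\<in>A. ?f x = v} \<subseteq> {x0, 2 * y - x0}"
    proof
      fix x assume "x \<in> {x\<in>A. ?f x = v}"
      then have "(x - y)^2 = (x0 - y)^2" by (simp add: v)
      then have "x - y = x0 - y \<or> x - y = - (x0 - y)" by (simp add: power2_eq_iff)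
      then show "x \<in> {x0, 2 * y - x0}" by (auto simp: algebra_simps eq_diff_eq)
    qed
    then have "card {x\<in>A. ?f x = v} \<le> card {x0, 2 * y - x0}" by (intro card_mono) auto
    also have "\<dots> \<le> 2" by (simp add: card_insert_if)
    finally show "card {x\<in>A. ?f x = v} \<le> 2" .
  qed
  also have "\<dots> = 2 * card (?f ` A)" by simp
  also have "\<dots> \<le> 2 * card (sq_sums (Suc 0) A)"
    using sub finite_sq_sums[OF assms, of "Suc 0"] by (intro mult_le_mono2 card_mono) auto
  finally show ?thesis .
qed simp

text \<open>
  The recursion \<open>x \<mapsto> a sqrt x / 20000\<close> of \<open>square_sums_growth\<close> has the fixed factor \<open>20000 powr (-2)\<close>.
\<close>

definition grow_const :: real where "grow_const = 1 / (4 * 10^8)"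

lemma card_sq_sums:
  fixes A :: "'f::field set" and p :: nat
  assumes ch: "\<And>n. 0 < n \<Longrightarrow> n < p \<Longrightarrow> of_nat n \<noteq> (0::'f)" and p: "2 < p"
    and A: "finite A" "A \<noteq> {}" "0 \<notin> A" "card A ^ 2 \<le> p"
  shows "grow_const * real (card A) powr (2 - 1 / 2^k) \<le> real (card (sq_sums (Suc k) A))"
proof (induction k)
  case 0
  have "real (card A) \<le> 2 * real (card (sq_sums (Suc 0) A))"
    using card_sq_sums_1[OF A(1)] by (metis of_nat_le_iff of_nat_mult of_nat_numeral)
  moreover have "real (card A) powr (2 - 1 / 2^0) = real (card A)" by simp
  moreover have "grow_const * real (card A) \<le> 1 / 2 * real (card A)"
    by (intro mult_right_mono) (auto simp: grow_const_def)
  ultimately show ?case by simp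
next
  case (Suc k)
  define a where "a = real (card A)"
  have a1: "a \<ge> 1" using A by (simp add: a_def Suc_le_eq card_gt_0_iff)
  define e :: real where "e = 2 - 1 / 2^k"
  have e: "0 \<le> e" "e \<le> 2" "1 + e / 2 = 2 - 1 / 2^(Suc k)"
  proof -
    have "1 / 2^k \<le> (1::real)" by (simp add: divide_le_eq)
    moreover have "0 \<le> 1 / (2::real)^k" by simp
    ultimately show "0 \<le> e" "e \<le> 2" unfolding e_def by linarith+
    show "1 + e / 2 = 2 - 1 / 2^(Suc k)" by (simp add: e_def)
  qed
  \<comment> \<open>The induction continues with a subset of exactly the guaranteed size, because
    \<open>square_sums_growth\<close> also needs upper bounds on the size of
    \<open>X\<close>.\<close>
  define N where "N = nat \<lceil>grow_const * a powr e\<rceil>"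
  have gpos: "grow_const > 0" "grow_const \<le> 1" by (simp_all add: grow_const_def)
  have pos: "grow_const * a powr e > 0" using gpos a1 by simp
  have Nge: "grow_const * a powr e \<le> real N" using pos by (simp add: N_def)
  have N1: "N \<ge> 1" using pos by (simp add: N_def Suc_le_eq)
  have "N \<le> card (sq_sums (Suc k) A)" using Suc.IH unfolding N_def a_def e_def by linarith
  then obtain X where X: "X \<subseteq> sq_sums (Suc k) A" "card X = N" "finite X"
    using obtain_subset_with_card_n by blast
  have Xne: "X \<noteq> {}" using X N1 by auto
  have "N \<le> card A ^ 2"
  proof -
    have "grow_const * a powr e \<le> 1 * a powr 2" using gpos a1 e by (intro mult_mono powr_mono) auto
    also have "\<dots> = real (card A ^ 2)" using a1 by (simp add: a_def powr_numeral)
    finally show ?thesis unfolding N_def by linarith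
  qed
  moreover from this have "card A ^ 2 * N \<le> p^2"
    unfolding power2_eq_square[of p] using A(4) by (meson le_trans mult_le_mono)
  ultimately have "real (card A) * sqrt (card X) / 20000 \<le> real (card {(x - y)^2 + z |x y z. x \<in> A \<and> y \<in> A \<and> z \<in> X})"
    using X A Xne by (intro square_sums_growth[OF ch p]) auto
  also have "\<dots> \<le> real (card (sq_sums (Suc (Suc k)) A))"
  proof -
    have "{(x - y)^2 + z |x y z. x \<in> A \<and> y \<in> A \<and> z \<in> X} \<subseteq> sq_sums (Suc (Suc k)) A" using X(1) by fastforce
    then show ?thesis using finite_sq_sums[OF A(1)] card_mono of_nat_le_iff by blast
  qed
  finally have 1: "a * sqrt N / 20000 \<le> real (card (sq_sums (Suc (Suc k)) A))" by (simp add: a_def X)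
  have "sqrt (grow_const * a powr e) \<le> sqrt N" using Nge by simp
  moreover have "sqrt (grow_const * a powr e) = (1 / 20000) * a powr (e / 2)"
  proof -
    have "sqrt grow_const = 1 / 20000"
      by (rule real_sqrt_unique) (simp_all add: grow_const_def power2_eq_square)
    moreover have "sqrt (a powr e) = a powr (e / 2)"
      by (rule real_sqrt_unique) (simp_all add: power2_eq_square flip: powr_add)
    ultimately show ?thesis by (simp add: real_sqrt_mult)
  qed
  ultimately have "a * ((1 / 20000) * a powr (e / 2)) / 20000 \<le> a * sqrt N / 20000"
    using a1 by (intro divide_right_mono mult_left_mono) auto
  moreover have "a * ((1 / 20000) * a powr (e / 2)) / 20000 = grow_const * a powr (1 + e / 2)"
    using a1 by (simp add: powr_add grow_const_def)
  ultimately show ?case using 1 e(3) by (simp add: a_def)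
qed

subsection \<open>Rich lines of a Cartesian product\<close>

text \<open>The richness of the line \<open>v = m * u + c\<close> in the grid
  \<open>X \<times> X\<close>.\<close>

definition inc :: "'f::field set \<Rightarrow> 'f \<Rightarrow> 'f \<Rightarrow> nat" where
  "inc X m c = card {u\<in>X. m * u + c \<in> X}"

text \<open>Two distinct lines of the pencil agree only where \<open>a * u + b = 0\<close>, which is
  at most one abscissa. Away from it their points are disjoint, and each line keeps at least
  \<open>k - 1\<close> of them.\<close>

lemma pencil_bound:
  fixes X :: "'f::field set" and L :: "('f \<times> 'f) set"
  assumes fin: "finite X" "finite L" and k: "k \<ge> 2"
    and rich: "\<And>m c. (m, c) \<in> L \<Longrightarrow> k \<le> inc X m c"
    and pencil: "\<And>m c. (m, c) \<in> L \<Longrightarrow> \<exists>\<mu>. m = m0 + \<mu> * a \<and> c = c0 + \<mu> * b" and ab: "(a, b) \<noteq> (0, 0)"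
  shows "card L * k \<le> 2 * card X ^ 2"
proof -
  define G where "G l = {u\<in>X. fst l * u + snd l \<in> X \<and> a * u + b \<noteq> 0}" for l
  have G: "k - 1 \<le> card (G l)" if l: "l \<in> L" for l
  proof -
    have "{u\<in>X. fst l * u + snd l \<in> X} \<subseteq> G l \<union> {u\<in>X. a * u + b = 0}" by (auto simp: G_def)
    then have "card {u\<in>X. fst l * u + snd l \<in> X} \<le> card (G l \<union> {u\<in>X. a * u + b = 0})"
      using fin by (intro card_mono) (auto simp: G_def)
    also have "\<dots> \<le> card (G l) + card {u\<in>X. a * u + b = 0}" by (rule card_Un_le)
    also have "card {u\<in>X. a * u + b = 0} \<le> 1"
    proof -
      have "u = u'" if "a * u + b = 0" "a * u' + b = 0" for u u'
      proof -
        have "a \<noteq> 0" using that ab by auto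
        moreover have "a * u = a * u'" using that by (metis add_right_cancel)
        ultimately show ?thesis by simp
      qed
      then show ?thesis using card_le_Suc0_iff_eq[of "{u\<in>X. a * u + b = 0}"] fin(1) by auto
    qed
    finally have "card {u\<in>X. fst l * u + snd l \<in> X} \<le> card (G l) + 1" by simp
    moreover have "k \<le> card {u\<in>X. fst l * u + snd l \<in> X}" using rich[of "fst l" "snd l"] l by (simp add: inc_def)
    ultimately show ?thesis by linarith
  qed
  have "card L * (k - 1) = (\<Sum>l\<in>L. k - 1)" by simp
  also have "\<dots> \<le> (\<Sum>l\<in>L. card (G l))" using G by (intro sum_mono)
  also have "\<dots> = card (SIGMA l:L. G l)" using fin by (simp add: G_def)
  also have "\<dots> \<le> card (X \<times> X)"
  proof (rule card_inj_on_le)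
    show "finite (X \<times> X)" using fin by simp
    let ?g = "\<lambda>(l, u). (u, fst l * u + snd l)"
    show "?g ` (SIGMA l:L. G l) \<subseteq> X \<times> X" by (auto simp: G_def)
    show "inj_on ?g (SIGMA l:L. G l)"
    proof (rule inj_onI)
      fix q q' assume q: "q \<in> (SIGMA l:L. G l)" "q' \<in> (SIGMA l:L. G l)" and e: "?g q = ?g q'"
      obtain m c u where qq: "q = ((m, c), u)" by (metis surj_pair)
      obtain m' c' u' where qq': "q' = ((m', c'), u')" by (metis surj_pair)
      have u: "u' = u" "m * u + c = m' * u + c'" using e by (auto simp: qq qq')
      have mem: "(m, c) \<in> L" "(m', c') \<in> L" "a * u + b \<noteq> 0" using q by (auto simp: qq qq' G_def)
      obtain \<mu> where m: "m = m0 + \<mu> * a" "c = c0 + \<mu> * b" using pencil[OF mem(1)] by blast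
      obtain \<mu>' where m': "m' = m0 + \<mu>' * a" "c' = c0 + \<mu>' * b" using pencil[OF mem(2)] by blast
      have "(\<mu> - \<mu>') * (a * u + b) = 0" using u(2) unfolding m m' by (simp add: algebra_simps)
      then have "\<mu> = \<mu>'" using mem(3) by simp
      then show "q = q'" using qq qq' u m m' by simp
    qed
  qed
  also have "\<dots> = card X ^ 2" by (simp add: power2_eq_square card_cartesian_product)
  finally have "card L * (k - 1) \<le> card X ^ 2" .
  moreover have "card L * k \<le> 2 * (card L * (k - 1))"
  proof -
    have "k \<le> 2 * (k - 1)" using k by simp
    then have "card L * k \<le> card L * (2 * (k - 1))" by (rule mult_le_mono2)
    then show ?thesis by simp
  qed
  ultimately show ?thesis by linarith
qed

text \<open>Pairs of incidences with equal ordinate \<open>m * u + c = m' * u' + c'\<close> are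
  counted twice: from below by Cauchy-Schwarz, and from above, after exchanging \<open>u\<close> and
  \<open>u'\<close>, by the symplectic bound for the triples \<open>(m, u, c)\<close>. A line of
  triples with constant \<open>u\<close> is a pencil.\<close>

lemma rich_lines_bound:
  fixes X :: "'f::{field,finite} set" and p k :: nat
  assumes ch: "\<And>n. 0 < n \<Longrightarrow> n < p \<Longrightarrow> of_nat n \<noteq> (0::'f)" and p: "2 < p"
    and x: "card X \<le> p" "40000 * card X ^ 3 \<le> k^2 * p" and k: "k \<ge> 2"
  shows "real (card {(m, c). m \<noteq> 0 \<and> k \<le> inc X m c}) * real k ^ 4 \<le> 5 * 10^8 * real (card X) ^ 5"
proof (rule ccontr)
  define LK where "LK = {(m, c). m \<noteq> 0 \<and> k \<le> inc X m c}"
  define x where "x = card X"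
  define C where "C = (5 * 10^8 :: nat)"
  assume "\<not> ?thesis"
  then have "real (C * x^5) < real (card LK * k^4)" by (simp add: LK_def x_def C_def not_le)
  then have gt: "C * x^5 < card LK * k^4" by (simp only: of_nat_less_iff)
  \<comment> \<open>Just enough rich lines for a contradiction; the upper bound \<open>Mup\<close>
    is needed for \<open>x * M \<le> p^2\<close>.\<close>
  define M where "M = C * x^5 div k^4 + 1"
  have "M \<le> card LK" using less_mult_imp_div_less[OF gt] by (simp add: M_def)
  then obtain L where L: "L \<subseteq> LK" "card L = M" "finite L" using obtain_subset_with_card_n by metis
  have k4: "k^4 > 0" using k by simp
  have Mlow: "C * x^5 < M * k^4"
    unfolding M_def using dividend_less_div_times[OF k4, of "C * x^5"] by (simp add: mult.commute)
  have Mup: "M * k^4 \<le> C * x^5 + k^4"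
    unfolding M_def using div_times_less_eq_dividend[of "C * x^5" "k^4"] by (simp add: add_mult_distrib)
  have finX: "finite X" by simp
  have M1: "M \<ge> 1" by (simp add: M_def)
  have rich: "k \<le> inc X m c" "m \<noteq> 0" if "(m, c) \<in> L" for m c using that L(1) by (auto simp: LK_def)
  have incx: "inc X m c \<le> x" for m c unfolding inc_def x_def by (rule card_mono) auto
  have kx: "k \<le> x"
  proof -
    have "L \<noteq> {}" using M1 L(2) by auto
    then obtain m c where "(m, c) \<in> L" by (metis ex_in_conv surj_pair)
    then show ?thesis using rich(1) incx le_trans by blast
  qed
  have x2: "x \<ge> 2" using kx k by simp
  \<comment> \<open>The hypothesis \<open>40000 * x^3 \<le> k^2 * p\<close> is squared. The factor
    16 is chosen because \<open>16 * C = 5 * 40000^2\<close>; the remaining share 11 covers the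
    rounding in \<open>M\<close>.\<close>
  have xM: "x * M \<le> p^2"
  proof -
    have "(40000 * x^3)^2 \<le> (k^2 * p)^2" using x(2) unfolding x_def by (rule power_mono) simp
    then have a: "1600000000 * x^6 \<le> k^4 * p^2"
      by (simp add: power_mult_distrib flip: power_mult)
    have "16 * (x * M * k^4) \<le> 16 * (x * (C * x^5 + k^4))" using Mup by (simp add: mult.assoc)
    also have "\<dots> = 5 * (1600000000 * x^6) + 16 * x * k^4"
    proof -
      have "x^6 = x * x^5" by (simp add: eval_nat_numeral)
      then show ?thesis by (simp add: C_def algebra_simps)
    qed
    also have "\<dots> \<le> 5 * (k^4 * p^2) + 11 * p^2 * k^4"
    proof (intro add_mono mult_le_mono2 a mult_le_mono1)
      have "16 * x \<le> 16 * p" using x(1) by (simp add: x_def)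
      also have "16 * p \<le> 11 * p * p" by (rule mult_le_mono1) (use p in simp)
      finally have "16 * x \<le> 11 * p * p" .
      then show "16 * x \<le> 11 * p^2" by (simp add: power2_eq_square)
    qed
    also have "\<dots> = 16 * (p^2 * k^4)" by simp
    finally have "x * M * k^4 \<le> p^2 * k^4" by simp
    then show ?thesis using k4 by simp
  qed
  define S where "S = (\<lambda>((m, c), u). (m, u, c)) ` (L \<times> X)"
  have injS: "inj (\<lambda>((m, c), u). (m, u, c))" by (auto simp: inj_def)
  have cS: "card S = x * M"
    unfolding S_def by (subst card_image[OF inj_on_subset[OF injS subset_UNIV]])
      (simp add: card_cartesian_product L x_def)
  have finS: "finite S" using L(3) by (simp add: S_def)
  define j where "j = nat \<lfloor>2 * real x ^ 2 / real k\<rfloor>"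
  have jle: "real j \<le> 2 * real x^2 / real k" by (simp add: j_def)
  have xj: "x \<le> j"
  proof -
    have "real x * real k \<le> real x * (2 * real x)" using kx by (intro mult_left_mono) auto
    then have "real x \<le> 2 * real x^2 / real k" using k by (simp add: field_simps power2_eq_square)
    then show ?thesis unfolding j_def by linarith
  qed
  have col: "collinear_bound j S" unfolding collinear_bound_def
  proof (intro allI impI)
    fix a0 b0 c0 a1 b1 c1 :: 'f assume n: "(a1, b1, c1) \<noteq> (0, 0, 0)"
    let ?T = "{P\<in>S. \<exists>\<mu>. P = (a0 + \<mu> * a1, b0 + \<mu> * b1, c0 + \<mu> * c1)}"
    show "card ?T \<le> j"
    proof (cases "b1 = 0")
      case False
      have "card ?T \<le> card X"
      proof (rule card_inj_on_le[OF _ _ finX])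
        show "inj_on (\<lambda>P. fst (snd P)) ?T" using False by (auto simp: inj_on_def)
        show "(\<lambda>P. fst (snd P)) ` ?T \<subseteq> X" by (auto simp: S_def)
      qed
      then show ?thesis using xj by (simp add: x_def)
    next
      case True
      define L' where "L' = (\<lambda>P. (fst P, snd (snd P))) ` ?T"
      have "inj_on (\<lambda>P. (fst P, snd (snd P))) ?T" using True by (auto simp: inj_on_def)
      then have cT: "card ?T = card L'" by (simp add: L'_def card_image)
      have L'L: "L' \<subseteq> L" by (auto simp: L'_def S_def)
      have "card L' * k \<le> 2 * card X ^ 2"
      proof (rule pencil_bound)
        show "finite X" "finite L'" "k \<ge> 2" using finX L'L L(3) k finite_subset by auto
        show "k \<le> inc X m c" if "(m, c) \<in> L'" for m c using that L'L rich by blast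
        show "\<exists>\<mu>. m = a0 + \<mu> * a1 \<and> c = c0 + \<mu> * c1" if "(m, c) \<in> L'" for m c
          using that by (auto simp: L'_def)
        show "(a1, c1) \<noteq> (0, 0)" using n True by auto
      qed
      then have "real (card L' * k) \<le> real (2 * card X ^ 2)" by (simp only: of_nat_le_iff)
      then have "real (card L') \<le> 2 * real x^2 / real k" using k by (simp add: field_simps x_def)
      then show ?thesis unfolding cT j_def by linarith
    qed
  qed
  define W where "W = {(l, u). l \<in> L \<and> u \<in> X \<and> fst l * u + snd l \<in> X}"
  define f where "f = (\<lambda>(l, u). fst l * u + snd l :: 'f)"
  have finW: "finite W" by (rule finite_subset[of _ "L \<times> X"]) (use L in \<open>auto simp: W_def\<close>)
  have "W = (SIGMA l:L. {u\<in>X. fst l * u + snd l \<in> X})" by (auto simp: W_def)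
  then have "card W = (\<Sum>l\<in>L. inc X (fst l) (snd l))" using L(3) by (simp add: inc_def)
  also have "\<dots> \<ge> (\<Sum>l\<in>L. k)" by (intro sum_mono) (use rich in auto)
  finally have cW: "M * k \<le> card W" using L(2) by simp
  have cf: "card (f ` W) \<le> x" unfolding x_def by (rule card_mono) (auto simp: f_def W_def)
  let ?E = "{(w, w'). w \<in> W \<and> w' \<in> W \<and> f w = f w'}"
  let ?I = "{(P, Q). P \<in> S \<and> Q \<in> S \<and> snd (snd P) - snd (snd Q) = fst Q * fst (snd P) - fst P * fst (snd Q)}"
  have "card ?E \<le> card ?I"
  proof (rule card_inj_on_le)
    show "finite ?I" by (rule finite_subset[of _ "S \<times> S"]) (use finS in auto)
    let ?g = "\<lambda>(w, w'). ((fst (fst w), snd w', snd (fst w)), (fst (fst w'), snd w, snd (fst w')))"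
    show "inj_on ?g ?E" by (rule inj_onI) (auto simp: prod_eq_iff)
    show "?g ` ?E \<subseteq> ?I"
    proof
      fix q assume "q \<in> ?g ` ?E"
      then obtain e where e0: "e \<in> ?E" "q = ?g e" by blast
      obtain m c u m' c' u' where e: "e = (((m, c), u), ((m', c'), u'))" by (metis surj_pair)
      have mem: "(m, c) \<in> L" "u \<in> X" "(m', c') \<in> L" "u' \<in> X" and eq: "m * u + c = m' * u' + c'"
        using e0 by (auto simp: e W_def f_def)
      have q: "q = ((m, u', c), (m', u, c'))" using e0 by (simp add: e)
      have "(m, u', c) \<in> S" "(m', u, c') \<in> S" using mem unfolding S_def by force+
      moreover have "c - c' = m' * u' - m * u" using eq by (simp add: algebra_simps)
      ultimately show "q \<in> ?I" unfolding q by simp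
    qed
  qed
  then have "real (card ?E) \<le> real (card ?I)" by simp
  also have "\<dots> \<le> 10000 * (card S * sqrt (card S) + j * card S)"
  proof (rule symplectic_incidence_bound[where p = p])
    show "fst P \<noteq> 0" if "P \<in> S" for P using that rich(2) by (auto simp: S_def)
    show "j \<ge> 1" using xj x2 by simp
    show "card S \<le> p^2" using xM cS by simp
  qed (use ch finS col in auto)
  finally have E: "real (card ?E) \<le> 10000 * (real (x * M) * sqrt (x * M) + real j * real (x * M))" by (simp add: cS)
  define xr Mr K where "xr = real x" and "Mr = real M" and "K = real k"
  have pos: "xr > 0" "Mr > 0" "K > 0" "K \<le> xr" using x2 M1 k kx by (simp_all add: xr_def Mr_def K_def)
  have "(Mr * K)^2 \<le> real (card W)^2"
    using cW unfolding Mr_def K_def by (intro power_mono) (simp_all flip: of_nat_mult)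
  also have "\<dots> \<le> real (card (f ` W)) * real (card ?E)" by (rule card_sq_le_image_energy[OF finW])
  also have "\<dots> \<le> xr * real (card ?E)" using cf by (intro mult_right_mono) (auto simp: xr_def)
  also have "\<dots> \<le> xr * (10000 * (xr * Mr * sqrt (xr * Mr) + real j * (xr * Mr)))"
    using E pos by (intro mult_left_mono) (auto simp: xr_def Mr_def)
  also have "\<dots> \<le> xr * (10000 * (xr * Mr * sqrt (xr * Mr) + 2 * xr^2 / K * (xr * Mr)))"
    using jle pos by (intro mult_left_mono add_left_mono mult_right_mono) (auto simp: xr_def K_def)
  finally have main: "(Mr * K)^2 \<le> xr * (10000 * (xr * Mr * sqrt (xr * Mr) + 2 * xr^2 / K * (xr * Mr)))" .
  \<comment> \<open>In terms of \<open>Y\<close>, and of \<open>Z = Y / xr^3\<close>, the comparison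
    becomes a quadratic inequality that forces \<open>Z \<le> 20000\<close>. The constant in
    \<open>C\<close> exceeds \<open>20000^2\<close>.\<close>
  define Y where "Y = K^2 * sqrt (xr * Mr)"
  have Ypos: "Y > 0" using pos by (simp add: Y_def)
  have Y2: "Y^2 = K^4 * xr * Mr" using pos by (simp add: Y_def power_mult_distrib flip: power_mult)
  have ineq: "Y^2 \<le> 10000 * xr^3 * Y + 20000 * xr^6"
  proof -
    have "xr * (10000 * (xr * Mr * sqrt (xr * Mr) + 2 * xr^2 / K * (xr * Mr)))
        = Mr * (10000 * (xr^2 * sqrt (xr * Mr) + 2 * xr^4 / K))"
      unfolding divide_inverse by Groebner_Basis.algebra
    moreover have "(Mr * K)^2 = Mr * (K^2 * Mr)" by Groebner_Basis.algebra
    ultimately have "Mr * (K^2 * Mr) \<le> Mr * (10000 * (xr^2 * sqrt (xr * Mr) + 2 * xr^4 / K))"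
      using main by simp
    then have "K^2 * Mr \<le> 10000 * (xr^2 * sqrt (xr * Mr) + 2 * xr^4 / K)" using pos by simp
    then have "xr * K^2 * (K^2 * Mr) \<le> xr * K^2 * (10000 * (xr^2 * sqrt (xr * Mr) + 2 * xr^4 / K))"
      using pos by (intro mult_left_mono) auto
    also have "\<dots> = 10000 * xr^3 * Y + 20000 * (xr^5 * K)"
    proof -
      have "K * inverse K = 1" using pos by simp
      then show ?thesis unfolding Y_def divide_inverse by Groebner_Basis.algebra
    qed
    also have "\<dots> \<le> 10000 * xr^3 * Y + 20000 * (xr^5 * xr)"
      using pos by (intro add_left_mono mult_left_mono) auto
    also have "\<dots> = 10000 * xr^3 * Y + 20000 * xr^6" by Groebner_Basis.algebra
    also have "xr * K^2 * (K^2 * Mr) = Y^2" unfolding Y2 by Groebner_Basis.algebra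
    finally show ?thesis .
  qed
  define Z where "Z = Y / xr^3"
  have YZ: "Y = Z * xr^3" using pos by (simp add: Z_def)
  have Zpos: "Z > 0" using Ypos pos by (simp add: Z_def)
  have "xr^6 * Z^2 \<le> xr^6 * (10000 * Z + 20000)"
  proof -
    have "xr^6 * Z^2 = (Z * xr^3)^2" "xr^6 * (10000 * Z + 20000) = 10000 * xr^3 * (Z * xr^3) + 20000 * xr^6"
      by Groebner_Basis.algebra+
    then show ?thesis using ineq unfolding YZ by simp
  qed
  then have Zle: "Z^2 \<le> 10000 * Z + 20000" using pos by simp
  have Zgt: "Z^2 > 5 * 10^8"
  proof -
    have "real (C * x^5) < real (M * k^4)" using Mlow by (simp only: of_nat_less_iff)
    then have "5 * 10^8 * xr^5 < Mr * K^4" by (simp add: C_def xr_def Mr_def K_def)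
    then have "xr * (5 * 10^8 * xr^5) < xr * (Mr * K^4)" using pos by simp
    also have "\<dots> = xr^6 * Z^2" using Y2 unfolding YZ by Groebner_Basis.algebra
    also have "xr * (5 * 10^8 * xr^5) = xr^6 * (5 * 10^8)" by Groebner_Basis.algebra
    finally have "xr^6 * (5 * 10^8) < xr^6 * Z^2" .
    then show ?thesis using pos by simp
  qed
  have "Z > 20000"
  proof (rule ccontr)
    assume "\<not> Z > 20000"
    then have "Z * Z \<le> 20000 * 20000" using Zpos by (intro mult_mono) auto
    then show False using Zgt by (simp add: power2_eq_square)
  qed
  then have "Z * 20000 < Z * Z" using Zpos by simp
  then show False using Zle \<open>Z > 20000\<close> unfolding power2_eq_square by linarith
qed

subsection \<open>Products of sums\<close>

text \<open>Summation by levels: a cube grows by at most \<open>3 * j^2\<close> at step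
  \<open>j\<close>, so level \<open>j\<close> contributes at most \<open>3 * D / j^2\<close>, which
  sums to \<open>3 * D / K\<close> beyond \<open>K\<close>. The base level contributes another
  \<open>D / K\<close>.\<close>

lemma layer_cake_cubes:
  fixes i :: "'q \<Rightarrow> nat" and D :: real
  assumes fin: "finite Q" and K: "K \<ge> 1" and ge: "\<And>q. q \<in> Q \<Longrightarrow> K \<le> i q" and D: "D \<ge> 0"
    and cnt: "\<And>j. j \<ge> K \<Longrightarrow> real (card {q\<in>Q. j \<le> i q}) * real j ^ 4 \<le> D"
  shows "(\<Sum>q\<in>Q. real (i q) ^ 3) \<le> 4 * D / K"
proof -
  define N where "N = K + (\<Sum>q\<in>Q. i q)"
  have iN: "i q \<le> N" if "q \<in> Q" for q
    using member_le_sum[of q Q i] fin that by (simp add: N_def)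
  have cube: "real (n + K) ^ 3 \<le> real K ^ 3 + (\<Sum>j\<in>{K<..n + K}. 3 * real j ^ 2)" for n
  proof (induction n)
    case (Suc n)
    have "{K<..Suc n + K} = insert (Suc (n + K)) {K<..n + K}" by auto
    then have "(\<Sum>j\<in>{K<..Suc n + K}. 3 * real j ^ 2) = 3 * real (Suc (n + K)) ^ 2 + (\<Sum>j\<in>{K<..n + K}. 3 * real j ^ 2)"
      by simp
    moreover have "real (Suc n + K) ^ 3 \<le> real (n + K) ^ 3 + 3 * real (Suc (n + K)) ^ 2"
    proof -
      define r where "r = real (n + K)"
      have r: "real (Suc n + K) = r + 1" "real (Suc (n + K)) = r + 1" "r \<ge> 0" by (simp_all add: r_def)
      have "r^3 + 3 * (r + 1)^2 - (r + 1)^3 = 3 * r + 2" by Groebner_Basis.algebra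
      then show ?thesis unfolding r r_def[symmetric] using r(3) by linarith
    qed
    ultimately show ?case using Suc by linarith
  qed simp
  have split: "real (i q) ^ 3 \<le> real K ^ 3 + (\<Sum>j\<in>{K<..N}. if j \<le> i q then 3 * real j ^ 2 else 0)" if q: "q \<in> Q" for q
  proof -
    obtain n where n: "i q = n + K" using ge[OF q] by (metis add.commute le_Suc_ex)
    have eq: "{K<..i q} = {j\<in>{K<..N}. j \<le> i q}" using iN[OF q] by auto
    have "(\<Sum>j\<in>{K<..i q}. 3 * real j ^ 2) = (\<Sum>j\<in>{K<..N}. if j \<le> i q then 3 * real j ^ 2 else 0)"
      unfolding eq by (rule sum.inter_filter) simp
    with cube[of n] show ?thesis unfolding n by simp
  qed
  have tail: "(\<Sum>j\<in>{K<..n + K}. 1 / real j ^ 2) \<le> 1 / K - 1 / real (n + K)" for n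
  proof (induction n)
    case (Suc n)
    have "{K<..Suc n + K} = insert (Suc (n + K)) {K<..n + K}" by auto
    then have "(\<Sum>j\<in>{K<..Suc n + K}. 1 / real j ^ 2) = 1 / real (Suc (n + K)) ^ 2 + (\<Sum>j\<in>{K<..n + K}. 1 / real j ^ 2)"
      by simp
    moreover have "1 / real (Suc (n + K)) ^ 2 \<le> 1 / real (n + K) - 1 / real (Suc n + K)"
    proof -
      define r where "r = real (n + K)"
      have r: "real (Suc n + K) = r + 1" "real (Suc (n + K)) = r + 1" "r > 0" using K by (simp_all add: r_def)
      have "1 / r - 1 / (r + 1) = 1 / (r * (r + 1))" using r(3) by (simp add: field_simps)
      moreover have "1 / (r + 1)^2 \<le> 1 / (r * (r + 1))"
        using r(3) by (intro divide_left_mono) (auto simp: power2_eq_square)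
      ultimately show ?thesis unfolding r r_def[symmetric] by linarith
    qed
    ultimately show ?case using Suc by linarith
  qed simp
  have cntd: "real (card {q\<in>Q. j \<le> i q}) \<le> D / real j ^ 4" if "j \<ge> K" for j
    using cnt[OF that] K that by (simp add: field_simps)
  have "(\<Sum>q\<in>Q. real (i q) ^ 3) \<le> (\<Sum>q\<in>Q. real K ^ 3 + (\<Sum>j\<in>{K<..N}. if j \<le> i q then 3 * real j ^ 2 else 0))"
    by (rule sum_mono) (rule split)
  also have "\<dots> = real (card Q) * real K ^ 3 + (\<Sum>j\<in>{K<..N}. \<Sum>q\<in>Q. if j \<le> i q then 3 * real j ^ 2 else 0)"
    by (subst sum.distrib, subst sum.swap) simp
  also have "(\<Sum>j\<in>{K<..N}. \<Sum>q\<in>Q. if j \<le> i q then 3 * real j ^ 2 else 0)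
      = (\<Sum>j\<in>{K<..N}. real (card {q\<in>Q. j \<le> i q}) * (3 * real j ^ 2))"
    using fin by (intro sum.cong refl) (simp add: sum.inter_filter[symmetric])
  also have "\<dots> \<le> (\<Sum>j\<in>{K<..N}. 3 * D * (1 / real j ^ 2))"
  proof (rule sum_mono)
    fix j assume j: "j \<in> {K<..N}"
    then have "real (card {q\<in>Q. j \<le> i q}) * (3 * real j ^ 2) \<le> D / real j ^ 4 * (3 * real j ^ 2)"
      by (intro mult_right_mono cntd) auto
    also have "\<dots> = 3 * D * (1 / real j ^ 2)"
      using j by (simp add: field_simps flip: power_add)
    finally show "real (card {q\<in>Q. j \<le> i q}) * (3 * real j ^ 2) \<le> 3 * D * (1 / real j ^ 2)" .
  qed
  also have "\<dots> \<le> 3 * D * (1 / K)"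
  proof -
    obtain n where n: "N = n + K" unfolding N_def by (metis add.commute)
    have "(\<Sum>j\<in>{K<..N}. 1 / real j ^ 2) \<le> 1 / K" using tail[of n] unfolding n
      by (rule order_trans) simp
    then show ?thesis unfolding sum_distrib_left[symmetric] using D by (intro mult_left_mono) auto
  qed
  also have "real (card Q) * real K ^ 3 \<le> D / K"
  proof -
    have "{q\<in>Q. K \<le> i q} = Q" using ge by auto
    then have "real (card Q) \<le> D / real K ^ 4" using cntd[of K] by simp
    then have "real (card Q) * real K ^ 3 \<le> D / real K ^ 4 * real K ^ 3" by (intro mult_right_mono) auto
    also have "\<dots> = D / K" using K by (simp add: field_simps eval_nat_numeral)
    finally show ?thesis .
  qed
  finally show ?thesis by simp
qed

section \<open>Moments of the incidence function and multiplicative energy\<close>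

lemma sum_inc:
  fixes X :: "'f::{field,finite} set"
  shows "(\<Sum>c\<in>UNIV. inc X m c) = card X ^ 2"
proof -
  have "(\<Sum>c\<in>UNIV. inc X m c) = (\<Sum>u\<in>X. card {c\<in>UNIV. m * u + c \<in> X})"
    unfolding inc_def by (rule sum_card_swap) auto
  also have "\<dots> = (\<Sum>u\<in>X. card X)"
  proof (rule sum.cong[OF refl])
    fix u
    have "{c. m * u + c \<in> X} = (\<lambda>v. v - m * u) ` X" by (auto simp: image_iff) (metis add_diff_cancel_left')
    then show "card {c\<in>UNIV. m * u + c \<in> X} = card X" by (simp add: card_image inj_on_def)
  qed
  finally show ?thesis by (simp add: power2_eq_square)
qed

text \<open>The sum counts pairs of grid points on a common non-vertical line. A point lies on
  \<open>CARD('f)\<close> such lines, and two points with distinct abscissas lie on at most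
  one.\<close>

lemma sum_inc_sq:
  fixes X :: "'f::{field,finite} set"
  shows "(\<Sum>m\<in>UNIV. \<Sum>c\<in>UNIV. inc X m c ^ 2) \<le> CARD('f) * card X ^ 2 + card X ^ 4"
proof -
  define I where "I q = {u\<in>X. fst q * u + snd q \<in> X}" for q :: "'f \<times> 'f"
  define T where "T = (SIGMA q:UNIV. I q \<times> I q)"
  define T1 T2 where "T1 = {(q, u, u') \<in> T. u = u'}" and "T2 = {(q, u, u') \<in> T. u \<noteq> u'}"
  have "(\<Sum>m\<in>UNIV. \<Sum>c\<in>UNIV. inc X m c ^ 2) = (\<Sum>q\<in>UNIV. inc X (fst q) (snd q) ^ 2)"
    by (simp add: sum.cartesian_product split_def)
  also have "\<dots> = (\<Sum>q\<in>UNIV. card (I q \<times> I q))"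
    by (simp add: I_def inc_def card_cartesian_product power2_eq_square)
  also have "\<dots> = card T" unfolding T_def by (subst card_SigmaI) auto
  also have "T = T1 \<union> T2" by (auto simp: T1_def T2_def)
  also have "card (T1 \<union> T2) \<le> card T1 + card T2" by (rule card_Un_le)
  also have "card T1 \<le> card (UNIV \<times> X \<times> X :: ('f \<times> 'f \<times> 'f) set)"
  proof (rule card_inj_on_le)
    let ?g = "\<lambda>(q :: 'f \<times> 'f, u, u' :: 'f). (fst q, u, fst q * u + snd q)"
    show "inj_on ?g T1" by (rule inj_onI) (auto simp: T1_def prod_eq_iff)
    show "?g ` T1 \<subseteq> UNIV \<times> X \<times> X" by (auto simp: T1_def T_def I_def)
  qed simp
  also have "card T2 \<le> card (X \<times> X \<times> X \<times> X)"
  proof (rule card_inj_on_le)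
    let ?g = "\<lambda>(q :: 'f \<times> 'f, u, u'). (u, u', fst q * u + snd q, fst q * u' + snd q)"
    show "inj_on ?g T2"
    proof (rule inj_onI)
      fix z z' assume z: "z \<in> T2" "z' \<in> T2" and e: "?g z = ?g z'"
      obtain m c u u' where zz: "z = ((m, c), u, u')" by (metis surj_pair)
      obtain n d v v' where zz': "z' = ((n, d), v, v')" by (metis surj_pair)
      have eqs: "v = u" "v' = u'" "m * u + c = n * u + d" "m * u' + c = n * u' + d"
        using e by (auto simp: zz zz')
      have ne: "u \<noteq> u'" using z by (simp add: zz T2_def)
      have "(m - n) * (u - u') = 0" using eqs(3,4) by Groebner_Basis.algebra
      then have "m = n" using ne by simp
      then show "z = z'" using eqs by (simp add: zz zz')
    qed
    show "?g ` T2 \<subseteq> X \<times> X \<times> X \<times> X" by (auto simp: T2_def T_def I_def)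
  qed simp
  finally show ?thesis by (simp add: card_cartesian_product eval_nat_numeral)
qed

text \<open>Equality of two products means that \<open>(a + b) / (a' + b')\<close> and
  \<open>(c' + d') / (c + d)\<close> are the same nonzero \<open>m\<close>. The equation
  \<open>a + b = m * (a' + b')\<close> says that \<open>a - m * a'\<close> and
  \<open>b - m * b'\<close> are opposite intercepts, so its solutions are counted by products of
  \<open>inc X m c\<close> and \<open>inc X m (- c)\<close>.\<close>

lemma product_energy_le:
  fixes X :: "'f::{field,finite} set"
  defines "W \<equiv> {(a, b, c, d). a \<in> X \<and> b \<in> X \<and> c \<in> X \<and> d \<in> X \<and> a + b \<noteq> 0 \<and> c + d \<noteq> 0}"
    and "f \<equiv> (\<lambda>(a, b, c, d). (a + b) * (c + d))"
  shows "card {(w, w'). w \<in> W \<and> w' \<in> W \<and> f w = f w'} \<le> (\<Sum>m\<in>UNIV - {0}. (\<Sum>c\<in>UNIV. inc X m c ^ 2) ^ 2)"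
proof -
  define Q where "Q m = {(a, b, a', b'). a \<in> X \<and> b \<in> X \<and> a' \<in> X \<and> b' \<in> X \<and> a + b = m * (a' + b')}" for m
  have cQ: "card (Q m) \<le> (\<Sum>c\<in>UNIV. inc X m c ^ 2)" for m
  proof -
    have "card (Q m) \<le> card (SIGMA c:UNIV. {u\<in>X. m * u + c \<in> X} \<times> {u\<in>X. m * u + (- c) \<in> X})"
    proof (rule card_inj_on_le)
      let ?g = "\<lambda>(a, b :: 'f, a', b'). (a - m * a', (a', b'))"
      show "inj_on ?g (Q m)"
      proof (rule inj_onI)
        fix z z' assume z: "z \<in> Q m" "z' \<in> Q m" and e: "?g z = ?g z'"
        obtain a b a' b' where zz: "z = (a, b, a', b')" by (metis surj_pair)
        obtain v w v' w' where zz': "z' = (v, w, v', w')" by (metis surj_pair)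
        have "a = v" "a' = v'" "b' = w'" using e by (auto simp: zz zz')
        moreover have "a + b = m * (a' + b')" "v + w = m * (v' + w')" using z by (simp_all add: zz zz' Q_def)
        ultimately show "z = z'" by (simp add: zz zz') (metis add_left_cancel)
      qed
      show "?g ` Q m \<subseteq> (SIGMA c:UNIV. {u\<in>X. m * u + c \<in> X} \<times> {u\<in>X. m * u + (- c) \<in> X})"
      proof
        fix q assume "q \<in> ?g ` Q m"
        then obtain z where z: "z \<in> Q m" "q = ?g z" by blast
        obtain a b a' b' where zz: "z = (a, b, a', b')" by (metis surj_pair)
        have mem: "a \<in> X" "b \<in> X" "a' \<in> X" "b' \<in> X" "a + b = m * (a' + b')" using z by (simp_all add: zz Q_def)
        have "m * b' + - (a - m * a') = b" using mem(5) by (simp add: algebra_simps)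
        then have 2: "m * b' + - (a - m * a') \<in> X" using mem(2) by metis
        have 1: "m * a' + (a - m * a') \<in> X" using mem(1) by simp
        have q: "q = (a - m * a', (a', b'))" using z by (simp add: zz)
        show "q \<in> (SIGMA c:UNIV. {u\<in>X. m * u + c \<in> X} \<times> {u\<in>X. m * u + (- c) \<in> X})"
          unfolding q using 1 2 mem(3,4) by blast
      qed
    qed simp
    also have "\<dots> = (\<Sum>c\<in>UNIV. inc X m c * inc X m (- c))"
      by (subst card_SigmaI) (auto simp: inc_def card_cartesian_product)
    finally have 1: "card (Q m) \<le> (\<Sum>c\<in>UNIV. inc X m c * inc X m (- c))" .
    have "2 * (\<Sum>c\<in>UNIV. inc X m c * inc X m (- c)) \<le> (\<Sum>c\<in>UNIV. inc X m c ^ 2 + inc X m (- c) ^ 2)"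
    proof -
      have "2 * (x * y) \<le> x^2 + y^2" for x y :: nat
      proof -
        have "2 * (real x * real y) \<le> real x ^ 2 + real y ^ 2" using sum_squares_bound[of "real x" "real y"] by simp
        then have "real (2 * (x * y)) \<le> real (x^2 + y^2)" by simp
        then show ?thesis by (simp only: of_nat_le_iff)
      qed
      then show ?thesis unfolding sum_distrib_left by (intro sum_mono)
    qed
    also have "\<dots> = (\<Sum>c\<in>UNIV. inc X m c ^ 2) + (\<Sum>c\<in>UNIV. inc X m (- c) ^ 2)" by (rule sum.distrib)
    also have "(\<Sum>c\<in>UNIV. inc X m (- c) ^ 2) = (\<Sum>c\<in>UNIV. inc X m c ^ 2)"
      by (rule sum.reindex_bij_witness[of _ uminus uminus]) auto
    finally show ?thesis using 1 by linarith
  qed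
  let ?E = "{(w, w'). w \<in> W \<and> w' \<in> W \<and> f w = f w'}"
  have "card ?E \<le> card (SIGMA m:UNIV - {0}. Q m \<times> Q m)"
  proof (rule card_inj_on_le)
    let ?g = "\<lambda>((a, b, c, d), (a', b', c', d')). ((a + b) / (a' + b'), (a, b, a', b'), (c', d', c, d)) :: 'f \<times> _"
    show "finite (SIGMA m:UNIV - {0}. Q m \<times> Q m)" by simp
    show "inj_on ?g ?E" by (rule inj_onI) auto
    show "?g ` ?E \<subseteq> (SIGMA m:UNIV - {0}. Q m \<times> Q m)"
    proof
      fix q assume "q \<in> ?g ` ?E"
      then obtain z where z: "z \<in> ?E" "q = ?g z" by blast
      obtain a b c d a' b' c' d' where zz: "z = ((a, b, c, d), (a', b', c', d'))" by (metis surj_pair)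
      have mem: "a \<in> X" "b \<in> X" "c \<in> X" "d \<in> X" "a' \<in> X" "b' \<in> X" "c' \<in> X" "d' \<in> X"
        "a + b \<noteq> 0" "c + d \<noteq> 0" "a' + b' \<noteq> 0" "c' + d' \<noteq> 0" "(a + b) * (c + d) = (a' + b') * (c' + d')"
        using z by (simp_all add: zz W_def f_def)
      have q: "q = ((a + b) / (a' + b'), (a, b, a', b'), (c', d', c, d))" using z by (simp add: zz)
      have "(a + b) / (a' + b') \<noteq> 0" using mem by simp
      moreover have "a + b = (a + b) / (a' + b') * (a' + b')" using mem by simp
      moreover have "c' + d' = (a + b) / (a' + b') * (c + d)"
        using mem by (simp add: field_simps)
      ultimately show "q \<in> (SIGMA m:UNIV - {0}. Q m \<times> Q m)" unfolding q Q_def using mem(1-8) by simp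
    qed
  qed
  also have "\<dots> = (\<Sum>m\<in>UNIV - {0}. card (Q m) ^ 2)"
    by (subst card_SigmaI) (auto simp: card_cartesian_product power2_eq_square)
  also have "\<dots> \<le> (\<Sum>m\<in>UNIV - {0}. (\<Sum>c\<in>UNIV. inc X m c ^ 2) ^ 2)"
    by (intro sum_mono power_mono cQ) auto
  finally show ?thesis .
qed

text \<open>
  Lines of richness below about \<open>200 x powr (3/2) / p powr (1/2)\<close> are handled by the variance of \<open>inc X m\<close> around
  its mean \<open>x\<^sup>2 / p\<close>, the others by summing \<open>rich_lines_bound\<close> over all richness levels.
\<close>

lemma energy_squares_bound:
  fixes X :: "'f::{field,finite} set"
  defines "p \<equiv> CARD('f)" and "x \<equiv> real (card X)"
  assumes ch: "\<And>n. 0 < n \<Longrightarrow> n < p \<Longrightarrow> of_nat n \<noteq> (0::'f)" and p: "2 < p" and xp: "p \<le> card X ^ 3"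
  shows "real (\<Sum>m\<in>UNIV - {0}. (\<Sum>c\<in>UNIV. inc X m c ^ 2) ^ 2) \<le>
    16 * x^8 / p + 3 * 10^7 * (sqrt x ^ 11 * sqrt p)"
proof -
  define s q where "s = sqrt x" and "q = sqrt p"
  have x1: "x \<ge> 1" using xp p by (cases "card X") (auto simp: x_def)
  have sq: "s > 0" "q > 0" "s^2 = x" "q^2 = real p" using x1 p by (simp_all add: s_def q_def)
  have cXp: "card X \<le> p" unfolding p_def by (rule card_mono) auto
  have sleq: "s \<le> q" using cXp by (simp add: s_def q_def x_def)
  \<comment> \<open>Chosen so that \<open>\<kappa>^2 * p = 40000 * x^3\<close>, the threshold in
    \<open>rich_lines_bound\<close>.\<close>
  define \<kappa> where "\<kappa> = 200 * s^3 / q"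
  define K where "K = nat \<lceil>\<kappa>\<rceil>"
  have kap: "\<kappa> \<ge> 200"
  proof -
    have "real p \<le> real (card X ^ 3)" using xp by (simp only: of_nat_le_iff)
    then have "q^2 \<le> x^3" by (simp add: sq x_def)
    also have "x^3 = (s^3)^2" unfolding sq(3)[symmetric] by (simp flip: power_mult)
    finally have "q \<le> s^3" by (rule power2_le_imp_le) (use sq in simp)
    then show ?thesis using sq by (simp add: \<kappa>_def field_simps)
  qed
  have K: "\<kappa> \<le> real K" "real K \<le> 2 * \<kappa>" "K \<ge> 2"
    using kap unfolding K_def by linarith+
  define \<mu> where "\<mu> = x^2 / p"
  have mu: "\<mu> \<ge> 0" "\<mu> \<le> real K"
  proof -
    show "\<mu> \<ge> 0" by (simp add: \<mu>_def)
    have "s * (s^3 / q^2) \<le> 200 * q * (s^3 / q^2)" using sleq sq by (intro mult_right_mono) auto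
    moreover have "s * (s^3 / q^2) = \<mu>" unfolding \<mu>_def sq(3,4)[symmetric] by (simp add: eval_nat_numeral)
    moreover have "200 * q * (s^3 / q^2) = \<kappa>" using sq(2) by (simp add: \<kappa>_def power2_eq_square)
    ultimately show "\<mu> \<le> real K" using K(1) by linarith
  qed
  define i where "i m c = real (inc X m c)" for m c
  have i0: "i m c \<ge> 0" for m c by (simp add: i_def)
  have sum_i: "(\<Sum>c\<in>UNIV. i m c) = x^2" for m
    using sum_inc[of X m] unfolding i_def x_def by (metis of_nat_power of_nat_sum)
  define L H V where "L m = (\<Sum>c | inc X m c < K. i m c ^ 2)" and "H m = (\<Sum>c | K \<le> inc X m c. i m c ^ 2)"
    and "V m = (\<Sum>c | inc X m c < K. (i m c - \<mu>)^2)" for m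
  have E: "real (\<Sum>c\<in>UNIV. inc X m c ^ 2) = L m + H m" for m
  proof -
    have "L m + H m = (\<Sum>c\<in>{c. inc X m c < K} \<union> {c. K \<le> inc X m c}. i m c ^ 2)"
      unfolding L_def H_def by (rule sum.union_disjoint[symmetric]) auto
    also have "{c. inc X m c < K} \<union> {c. K \<le> inc X m c} = UNIV" by auto
    finally show ?thesis by (simp add: i_def)
  qed
  have V0: "V m \<ge> 0" for m unfolding V_def by (intro sum_nonneg) auto
  have LV: "L m \<le> 2 * p * \<mu>^2 + 2 * V m" for m
  proof -
    have "L m \<le> (\<Sum>c | inc X m c < K. 2 * \<mu>^2 + 2 * (i m c - \<mu>)^2)"
      unfolding L_def
    proof (rule sum_mono)
      fix c
      have "0 \<le> (i m c - 2 * \<mu>)^2" by simp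
      then show "i m c ^ 2 \<le> 2 * \<mu>^2 + 2 * (i m c - \<mu>)^2" by (simp add: power2_eq_square algebra_simps)
    qed
    also have "\<dots> = real (card {c. inc X m c < K}) * (2 * \<mu>^2) + 2 * V m"
      by (simp add: sum.distrib V_def sum_distrib_left)
    also have "real (card {c. inc X m c < K}) * (2 * \<mu>^2) \<le> real p * (2 * \<mu>^2)"
      unfolding p_def by (intro mult_right_mono) (auto intro!: card_mono)
    finally show ?thesis by simp
  qed
  \<comment> \<open>A uniform bound for \<open>V m\<close>; multiplied with the bound
    \<open>Vsum\<close> for the sum it controls the sum of the squares.\<close>
  have Vle: "V m \<le> 4 * K * x^2" for m
  proof -
    have "V m \<le> (\<Sum>c | inc X m c < K. (i m c + \<mu>) * (2 * K))"
      unfolding V_def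
    proof (rule sum_mono)
      fix c assume "c \<in> {c. inc X m c < K}"
      then have "i m c \<le> real K" by (simp add: i_def)
      then have "(i m c - \<mu>)^2 \<le> (i m c + \<mu>)^2" "(i m c + \<mu>) \<le> 2 * K"
        using i0[of m c] mu by (auto simp: power2_eq_square algebra_simps)
      moreover have "(i m c + \<mu>)^2 \<le> (i m c + \<mu>) * (2 * K)"
        using calculation(2) i0[of m c] mu unfolding power2_eq_square by (intro mult_left_mono) auto
      ultimately show "(i m c - \<mu>)^2 \<le> (i m c + \<mu>) * (2 * K)" by linarith
    qed
    also have "\<dots> \<le> (\<Sum>c\<in>UNIV. (i m c + \<mu>) * (2 * K))"
      using i0 mu by (intro sum_mono2) (auto intro!: mult_nonneg_nonneg add_nonneg_nonneg)
    also have "\<dots> = (x^2 + p * \<mu>) * (2 * K)"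
      unfolding sum_distrib_right[symmetric] by (simp add: sum.distrib sum_i p_def)
    also have "p * \<mu> = x^2" using p by (simp add: \<mu>_def)
    finally show ?thesis by (simp add: algebra_simps)
  qed
  \<comment> \<open>Centering at the mean cancels the main term \<open>x^4\<close> of
    \<open>sum_inc_sq\<close>.\<close>
  have Vsum: "(\<Sum>m\<in>UNIV - {0}. V m) \<le> p * x^2"
  proof -
    have "(\<Sum>m\<in>UNIV - {0}. V m) \<le> (\<Sum>m\<in>UNIV. V m)" using V0 by (intro sum_mono2) auto
    also have "\<dots> \<le> (\<Sum>m\<in>UNIV. \<Sum>c\<in>UNIV. (i m c - \<mu>)^2)"
      unfolding V_def by (intro sum_mono sum_mono2) auto
    also have "\<dots> = (\<Sum>m\<in>UNIV. (\<Sum>c\<in>UNIV. i m c ^ 2) - x^4 / p)"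
    proof (rule sum.cong[OF refl])
      fix m
      have "(\<Sum>c\<in>UNIV. (i m c - \<mu>)^2) = (\<Sum>c\<in>UNIV. i m c ^ 2) - 2 * \<mu> * (\<Sum>c\<in>UNIV. i m c) + p * \<mu>^2"
        unfolding power2_diff
        by (simp add: sum.distrib sum_subtractf sum_distrib_left p_def algebra_simps)
      also have "\<dots> = (\<Sum>c\<in>UNIV. i m c ^ 2) - x^4 / p"
        unfolding sum_i using p by (simp add: \<mu>_def field_simps eval_nat_numeral)
      finally show "(\<Sum>c\<in>UNIV. (i m c - \<mu>)^2) = (\<Sum>c\<in>UNIV. i m c ^ 2) - x^4 / p" .
    qed
    also have "\<dots> = real (\<Sum>m\<in>UNIV. \<Sum>c\<in>UNIV. inc X m c ^ 2) - x^4"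
      using p by (simp add: sum_subtractf i_def p_def)
    also have "\<dots> \<le> real (p * card X ^ 2 + card X ^ 4) - x^4"
      using sum_inc_sq[of X] unfolding p_def by (intro diff_right_mono) (simp only: of_nat_le_iff)
    finally show ?thesis by (simp add: x_def)
  qed
  have Lsum: "(\<Sum>m\<in>UNIV - {0}. L m ^ 2) \<le> 8 * x^8 / p + 12800 * (s^11 * q)"
  proof -
    have "L m ^ 2 \<le> 8 * p^2 * \<mu>^4 + 8 * (4 * K * x^2) * V m" for m
    proof -
      have "0 \<le> L m" unfolding L_def by (intro sum_nonneg) auto
      then have "L m ^ 2 \<le> (2 * p * \<mu>^2 + 2 * V m)^2" using LV[of m] by (intro power_mono) auto
      also have "\<dots> \<le> 2 * (2 * p * \<mu>^2)^2 + 2 * (2 * V m)^2"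
      proof -
        have "0 \<le> (2 * p * \<mu>^2 - 2 * V m)^2" by simp
        then show ?thesis by (simp add: power2_eq_square algebra_simps)
      qed
      also have "\<dots> = 8 * p^2 * \<mu>^4 + 8 * (V m * V m)" by (simp add: power2_eq_square eval_nat_numeral)
      also have "V m * V m \<le> 4 * K * x^2 * V m" using Vle[of m] V0[of m] by (rule mult_right_mono)
      finally show ?thesis by (simp add: mult.assoc)
    qed
    then have "(\<Sum>m\<in>UNIV - {0}. L m ^ 2) \<le> (\<Sum>m\<in>UNIV - {0::'f}. 8 * p^2 * \<mu>^4 + 8 * (4 * K * x^2) * V m)"
      by (intro sum_mono)
    also have "\<dots> = real (card (UNIV - {0::'f})) * (8 * p^2 * \<mu>^4) + 8 * (4 * K * x^2) * (\<Sum>m\<in>UNIV - {0}. V m)"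
      by (simp add: sum.distrib sum_distrib_left)
    also have "\<dots> \<le> real p * (8 * p^2 * \<mu>^4) + 8 * (4 * K * x^2) * (p * x^2)"
      using Vsum by (intro add_mono mult_right_mono mult_left_mono) (auto simp: p_def)
    also have "real p * (8 * p^2 * \<mu>^4) = 8 * x^8 / p"
      using p by (simp add: \<mu>_def field_simps eval_nat_numeral)
    also have "8 * (4 * K * x^2) * (p * x^2) \<le> 8 * (4 * (2 * \<kappa>) * x^2) * (p * x^2)"
      using K(2) by (intro mult_right_mono mult_left_mono) auto
    also have "\<dots> = 12800 * (s^11 * q)"
    proof -
      have "\<kappa> * q = 200 * s^3" using sq by (simp add: \<kappa>_def)
      then have "8 * (4 * (2 * \<kappa>) * (s^2)^2) * (q^2 * (s^2)^2) = 12800 * (s^11 * q)" by Groebner_Basis.algebra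
      then show ?thesis unfolding sq .
    qed
    finally show ?thesis by simp
  qed
  have Hsum: "(\<Sum>m\<in>UNIV - {0}. H m ^ 2) \<le> 10^7 * (s^11 * q)"
  proof -
    define Q where "Q = {(m, c). m \<noteq> 0 \<and> K \<le> inc X m c}"
    \<comment> \<open>Splitting \<open>i^2\<close> as \<open>i powr (1/2) * i powr (3/2)\<close> in
      Cauchy-Schwarz leaves one factor with the known first moment and one with the third moment,
      which the layer cake bounds.\<close>
    have H2: "H m ^ 2 \<le> x^2 * (\<Sum>c | K \<le> inc X m c. i m c ^ 3)" for m
    proof -
      have "H m = (\<Sum>c | K \<le> inc X m c. sqrt (i m c) * (i m c * sqrt (i m c)))"
        unfolding H_def by (rule sum.cong) (use i0 in \<open>auto simp: power2_eq_square\<close>)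
      then have "H m ^ 2 \<le> (\<Sum>c | K \<le> inc X m c. (sqrt (i m c))^2) * (\<Sum>c | K \<le> inc X m c. (i m c * sqrt (i m c))^2)"
        using Cauchy_Schwarz_ineq_sum by simp
      also have "(\<Sum>c | K \<le> inc X m c. (sqrt (i m c))^2) = (\<Sum>c | K \<le> inc X m c. i m c)"
        using i0 by simp
      also have "(\<Sum>c | K \<le> inc X m c. (i m c * sqrt (i m c))^2) = (\<Sum>c | K \<le> inc X m c. i m c ^ 3)"
        by (rule sum.cong) (use i0 in \<open>auto simp: power_mult_distrib eval_nat_numeral\<close>)
      also have "(\<Sum>c | K \<le> inc X m c. i m c) * (\<Sum>c | K \<le> inc X m c. i m c ^ 3)
          \<le> (\<Sum>c\<in>UNIV. i m c) * (\<Sum>c | K \<le> inc X m c. i m c ^ 3)"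
        using i0 by (intro mult_right_mono sum_mono2 sum_nonneg) auto
      finally show ?thesis by (simp add: sum_i)
    qed
    have "(\<Sum>m\<in>UNIV - {0}. H m ^ 2) \<le> (\<Sum>m\<in>UNIV - {0}. x^2 * (\<Sum>c | K \<le> inc X m c. i m c ^ 3))"
      by (intro sum_mono H2)
    also have "\<dots> = x^2 * (\<Sum>m\<in>UNIV - {0}. \<Sum>c | K \<le> inc X m c. i m c ^ 3)" by (simp add: sum_distrib_left)
    also have "(\<Sum>m\<in>UNIV - {0}. \<Sum>c | K \<le> inc X m c. i m c ^ 3) = (\<Sum>z\<in>Q. real (inc X (fst z) (snd z)) ^ 3)"
    proof -
      have "Q = (SIGMA m:UNIV - {0}. {c. K \<le> inc X m c})" by (auto simp: Q_def)
      then show ?thesis by (subst sum.Sigma) (auto simp: i_def split_def)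
    qed
    also have "\<dots> \<le> 4 * (5 * 10^8 * x^5) / K"
    proof (rule layer_cake_cubes)
      show "finite Q" by simp
      show "1 \<le> K" using K by simp
      show "K \<le> inc X (fst z) (snd z)" if "z \<in> Q" for z using that by (auto simp: Q_def)
      show "0 \<le> 5 * 10^8 * x^5" using x1 by simp
      show "real (card {z\<in>Q. j \<le> inc X (fst z) (snd z)}) * real j ^ 4 \<le> 5 * 10^8 * x^5" if j: "K \<le> j" for j
      proof -
        have "real (card {z\<in>Q. j \<le> inc X (fst z) (snd z)}) \<le> real (card {(m, c). m \<noteq> 0 \<and> j \<le> inc X m c})"
          by (simp only: of_nat_le_iff) (rule card_mono, auto simp: Q_def)
        then have "real (card {z\<in>Q. j \<le> inc X (fst z) (snd z)}) * real j ^ 4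
            \<le> real (card {(m, c). m \<noteq> 0 \<and> j \<le> inc X m c}) * real j ^ 4" by (intro mult_right_mono) auto
        also have "\<dots> \<le> 5 * 10^8 * real (card X) ^ 5"
        proof (rule rich_lines_bound[OF ch p cXp])
          have "\<kappa>^2 * real p \<le> real j ^ 2 * real p"
            using K(1) kap j by (intro mult_right_mono power_mono) auto
          moreover have "\<kappa>^2 * real p = 40000 * x^3"
          proof -
            have "\<kappa> * q = 200 * s^3" using sq by (simp add: \<kappa>_def)
            then have "\<kappa>^2 * q^2 = 40000 * (s^2)^3" by Groebner_Basis.algebra
            then show ?thesis by (simp add: sq)
          qed
          ultimately have "real (40000 * card X ^ 3) \<le> real (j^2 * p)" by (simp add: x_def)
          then show "40000 * card X ^ 3 \<le> j^2 * p" by (simp only: of_nat_le_iff)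
          show "2 \<le> j" using K(3) j by simp
        qed
        finally show ?thesis by (simp add: x_def)
      qed
    qed
    also have "x^2 * (4 * (5 * 10^8 * x^5) / K) \<le> x^2 * (4 * (5 * 10^8 * x^5) / \<kappa>)"
      using K(1) kap x1 by (intro mult_left_mono divide_left_mono) auto
    also have "\<dots> = 10^7 * (s^11 * q)"
    proof -
      have q: "inverse \<kappa> * (200 * s^3) = q" using sq by (simp add: \<kappa>_def field_simps)
      have "s^11 * s^3 = (s^2)^2 * (s^2)^5" by (simp flip: power_mult power_add)
      then have "10000000 * (s^11 * q) = 2000000000 * (inverse \<kappa> * ((s^2)^2 * (s^2)^5))"
        unfolding q[symmetric] by (simp add: ac_simps)
      then show ?thesis unfolding sq divide_inverse by simp
    qed
    finally show ?thesis using x1 by simp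
  qed
  have "real (\<Sum>m\<in>UNIV - {0}. (\<Sum>c\<in>UNIV. inc X m c ^ 2) ^ 2) = (\<Sum>m\<in>UNIV - {0}. (L m + H m)^2)"
    unfolding E[symmetric] by simp
  also have "\<dots> \<le> (\<Sum>m\<in>UNIV - {0}. 2 * L m ^ 2 + 2 * H m ^ 2)"
  proof (rule sum_mono)
    fix m
    have "0 \<le> (L m - H m)^2" by simp
    then show "(L m + H m)^2 \<le> 2 * L m ^ 2 + 2 * H m ^ 2" by (simp add: power2_eq_square algebra_simps)
  qed
  also have "\<dots> = 2 * (\<Sum>m\<in>UNIV - {0}. L m ^ 2) + 2 * (\<Sum>m\<in>UNIV - {0}. H m ^ 2)"
    by (simp add: sum.distrib sum_distrib_left)
  also have "\<dots> \<le> 2 * (8 * x^8 / p + 12800 * (s^11 * q)) + 2 * (10^7 * (s^11 * q))"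
    using Lsum Hsum by (intro add_mono mult_left_mono) auto
  also have "\<dots> \<le> 16 * x^8 / p + 3 * 10^7 * (s^11 * q)" using sq by simp
  finally show ?thesis by (simp add: s_def q_def)
qed

text \<open>The parameter \<open>B\<close> measures how far \<open>x\<close> may fall below
  \<open>p powr (3/5)\<close>. The hypothesis on it makes the second energy term at most a constant
  times \<open>x^8 / p\<close>, and Cauchy-Schwarz on about \<open>x^4\<close> quadruples then gives
  a multiple of \<open>p\<close>.\<close>

lemma card_products_of_sums:
  fixes X :: "'f::{field,finite} set" and B :: real
  defines "p \<equiv> CARD('f)" and "x \<equiv> real (card X)"
  assumes ch: "\<And>n. 0 < n \<Longrightarrow> n < p \<Longrightarrow> of_nat n \<noteq> (0::'f)" and p: "2 < p"
    and xp: "p \<le> card X ^ 3" "card X \<ge> 4" and B: "sqrt p ^ 3 \<le> B * sqrt x ^ 5"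
  shows "real p / (4 * (16 + 3 * 10^7 * B)) \<le>
    real (card {(a + b) * (c + d) |a b c d. a \<in> X \<and> b \<in> X \<and> c \<in> X \<and> d \<in> X})"
proof -
  define W where "W = {(a, b, c, d). a \<in> X \<and> b \<in> X \<and> c \<in> X \<and> d \<in> X \<and> a + b \<noteq> 0 \<and> c + d \<noteq> 0}"
  define f where "f = (\<lambda>(a, b, c, d). (a + b) * (c + d) :: 'f)"
  define Z where "Z = {(a + b) * (c + d) |a b c d. a \<in> X \<and> b \<in> X \<and> c \<in> X \<and> d \<in> X}"
  define s q where "s = sqrt x" and "q = sqrt p"
  have x4: "x \<ge> 4" using xp by (simp add: x_def)
  have sq: "s > 0" "q > 0" "s^2 = x" "q^2 = real p" using x4 p by (simp_all add: s_def q_def)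
  have Bpos: "B > 0"
  proof -
    have "0 < q^3" using sq by simp
    also have "q^3 \<le> B * s^5" using B by (simp add: s_def q_def)
    finally have "0 < B * s^5" .
    then show ?thesis using sq by (simp add: zero_less_mult_iff)
  qed
  \<comment> \<open>For \<open>x \<ge> 4\<close> at least three quarters of the pairs have nonzero
    sum, and \<open>9 / 16\<close> exceeds one half.\<close>
  have cW: "x^4 / 2 \<le> real (card W)"
  proof -
    define Y where "Y = {(a, b). a \<in> X \<and> b \<in> X \<and> a + b \<noteq> 0}"
    have "X \<times> X \<subseteq> Y \<union> (\<lambda>a. (a, - a)) ` X" by (auto simp: Y_def add_eq_0_iff image_iff)
    then have "card (X \<times> X) \<le> card (Y \<union> (\<lambda>a. (a, - a)) ` X)" by (intro card_mono) auto
    also have "\<dots> \<le> card Y + card ((\<lambda>a. (a, - a)) ` X)" by (rule card_Un_le)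
    also have "card ((\<lambda>a. (a, - a)) ` X) \<le> card X" by (rule card_image_le) simp
    finally have "real (card X * card X) \<le> real (card Y + card X)" by (simp only: of_nat_le_iff card_cartesian_product)
    then have Y1: "x^2 - x \<le> real (card Y)" by (simp add: x_def power2_eq_square)
    have "4 * x \<le> x * x" using x4 by (intro mult_right_mono) auto
    then have "3 / 4 * x^2 \<le> real (card Y)" using Y1 by (simp add: power2_eq_square)
    then have "(3 / 4 * x^2)^2 \<le> real (card Y)^2" by (intro power_mono) auto
    moreover have "W = (\<lambda>((a, b), (c, d)). (a, b, c, d)) ` (Y \<times> Y)" by (force simp: W_def Y_def)
    then have "card W = card (Y \<times> Y)" by (simp only:) (rule card_image, auto simp: inj_on_def)
    then have "real (card W) = real (card Y)^2" by (simp add: card_cartesian_product power2_eq_square)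
    moreover have "(3 / 4 * x^2)^2 = 9 / 16 * x^4" by (simp add: power_mult_distrib power_divide flip: power_mult)
    moreover have "x^4 / 2 \<le> 9 / 16 * x^4" using x4 by simp
    ultimately show ?thesis by linarith
  qed
  let ?E = "{(w, w'). w \<in> W \<and> w' \<in> W \<and> f w = f w'}"
  have "real (card ?E) \<le> real (\<Sum>m\<in>UNIV - {0}. (\<Sum>c\<in>UNIV. inc X m c ^ 2) ^ 2)"
    unfolding W_def f_def by (simp only: of_nat_le_iff) (rule product_energy_le)
  also have "\<dots> \<le> 16 * x^8 / p + 3 * 10^7 * (s^11 * q)"
    unfolding s_def q_def x_def p_def by (rule energy_squares_bound) (use ch p xp in \<open>auto simp: p_def\<close>)
  also have "\<dots> \<le> (16 + 3 * 10^7 * B) * (x^8 / p)"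
  proof -
    have "q^3 * (s^11 / q^2) \<le> B * s^5 * (s^11 / q^2)" using B sq unfolding s_def[symmetric] q_def[symmetric]
      by (intro mult_right_mono) auto
    moreover have "q^3 * (s^11 / q^2) = s^11 * q" using sq(2) by (simp add: field_simps eval_nat_numeral)
    moreover have "B * s^5 * (s^11 / q^2) = B * (x^8 / p)"
      unfolding sq(3,4)[symmetric] by (simp flip: power_mult power_add)
    ultimately have "s^11 * q \<le> B * (x^8 / p)" by linarith
    then have "3 * 10^7 * (s^11 * q) \<le> 3 * 10^7 * (B * (x^8 / p))" by (intro mult_left_mono) auto
    then show ?thesis by (simp add: algebra_simps)
  qed
  finally have E: "real (card ?E) \<le> (16 + 3 * 10^7 * B) * (x^8 / p)" .
  have "x^8 / 4 \<le> real (card W)^2"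
  proof -
    have "(x^4 / 2)^2 \<le> real (card W)^2" using cW x4 by (intro power_mono) auto
    then show ?thesis by (simp add: power_divide flip: power_mult)
  qed
  also have "\<dots> \<le> real (card (f ` W)) * real (card ?E)" by (rule card_sq_le_image_energy) simp
  also have "\<dots> \<le> real (card Z) * ((16 + 3 * 10^7 * B) * (x^8 / p))"
  proof (intro mult_mono E)
    show "real (card (f ` W)) \<le> real (card Z)"
      by (simp only: of_nat_le_iff) (rule card_mono, auto simp: f_def W_def Z_def)
  qed auto
  finally have "x^8 * (1 / 4) \<le> x^8 * (real (card Z) * (16 + 3 * 10^7 * B) / p)" by (simp add: field_simps)
  moreover have "x^8 > 0" using x4 by simp
  ultimately have "1 / 4 \<le> real (card Z) * (16 + 3 * 10^7 * B) / p" using mult_le_cancel_left_pos by blast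
  then have "real p / 4 \<le> real (card Z) * (16 + 3 * 10^7 * B)" using p by (simp add: field_simps)
  moreover have "16 + 3 * 10^7 * B > 0" using Bpos by simp
  ultimately show ?thesis unfolding Z_def[symmetric] by (simp add: field_simps)
qed

subsection \<open>Transfer to residues\<close>

text \<open>
  In terms of \<open>|A|\<close> the hypothesis of the theorem reads \<open>|A| \<ge> C p powr growth_exponent k\<close> with another \<open>C\<close>.
  The factor \<open>10^60\<close> used for it forces \<open>p \<ge> 10^60\<close> because \<open>|A| \<le> p\<close>.
\<close>

definition growth_exponent :: "nat \<Rightarrow> real" where
  "growth_exponent k = 3 * 2^k / (10 * (2^k - 1))"

lemma growth_exponent_bounds:
  assumes "k \<ge> 2"
  shows "0 < growth_exponent k" "growth_exponent k \<le> 2/5"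
    "growth_exponent k * (2 - 1 / 2^(k - 1)) = 3/5"
proof -
  have t: "(2::real)^k \<ge> 4"
    using power_increasing[OF assms, of "2::real"] by simp
  show "0 < growth_exponent k" "growth_exponent k \<le> 2/5"
    using t by (simp_all add: growth_exponent_def field_simps)
  have "(2::real)^k = 2 * 2^(k - 1)" using assms by (cases k) auto
  then show "growth_exponent k * (2 - 1 / 2^(k - 1)) = 3/5"
    using t by (simp add: growth_exponent_def field_simps)
qed

lemma sq_sums_mono: "A \<subseteq> B \<Longrightarrow> sq_sums k A \<subseteq> sq_sums k B"
  by (induction k) fastforce+

text \<open>The constant of \<open>card_products_of_sums\<close> with \<open>B = 20000^5\<close>:
  the loss \<open>20000^2\<close> in the size of \<open>X\<close> enters to the power
  \<open>5/2\<close>.\<close>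

definition final_const :: real where
  "final_const = 1 / (4 * (16 + 3 * 10^7 * 20000^5))"

text \<open>The growth lemma requires a set avoiding 0 with at most \<open>sqrt p\<close> elements.
  Therefore \<open>A\<close> is replaced by a subset \<open>A'\<close> of size about
  \<open>p powr e\<close>, which is below \<open>sqrt p\<close> since
  \<open>e \<le> 2/5\<close>.\<close>

lemma card_products_of_sq_sums:
  fixes A :: "'f::{field,finite} set" and k :: nat
  defines "p \<equiv> CARD('f)"
  assumes ch: "\<And>n. 0 < n \<Longrightarrow> n < p \<Longrightarrow> of_nat n \<noteq> (0::'f)" and k: "k \<ge> 2"
    and A: "10^60 * real p powr growth_exponent k \<le> real (card A)"
  shows "final_const * real p \<le>
    real (card {v * w |v w. v \<in> sq_sums (2 * k) A \<and> w \<in> sq_sums (2 * k) A})"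
proof -
  define e where "e = growth_exponent k"
  note e = growth_exponent_bounds[OF k, folded e_def]
  define P where "P = real p"
  have "card A \<le> p" unfolding p_def by (intro card_mono) auto
  then have Ap: "real (card A) \<le> P" by (simp add: P_def)
  have "p > 0" unfolding p_def by (simp add: card_gt_0_iff)
  then have P1: "P \<ge> 1" by (simp add: P_def)
  then have Pe: "P powr e \<ge> 1" using e by (simp add: ge_one_powr_ge_zero)
  have "10^60 * 1 \<le> 10^60 * P powr e" using Pe by (intro mult_left_mono) auto
  then have P60: "P \<ge> 10^60" using A Ap unfolding e_def[symmetric] P_def[symmetric] by linarith
  \<comment> \<open>With the fifth root of \<open>p\<close> the exponents \<open>2/5\<close>,
    \<open>3/5\<close> and 1 become the integral powers \<open>q^2\<close>, \<open>q^3\<close> and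
    \<open>q^5\<close>.\<close>
  define q where "q = P powr (1/5)"
  have q: "q > 0" "q ^ 5 = P"
    using P1 by (simp_all add: q_def powr_realpow[symmetric] powr_powr)
  \<comment> \<open>The factor \<open>10^60\<close> enters here; a large \<open>q\<close> absorbs
    the powers of 20000 below.\<close>
  have q12: "q \<ge> 10^12"
  proof (rule power_le_imp_le_base[of _ 4])
    show "(10^12) ^ Suc 4 \<le> q ^ Suc 4" using q P60 by simp
  qed (use q in simp)
  define N where "N = nat \<lceil>P powr e\<rceil>"
  have N1: "P powr e \<le> real N" unfolding N_def by linarith
  have N2: "real N \<le> 2 * P powr e" using Pe unfolding N_def by linarith
  have "real (card (A - {0})) \<ge> real (card A) - 1"
    by (cases "0 \<in> A") (auto simp: card_Diff_singleton of_nat_diff)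
  moreover have "3 * P powr e \<le> 10^60 * P powr e" by (intro mult_right_mono) auto
  ultimately have "real N \<le> real (card (A - {0}))"
    using A N2 Pe unfolding e_def[symmetric] P_def[symmetric] by linarith
  then have "N \<le> card (A - {0})" by simp
  then obtain A' where A': "A' \<subseteq> A - {0}" "card A' = N"
    using obtain_subset_with_card_n by blast
  have "N > 0" using N1 Pe by (cases N) auto
  have "P powr e \<le> P powr (2/5)" using e P1 by (intro powr_mono) auto
  also have "\<dots> = q^2" using P1 by (simp add: q_def powr_realpow[symmetric] powr_powr)
  finally have "real N \<le> 2 * q^2" using N2 by linarith
  then have "real N ^ 2 \<le> (2 * q^2) ^ 2" by (intro power_mono) auto
  also have "\<dots> = 4 * q^4" by (simp add: power2_eq_square eval_nat_numeral)
  also have "\<dots> \<le> q * q^4" using q q12 by (intro mult_right_mono) auto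
  also have "\<dots> = P" using q(2) by (simp add: eval_nat_numeral)
  finally have Np: "N ^ 2 \<le> p" unfolding P_def by (metis of_nat_le_iff of_nat_power)
  define X where "X = sq_sums k A'"
  define x where "x = real (card X)"
  have "real 2 < real p" using P60 by (simp add: P_def)
  then have p2: "2 < p" by simp
  have "grow_const * real (card A') powr (2 - 1 / 2^(k - 1)) \<le> real (card (sq_sums (Suc (k - 1)) A'))"
    using A' Np \<open>N > 0\<close> by (intro card_sq_sums[OF ch p2]) (auto intro: finite_subset)
  then have "grow_const * real N powr (2 - 1 / 2^(k - 1)) \<le> x" using k A'(2) by (simp add: X_def x_def)
  moreover have "q ^ 3 \<le> real N powr (2 - 1 / 2^(k - 1))"
  proof -
    have "q^3 = P powr (3/5)"
      using P1 by (simp add: q_def powr_realpow[symmetric] powr_powr)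
    also have "\<dots> = P powr (e * (2 - 1 / 2^(k - 1)))" by (simp only: e(3))
    also have "\<dots> = (P powr e) powr (2 - 1 / 2^(k - 1))" by (simp add: powr_powr)
    also have "\<dots> \<le> real N powr (2 - 1 / 2^(k - 1))"
    proof (rule powr_mono2)
      have "1 / 2^(k - 1) \<le> (1::real)" by simp
      then show "0 \<le> 2 - 1 / (2::real)^(k - 1)" by linarith
    qed (use N1 in auto)
    finally show ?thesis .
  qed
  moreover have "grow_const > 0" by (simp add: grow_const_def)
  ultimately have "grow_const * q^3 \<le> x" by (smt (verit) mult_left_mono)
  then have xq: "q^3 \<le> 20000^2 * x" by (simp add: grow_const_def)
  have q36: "q^3 \<ge> 10^36" using power_mono[OF q12, of 3] by simp
  have x4: "x \<ge> 4" using xq q36 by simp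
  have "P \<le> x^3"
  proof -
    have "(q^3)^3 \<le> (20000^2 * x)^3" using xq q by (intro power_mono) auto
    then have "q^4 * P \<le> 20000^6 * x^3" using q(2) by (simp add: power_mult_distrib eval_nat_numeral ac_simps)
    moreover have "q^4 \<ge> 20000^6" using power_mono[OF q12, of 4] by simp
    then have "20000^6 * P \<le> q^4 * P" using P1 by (intro mult_right_mono) auto
    ultimately have "20000^6 * P \<le> 20000^6 * x^3" by linarith
    then show ?thesis by simp
  qed
  then have p3: "p \<le> card X ^ 3" unfolding P_def x_def by (metis of_nat_le_iff of_nat_power)
  have sqrt: "sqrt P ^ 3 \<le> 20000^5 * sqrt x ^ 5"
  proof -
    have "sqrt q ^ 3 = sqrt (q^3)" by (simp add: real_sqrt_power)
    also have "\<dots> \<le> sqrt (20000^2 * x)" using xq by simp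
    also have "\<dots> = 20000 * sqrt x" by (simp add: real_sqrt_mult)
    finally have "(sqrt q ^ 3) ^ 5 \<le> (20000 * sqrt x) ^ 5" using q by (intro power_mono) auto
    moreover have "sqrt P = sqrt q ^ 5" unfolding q(2)[symmetric] by (simp add: real_sqrt_power)
    ultimately show ?thesis by (simp add: power_mult[symmetric] power_mult_distrib)
  qed
  have "final_const * P \<le>
    real (card {(a + b) * (c + d) |a b c d. a \<in> X \<and> b \<in> X \<and> c \<in> X \<and> d \<in> X})"
    using card_products_of_sums[of X "20000^5", folded p_def, OF ch p2 p3]
      x4 sqrt by (simp add: final_const_def P_def x_def)
  also have "\<dots> \<le> real (card {v * w |v w. v \<in> sq_sums (2 * k) A \<and> w \<in> sq_sums (2 * k) A})"
  proof -
    have "sq_sums (2 * k) A' \<subseteq> sq_sums (2 * k) A" using A' by (intro sq_sums_mono) auto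
    then have "a + b \<in> sq_sums (2 * k) A" if "a \<in> X" "b \<in> X" for a b
      using sq_sums_add[of a k A' b k] that by (auto simp: X_def mult_2)
    then show ?thesis by (intro of_nat_mono card_mono) (simp, blast)
  qed
  finally show ?thesis by (simp add: P_def)
qed

section \<open>From field elements to integer residues\<close>

lemma sq_sums_of_int:
  fixes A :: "int set"
  assumes "v \<in> sq_sums d (of_int ` A :: 'f::field set)"
  shows "\<exists>x\<in>PiE {..<d} (\<lambda>_. A). \<exists>y\<in>PiE {..<d} (\<lambda>_. A). v = of_int (\<Sum>i<d. (x i - y i)^2)"
  using assms
proof (induction d arbitrary: v)
  case 0
  then show ?case by simp
next
  case (Suc d)
  then obtain a b z where ab: "a \<in> A" "b \<in> A" "z \<in> sq_sums d (of_int ` A :: 'f set)"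
    "v = (of_int a - of_int b)^2 + z" by auto
  from Suc.IH[OF ab(3)] obtain x y where xy: "x \<in> PiE {..<d} (\<lambda>_. A)" "y \<in> PiE {..<d} (\<lambda>_. A)"
    "z = of_int (\<Sum>i<d. (x i - y i)^2)" by auto
  have "x(d := a) \<in> PiE {..<Suc d} (\<lambda>_. A)" "y(d := b) \<in> PiE {..<Suc d} (\<lambda>_. A)"
    using PiE_fun_upd[OF ab(1) xy(1)] PiE_fun_upd[OF ab(2) xy(2)] by (simp_all add: lessThan_Suc)
  moreover have "(\<Sum>i<Suc d. ((x(d := a)) i - (y(d := b)) i)^2) = (\<Sum>i<d. (x i - y i)^2) + (a - b)^2"
    by simp
  then have "v = of_int (\<Sum>i<Suc d. ((x(d := a)) i - (y(d := b)) i)^2)"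
    using ab(4) xy(3) by (simp only: of_int_add of_int_power of_int_diff add.commute)
  ultimately show ?case by blast
qed

definition product_bound :: "nat \<Rightarrow> bool" where
  "product_bound p \<longleftrightarrow> (\<forall>k\<ge>2. \<forall>A\<subseteq>{0..<int p}. 10^60 * real p powr growth_exponent k \<le> real (card A) \<longrightarrow>
    final_const * real p \<le> real (card (prod_set p (dist_set p (2*k) (PiE {..<2*k} (\<lambda>_. A))))))"

lemma product_bound_CARD: "product_bound CARD('a::prime_card)"
  unfolding product_bound_def
proof (intro allI impI)
  fix k :: nat and A :: "int set"
  let ?p = "CARD('a)" and ?h = "of_int :: int \<Rightarrow> 'a mod_ring"
  let ?D = "dist_set ?p (2*k) (PiE {..<2*k} (\<lambda>_. A))"
  assume k: "2 \<le> k" and A: "A \<subseteq> {0..<int ?p}" and big: "10^60 * real ?p powr growth_exponent k \<le> real (card A)"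
  have hmod: "?h (n mod int ?p) = ?h n" for n
    using of_int_mod_CHAR[of n, where 'a = "'a mod_ring"] by simp
  have "inj_on ?h A"
    by (rule inj_onI) (metis A atLeastLessThan_iff subsetD of_int_of_int_mod_ring to_int_mod_ring_of_int_mod_ring)
  then have cA: "card (?h ` A) = card A" by (rule card_image)
  have ch: "of_nat n \<noteq> (0::'a mod_ring)" if "0 < n" "n < ?p" for n
    using that by (auto simp: of_nat_eq_0_iff_char_dvd dest: nat_dvd_not_less)
  have D: "v \<in> ?h ` ?D" if "v \<in> sq_sums (2*k) (?h ` A)" for v
  proof -
    from sq_sums_of_int[OF that] obtain x y where xy: "x \<in> PiE {..<2*k} (\<lambda>_. A)" "y \<in> PiE {..<2*k} (\<lambda>_. A)"
      "v = ?h (\<Sum>i<2*k. (x i - y i)^2)" by blast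
    then have "v = ?h (ff_dist ?p (2*k) x y)" by (simp only: hmod ff_dist_def)
    moreover have "ff_dist ?p (2*k) x y \<in> ?D" using xy unfolding dist_set_def by blast
    ultimately show ?thesis by blast
  qed
  have sub: "{v * w |v w. v \<in> sq_sums (2*k) (?h ` A) \<and> w \<in> sq_sums (2*k) (?h ` A)} \<subseteq> ?h ` prod_set ?p ?D"
  proof
    fix z assume "z \<in> {v * w |v w. v \<in> sq_sums (2*k) (?h ` A) \<and> w \<in> sq_sums (2*k) (?h ` A)}"
    then obtain a b where ab: "a \<in> ?D" "b \<in> ?D" "z = ?h a * ?h b" using D by blast
    then have "z = ?h ((a * b) mod int ?p)" by (simp only: hmod of_int_mult)
    moreover have "(a * b) mod int ?p \<in> prod_set ?p ?D" using ab by (auto simp: prod_set_def)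
    ultimately show "z \<in> ?h ` prod_set ?p ?D" by blast
  qed
  have "prod_set ?p ?D \<subseteq> {0..<int ?p}" by (auto simp: prod_set_def)
  then have fin: "finite (prod_set ?p ?D)" by (rule finite_subset) simp
  have "final_const * real ?p
      \<le> real (card {v * w |v w. v \<in> sq_sums (2*k) (?h ` A) \<and> w \<in> sq_sums (2*k) (?h ` A)})"
    using card_products_of_sq_sums[of k "?h ` A"] k big ch cA by simp
  also have "\<dots> \<le> real (card (prod_set ?p ?D))"
    using card_mono[OF finite_imageI[OF fin] sub] card_image_le[OF fin, of ?h] by simp
  finally show "final_const * real ?p \<le> real (card (prod_set ?p ?D))" .
qed

text \<open>
  The field with \<open>p\<close> elements is a type only if \<open>p\<close> is the cardinality of a type, whereas the
  theorem quantifies over \<open>p\<close>. It suffices to treat one closed term: a prime that violates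
  the bound if any prime does.
\<close>

definition critical_prime :: nat where
  "critical_prime = (SOME p. prime p \<and> ((\<exists>q. prime q \<and> \<not> product_bound q) \<longrightarrow> \<not> product_bound p))"

lemma critical_prime:
  "prime critical_prime"
  "prime q \<Longrightarrow> product_bound critical_prime \<Longrightarrow> product_bound q"
proof -
  have "\<exists>p. prime p \<and> ((\<exists>q. prime q \<and> \<not> product_bound q) \<longrightarrow> \<not> product_bound p)"
    using two_is_prime_nat by blast
  from someI_ex[OF this] show "prime critical_prime"
    "prime q \<Longrightarrow> product_bound critical_prime \<Longrightarrow> product_bound q"
    unfolding critical_prime_def by blast+
qed

typedef critical_index = "{..<critical_prime}"
  using prime_gt_0_nat[OF critical_prime(1)] by auto

lemma CARD_critical_index: "CARD(critical_index) = critical_prime"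
  using type_definition.card[OF type_definition_critical_index] by simp

instance critical_index :: prime_card
  by standard (simp add: CARD_critical_index critical_prime(1))

lemma product_bound_prime: "prime p \<Longrightarrow> product_bound p"
  using critical_prime(2) product_bound_CARD[where 'a = critical_index] CARD_critical_index by simp

theorem theorem1p5:
  fixes k :: nat
  assumes "k \<ge> 2"
  shows "\<exists>C::real. C > 0 \<and> (\<exists>c::real. c > 0 \<and>
    (\<forall>(p::nat) (A::int set).
       prime p \<and> odd p \<and> A \<subseteq> {0..<int p} \<and>
       real (card (PiE {..<2*k} (\<lambda>_. A)))
         \<ge> C * real p powr (real (2*k) / 2 -
               (real (2*k) / 2) * ((2 ^ (k+1) - 5) / (5 * 2 ^ k - 5)))
       \<longrightarrow> real (card (prod_set p (dist_set p (2*k) (PiE {..<2*k} (\<lambda>_. A))))) \<ge> c * real p))"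
proof (rule exI[of _ "(10^60)^(2*k)"], rule conjI[OF _ exI[of _ final_const]], goal_cases)
  case 2
  have "final_const > 0" by (simp add: final_const_def)
  then show ?case
  proof (intro conjI allI impI)
    fix p :: nat and A :: "int set"
    let ?e = "real (2*k) / 2 - (real (2*k) / 2) * ((2 ^ (k+1) - 5) / (5 * 2 ^ k - 5))"
    assume *: "prime p \<and> odd p \<and> A \<subseteq> {0..<int p} \<and>
      real (card (PiE {..<2*k} (\<lambda>_. A))) \<ge> (10^60)^(2*k) * real p powr ?e"
    have p0: "real p > 0" using * by (simp add: prime_gt_0_nat)
    have t: "(2::real)^k \<ge> 4" using power_increasing[OF assms, of "2::real"] by simp
    \<comment> \<open>Since \<open>|E| = |A| ^ (2 * k)\<close>, the hypothesis is the
      \<open>2 * k\<close>-th power of a lower bound for \<open>|A|\<close>; this is why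
      \<open>C\<close> is chosen as a \<open>2 * k\<close>-th power.\<close>
    have "?e = growth_exponent k * real (2*k)"
      using t by (simp add: growth_exponent_def field_simps)
    then have "real p powr ?e = (real p powr growth_exponent k) ^ (2*k)"
      using p0 by (simp only: powr_powr[symmetric] powr_realpow powr_gt_zero)
    moreover have "card (PiE {..<2*k} (\<lambda>_. A)) = card A ^ (2*k)" by (simp add: card_PiE)
    ultimately have "(10^60 * real p powr growth_exponent k) ^ (2*k) \<le> real (card A) ^ (2*k)"
      using * by (simp only: power_mult_distrib of_nat_power)
    then have "10^60 * real p powr growth_exponent k \<le> real (card A)"
      using assms power_mono_iff[of "10^60 * real p powr growth_exponent k" "real (card A)" "2*k"] by simp
    then show "final_const * real p \<le> real (card (prod_set p (dist_set p (2*k) (PiE {..<2*k} (\<lambda>_. A)))))"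
      using product_bound_prime[of p] * assms unfolding product_bound_def by blast
  qed
qed simp

end
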